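(* Let $T>0$ and let $f^T$ satisfy the standing assumptions in the context. Assume there exists a pulsating front $(c,U)$, i.e. $c\in\mathbb{R}$ and $U:\mathbb{R}\times\mathbb{R}\to[0,1]$ with $$\begin{cases} U_t-cU_\xi-U_{\xi\xi}-f^T(t,U)=0, & \forall (t,\xi)\in\mathbb{R}\times\mathbb{R},\\ U(\cdot,-\infty)=1,\quad U(\cdot,+\infty)=0, & \text{uniformly on }\mathbb{R},\\ U(t+T,\xi)=U(t,\xi), & \forall (t,\xi)\in\mathbb{R}\times\mathbb{R}.\end{cases}$$ There exists a constant $\gamma\in(0,1)$ depending only on $f^T$ such that the following holds. Let $h:\mathbb{R}\to[0,1]$ be uniformly continuous, let $u$ be the solution of the Cauchy problem $$\begin{cases} u_t-u_{xx}=f^T(t,u), & \forall t>0,\ \forall x\in\mathbb{R},\\ u(0,x)=h(x), & \forall x\in\mathbb{R},\end{cases}$$ and set $v(t,\xi)=u(t,\xi+ct)$. If $$\liminf_{\xi\to-\infty}h(\xi)>1-\gamma\quad\text{and}\quad\limsup_{\xi\to+\infty}h(\xi)<\gamma,$$ then there exists $\xi_0\in\mathbb{R}$ such that $$\lim_{t\to+\infty}\big(v(t,\xi)-U(t,\xi+\xi_0)\big)=0\quad\text{uniformly for }\xi\in\mathbb{R}.$$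
   Context: Standing assumptions on $f^T$: $f^T:\mathbb{R}\times[0,1]\to\mathbb{R}$, $(t,u)\mapsto f^T(t,u)$, is of class $\mathcal{C}^1$ with respect to $t$ uniformly for $u\in[0,1]$ and of class $\mathcal{C}^2$ with respect to $u$ uniformly for $t\in\mathbb{R}$; $f^T(t+T,u)=f^T(t,u)$ for all $t\in\mathbb{R}$, $u\in[0,1]$; $f^T(t,0)=f^T(t,1)=0$ for all $t\in\mathbb{R}$; and $$\frac1T\int_0^T f^T_u(s,0)\,ds<0,\qquad \frac1T\int_0^T f^T_u(s,1)\,ds<0,$$ where $f^T_u$ is the partial derivative with respect to $u$. Solutions are classical and take values in $[0,1]$. *)

theory Defs
  imports "HOL-Analysis.Analysis"
begin

text \<open>
  The nonlinearity \<open>f t u\<close> is only meaningful for \<open>u \<in> [0,1]\<close>, so its \<open>u\<close>-derivatives are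
  taken within \<open>[0,1]\<close>, i.e. they are one-sided at \<open>u = 0\<close> and \<open>u = 1\<close>.
\<close>

definition f_t :: "(real \<Rightarrow> real \<Rightarrow> real) \<Rightarrow> real \<Rightarrow> real \<Rightarrow> real" where
  "f_t f t u = deriv (\<lambda>s. f s u) t"

definition f_u :: "(real \<Rightarrow> real \<Rightarrow> real) \<Rightarrow> real \<Rightarrow> real \<Rightarrow> real" where
  "f_u f t u = vector_derivative (f t) (at u within {0..1})"

definition f_uu :: "(real \<Rightarrow> real \<Rightarrow> real) \<Rightarrow> real \<Rightarrow> real \<Rightarrow> real" where
  "f_uu f t u = vector_derivative (f_u f t) (at u within {0..1})"

text \<open>
  ``Of class \<open>C\<^sup>k\<close> in one variable uniformly in the other'': the derivatives up to order \<open>k\<close>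
  exist and the \<open>k\<close>-th one is continuous in the first variable, uniformly with respect to the
  second. For functions that are periodic in \<open>t\<close> and vanish at \<open>u = 0, 1\<close>, the two conditions
  together make \<open>f_t\<close>, \<open>f_u\<close> and \<open>f_uu\<close> bounded and jointly continuous.
\<close>

definition C1_in_t_uniformly :: "(real \<Rightarrow> real \<Rightarrow> real) \<Rightarrow> bool" where
  "C1_in_t_uniformly f \<longleftrightarrow>
     (\<forall>t. \<forall>u\<in>{0..1}. (\<lambda>s. f s u) differentiable (at t)) \<and>
     (\<forall>t. uniform_limit {0..1} (\<lambda>s u. f_t f s u) (\<lambda>u. f_t f t u) (at t))"

definition C2_in_u_uniformly :: "(real \<Rightarrow> real \<Rightarrow> real) \<Rightarrow> bool" where
  "C2_in_u_uniformly f \<longleftrightarrow>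
     (\<forall>t. \<forall>u\<in>{0..1}. f t differentiable (at u within {0..1})) \<and>
     (\<forall>t. \<forall>u\<in>{0..1}. f_u f t differentiable (at u within {0..1})) \<and>
     (\<forall>u\<in>{0..1}. uniform_limit UNIV (\<lambda>w t. f_uu f t w) (\<lambda>t. f_uu f t u) (at u within {0..1}))"

definition bistable_on_average :: "real \<Rightarrow> (real \<Rightarrow> real \<Rightarrow> real) \<Rightarrow> bool" where
  "bistable_on_average T f \<longleftrightarrow>
     C1_in_t_uniformly f \<and> C2_in_u_uniformly f \<and>
     (\<forall>t. \<forall>u\<in>{0..1}. f (t + T) u = f t u) \<and>
     (\<forall>t. f t 0 = 0 \<and> f t 1 = 0) \<and>
     1 / T * integral {0..T} (\<lambda>s. f_u f s 0) < 0 \<and>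
     1 / T * integral {0..T} (\<lambda>s. f_u f s 1) < 0"

definition D_t :: "(real \<Rightarrow> real \<Rightarrow> real) \<Rightarrow> real \<Rightarrow> real \<Rightarrow> real" where
  "D_t w t x = deriv (\<lambda>s. w s x) t"

definition D_x :: "(real \<Rightarrow> real \<Rightarrow> real) \<Rightarrow> real \<Rightarrow> real \<Rightarrow> real" where
  "D_x w t x = deriv (w t) x"

definition D_xx :: "(real \<Rightarrow> real \<Rightarrow> real) \<Rightarrow> real \<Rightarrow> real \<Rightarrow> real" where
  "D_xx w t x = deriv (D_x w t) x"

text \<open>The regularity of a classical solution on \<open>I \<times> \<real>\<close>, for an open set \<open>I\<close> of times.\<close>

definition C12_on :: "real set \<Rightarrow> (real \<Rightarrow> real \<Rightarrow> real) \<Rightarrow> bool" where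
  "C12_on I w \<longleftrightarrow>
     (\<forall>t\<in>I. \<forall>x. (\<lambda>s. w s x) differentiable (at t) \<and>
        w t differentiable (at x) \<and> D_x w t differentiable (at x)) \<and>
     (\<forall>g\<in>{w, D_t w, D_x w, D_xx w}. continuous_on (I \<times> UNIV) (\<lambda>(t, x). g t x))"

definition pulsating_front ::
    "real \<Rightarrow> (real \<Rightarrow> real \<Rightarrow> real) \<Rightarrow> real \<Rightarrow> (real \<Rightarrow> real \<Rightarrow> real) \<Rightarrow> bool" where
  "pulsating_front T f c U \<longleftrightarrow>
     C12_on UNIV U \<and>
     (\<forall>t \<xi>. U t \<xi> \<in> {0..1}) \<and>
     (\<forall>t \<xi>. D_t U t \<xi> - c * D_x U t \<xi> - D_xx U t \<xi> - f t (U t \<xi>) = 0) \<and>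
     uniform_limit UNIV (\<lambda>\<xi> t. U t \<xi>) (\<lambda>t. 1) at_bot \<and>
     uniform_limit UNIV (\<lambda>\<xi> t. U t \<xi>) (\<lambda>t. 0) at_top \<and>
     (\<forall>t \<xi>. U (t + T) \<xi> = U t \<xi>)"

text \<open>
  The values of \<open>u\<close> at negative times are irrelevant. Continuity up to \<open>t = 0\<close> is what ties the
  solution to its initial datum.
\<close>

definition cauchy_solution ::
    "(real \<Rightarrow> real \<Rightarrow> real) \<Rightarrow> (real \<Rightarrow> real) \<Rightarrow> (real \<Rightarrow> real \<Rightarrow> real) \<Rightarrow> bool" where
  "cauchy_solution f h u \<longleftrightarrow>
     continuous_on ({0..} \<times> UNIV) (\<lambda>(t, x). u t x) \<and>
     C12_on {0<..} u \<and>
     (\<forall>t\<ge>0. \<forall>x. u t x \<in> {0..1}) \<and>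
     (\<forall>t>0. \<forall>x. D_t u t x - D_xx u t x = f t (u t x)) \<and>
     (\<forall>x. u 0 x = h x)"

end

theory Submission
  imports Defs
begin

text \<open>
  Everything rests on the maximum principle in the moving frame; no compactness of families of
  solutions is used. Solutions are Lipschitz in space (doubling of variables), positivity of a
  difference of solutions spreads (an explicit barrier), and in the tails, where both solutions are
  close to the same rest state, differences decay exponentially by bistability on average. Sliding then
  shows that \<open>U\<close> is strictly decreasing in \<open>\<xi>\<close>, and an iteration with summable shifts gives its
  stability. The initial condition traps the solution asymptotically between two shifts of \<open>U\<close>. For the
  smallest shift that is asymptotically above it, the solution must come close to that shift on long time
  windows and large intervals, for otherwise the shift could be decreased; the tails follow, and
  stability gives convergence. Lower bounds come from the symmetry
  \<open>u \<mapsto> 1 - u\<close>, \<open>\<xi> \<mapsto> - \<xi>\<close>, \<open>c \<mapsto> - c\<close>.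
\<close>

section \<open>Residuals and the maximum principle\<close>

text \<open>The sign of \<open>f_u\<close> at a rest state may change during a period, so
  neighbourhoods of 0 and 1 need not be invariant. Tail estimates therefore lose a factor
  \<open>exp (2 * B)\<close>, where \<open>B\<close> bounds the primitives of the centred
  derivatives. This is the origin of \<gamma>: a supersolution started from \<gamma> has to remain
  in \<open>[0, g]\<close>, where the one-sided linear bound holds. The numbers \<open>K\<close>,
  \<open>g\<close>, \<open>\<mu>\<close>, \<open>B\<close> are extracted from \<open>f\<close>
  before any front is fixed. In place of compactness, the Lipschitz constant \<open>M\<close> and
  the spreading factor \<eta> depend neither on the solutions nor on the starting time, and a
  minimum over one period of \<open>U\<close> is a minimum over all times. The delicate point is
  that closeness on a bounded interval at one instant says nothing about the tails. Spreading is
  read backwards there: a gap at an earlier time would still be visible later, so smallness at one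
  instant forces smallness throughout a preceding window. If that window is long, the tails have
  decayed by its end, and one instant of global closeness is all that stability requires.\<close>

text \<open>\<open>residual c w t x r\<close> says that \<open>w\<^sub>t - c w\<^sub>x - w\<^sub>x\<^sub>x\<close> exists at \<open>(t, x)\<close> and equals \<open>r\<close>.
  As a relation it is linear in \<open>(w, r)\<close> without any side conditions on differentiability.\<close>

definition residual :: "real \<Rightarrow> (real \<Rightarrow> real \<Rightarrow> real) \<Rightarrow> real \<Rightarrow> real \<Rightarrow> real \<Rightarrow> bool" where
  "residual c w t x r \<longleftrightarrow> (\<exists>wt wx wxx. ((\<lambda>s. w s x) has_real_derivative wt) (at t) \<and>
     (\<forall>y. (w t has_real_derivative wx y) (at y)) \<and> (wx has_real_derivative wxx) (at x) \<and>
     r = wt - c * wx x - wxx)"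

lemma residualI:
  assumes "((\<lambda>s. w s x) has_real_derivative wt) (at t)"
    and "\<And>y. (w t has_real_derivative wx y) (at y)"
    and "(wx has_real_derivative wxx) (at x)" and "r = wt - c * wx x - wxx"
  shows "residual c w t x r"
  using assms unfolding residual_def by blast

lemma residual_diff:
  assumes "residual c v t x r" "residual c w t x s"
  shows "residual c (\<lambda>t x. v t x - w t x) t x (r - s)"
proof -
  obtain vt vx vxx where v: "((\<lambda>s. v s x) has_real_derivative vt) (at t)"
     "\<And>y. (v t has_real_derivative vx y) (at y)" "(vx has_real_derivative vxx) (at x)"
     "r = vt - c * vx x - vxx" using assms(1) unfolding residual_def by blast
  obtain wt wx wxx where w: "((\<lambda>s. w s x) has_real_derivative wt) (at t)"
     "\<And>y. (w t has_real_derivative wx y) (at y)" "(wx has_real_derivative wxx) (at x)"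
     "s = wt - c * wx x - wxx" using assms(2) unfolding residual_def by blast
  show ?thesis
    by (rule residualI[of _ _ "vt - wt" _ "\<lambda>y. vx y - wx y" "vxx - wxx"])
      (use v w in \<open>auto intro!: derivative_eq_intros simp: algebra_simps\<close>)
qed

lemma residual_cmult:
  assumes "residual c v t x r"
  shows "residual c (\<lambda>t x. k * v t x) t x (k * r)"
proof -
  obtain vt vx vxx where v: "((\<lambda>s. v s x) has_real_derivative vt) (at t)"
     "\<And>y. (v t has_real_derivative vx y) (at y)" "(vx has_real_derivative vxx) (at x)"
     "r = vt - c * vx x - vxx" using assms(1) unfolding residual_def by blast
  show ?thesis
    by (rule residualI[of _ _ "k * vt" _ "\<lambda>y. k * vx y" "k * vxx"])
      (use v in \<open>auto intro!: derivative_eq_intros simp: algebra_simps\<close>)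
qed

lemma residual_add:
  assumes "residual c v t x r" "residual c w t x s"
  shows "residual c (\<lambda>t x. v t x + w t x) t x (r + s)"
  using residual_diff[OF assms(1) residual_cmult[OF assms(2), of "-1"]] by simp

lemma residual_time:
  assumes "(\<phi> has_real_derivative d) (at t)"
  shows "residual c (\<lambda>t x. \<phi> t) t x d"
  by (rule residualI[of _ _ d _ "\<lambda>_. 0" 0]) (use assms in auto)

lemma residual_shift:
  assumes "residual c v t (x + s) r"
  shows "residual c (\<lambda>t x. v t (x + s)) t x r"
proof -
  obtain vt vx vxx where v: "((\<lambda>\<tau>. v \<tau> (x + s)) has_real_derivative vt) (at t)"
     "\<And>y. (v t has_real_derivative vx y) (at y)" "(vx has_real_derivative vxx) (at (x + s))"
     "r = vt - c * vx (x + s) - vxx" using assms(1) unfolding residual_def by blast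
  show ?thesis
    by (rule residualI[of _ _ vt _ "\<lambda>y. vx (y + s)" vxx])
      (use v(1) v(2)[THEN DERIV_shift[THEN iffD1]] v(3)[THEN DERIV_shift[THEN iffD1]] v(4) in auto)
qed

lemma residual_reflect:
  assumes "residual c v t (- x) r"
  shows "residual (- c) (\<lambda>t x. v t (- x)) t x r"
proof -
  obtain vt vx vxx where v: "((\<lambda>\<tau>. v \<tau> (- x)) has_real_derivative vt) (at t)"
     "\<And>y. (v t has_real_derivative vx y) (at y)" "(vx has_real_derivative vxx) (at (- x))"
     "r = vt - c * vx (- x) - vxx" using assms(1) unfolding residual_def by blast
  have 1: "((\<lambda>x. v t (- x)) has_real_derivative - vx (- y)) (at y)" for y
    using DERIV_mirror[of "v t" "vx (-y)" y] v(2)[of "-y"] by simp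
  have "((\<lambda>x. vx (- x)) has_real_derivative - vxx) (at x)"
    using DERIV_mirror[of vx vxx x] v(3) by simp
  then have 2: "((\<lambda>x. - vx (- x)) has_real_derivative vxx) (at x)"
    using DERIV_minus by fastforce
  show ?thesis
    by (rule residualI[OF v(1) 1 2]) (use v in auto)
qed

text \<open>The second derivative is assumed at the single point \<open>x\<close>, which is what
  \<open>residual\<close> provides. If \<open>l\<close> were positive, \<open>g\<close> would be
  positive just to the right of its zero \<open>x\<close>, and the mean value theorem would make
  \<phi> exceed its maximum there.\<close>

lemma second_derivative_test:
  fixes \<phi> g :: "real \<Rightarrow> real"
  assumes \<phi>: "\<And>y. (\<phi> has_real_derivative g y) (at y)"
    and g: "(g has_real_derivative l) (at x)"
    and d: "0 < d" and max: "\<And>y. \<bar>y - x\<bar> < d \<Longrightarrow> \<phi> y \<le> \<phi> x"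
  shows "g x = 0" "l \<le> 0"
proof -
  show g0: "g x = 0"
    using DERIV_local_max[OF \<phi> d] max by (simp add: abs_minus_commute)
  show "l \<le> 0"
  proof (rule ccontr)
    assume "\<not> l \<le> 0"
    then obtain e where e: "e > 0" "\<And>h. h > 0 \<Longrightarrow> h < e \<Longrightarrow> g x < g (x + h)"
      using DERIV_pos_inc_right[OF g] by auto
    define h where "h = min d e / 2"
    have h: "0 < h" "h < d" "h < e" using d e by (auto simp: h_def)
    obtain z where z: "x < z" "z < x + h" "\<phi> (x + h) - \<phi> x = h * g z"
      using MVT2[of x "x + h" \<phi> g] \<phi> h by auto
    have "g z > 0" using e(2)[of "z - x"] z h g0 by auto
    then have "\<phi> (x + h) > \<phi> x" using z(3) h mult_pos_pos[of h "g z"] by linarith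
    then show False using max[of "x + h"] h by auto
  qed
qed

text \<open>Only the past of \<open>t\<close> is compared, because a maximum over a time interval
  may sit at its right end.\<close>

lemma deriv_left_max:
  fixes \<phi> :: "real \<Rightarrow> real"
  assumes "(\<phi> has_real_derivative l) (at t)" "a < t"
    and "\<And>s. a \<le> s \<Longrightarrow> s \<le> t \<Longrightarrow> \<phi> s \<le> \<phi> t"
  shows "0 \<le> l"
proof (rule ccontr)
  assume "\<not> 0 \<le> l"
  then obtain e where e: "e > 0" "\<And>h. h > 0 \<Longrightarrow> h < e \<Longrightarrow> \<phi> t < \<phi> (t - h)"
    using DERIV_neg_dec_left[OF assms(1)] by auto
  define h where "h = min e (t - a) / 2"
  have "0 < h" "h < e" "a \<le> t - h" using e assms(2) by (auto simp: h_def field_simps min_def)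
  then show False using e(2)[of h] assms(3)[of "t - h"] by auto
qed

lemma drift_le:
  fixes c y :: real
  shows "c * (2 * y) \<le> \<bar>c\<bar> * (1 + y\<^sup>2)"
proof -
  have "c * (2 * y) \<le> \<bar>c\<bar> * (2 * \<bar>y\<bar>)"
    by (metis abs_le_D1 abs_mult abs_numeral order_refl)
  also have "\<dots> \<le> \<bar>c\<bar> * (1 + y\<^sup>2)"
  proof (rule mult_left_mono)
    show "2 * \<bar>y\<bar> \<le> 1 + y\<^sup>2"
      using zero_le_power2[of "\<bar>y\<bar> - 1"] by (simp add: power2_eq_square algebra_simps)
  qed simp
  finally show ?thesis .
qed

text \<open>\<open>D\<close> may be unbounded, so a small quadratic penalty forces the maximum to be
  attained on a compact set, where the derivative tests contradict \<open>pos\<close>. Asking that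
  points with \<open>W\<close> positive lie in \<open>interior D\<close> encodes the boundary
  condition.\<close>

lemma max_principle:
  fixes W :: "real \<Rightarrow> real \<Rightarrow> real"
  assumes D: "closed D" and cont: "continuous_on ({a..b} \<times> D) (\<lambda>(t, x). W t x)"
    and bdd: "\<And>t x. t \<in> {a..b} \<Longrightarrow> x \<in> D \<Longrightarrow> W t x \<le> N"
    and init: "\<And>x. x \<in> D \<Longrightarrow> W a x \<le> 0"
    and pos: "\<And>t x. a < t \<Longrightarrow> t \<le> b \<Longrightarrow> x \<in> D \<Longrightarrow> 0 < W t x \<Longrightarrow>
        x \<in> interior D \<and> (\<exists>r. residual c W t x r \<and> r \<le> K * W t x)"
    and K: "0 \<le> K" and t: "t \<in> {a..b}" and x: "x \<in> D"
  shows "W t x \<le> 0"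
proof (rule ccontr)
  assume "\<not> W t x \<le> 0"
  then have W0: "W t x > 0" by simp
  \<comment> \<open>The parts of \<open>m\<close> pay for the reaction bound, for the drift (through
    \<open>drift_le\<close>) and for the second derivative 2 of
    \<open>1 + x\<^sup>2\<close>.\<close>
  define m where "m = K + \<bar>c\<bar> + 3"
  define \<psi> where "\<psi> = (\<lambda>t x. exp (m * (t - a)) * (1 + x\<^sup>2))"
  \<comment> \<open>With this size, half of the supposed positive value survives the
    penalty.\<close>
  define \<epsilon> where "\<epsilon> = W t x / (2 * \<psi> t x)"
  have \<psi>pos: "\<psi> t x > 0" for t x
    by (simp add: \<psi>_def add_pos_nonneg)
  have \<epsilon>: "\<epsilon> > 0" using W0 \<psi>pos by (simp add: \<epsilon>_def)
  \<comment> \<open>The rate \<open>K + 1\<close> is one above the reaction bound, which leaves the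
    positive quantity \<open>Z\<close> alone on one side at the end.\<close>
  define V where "V = (\<lambda>t x. exp (- (K + 1) * (t - a)) * (W t x - \<epsilon> * \<psi> t x))"
  have \<psi>tx: "\<epsilon> * \<psi> t x = W t x / 2" using \<psi>pos[of t x] by (simp add: \<epsilon>_def)
  have V0: "V t x > 0" using W0 unfolding V_def \<psi>tx by simp
  define X where "X = max \<bar>x\<bar> (\<bar>N\<bar> / \<epsilon> + 1)"
  define Q where "Q = {a..b} \<times> (D \<inter> {-X..X})"
  have "compact Q" unfolding Q_def using D
    by (intro compact_Times) (auto simp: closed_Int_compact)
  moreover have "continuous_on Q (\<lambda>(t, x). V t x)"
  proof -
    have "continuous_on Q (\<lambda>(t, x). W t x)"
      using cont by (rule continuous_on_subset) (auto simp: Q_def)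
    then show ?thesis unfolding V_def \<psi>_def
      by (auto simp: case_prod_beta intro!: continuous_intros)
  qed
  moreover have mem: "(t, x) \<in> Q" using t x by (auto simp: Q_def X_def)
  ultimately obtain p where p: "p \<in> Q" "\<And>q. q \<in> Q \<Longrightarrow> (\<lambda>(t, x). V t x) q \<le> (\<lambda>(t, x). V t x) p"
    using continuous_attains_sup[of Q] by blast
  obtain s y where sy: "p = (s, y)" by (cases p)
  have s: "a \<le> s" "s \<le> b" and y: "y \<in> D" using p(1) by (auto simp: sy Q_def)
  have max1: "V \<tau> z \<le> V s y" if "(\<tau>, z) \<in> Q" for \<tau> z using p(2)[OF that] by (simp add: sy)
  have Vs: "V s y > 0" using max1[OF mem] V0 by simp
  have maxV: "V \<tau> z \<le> V s y" if h: "\<tau> \<in> {a..b}" "z \<in> D" for \<tau> z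
  proof (cases "\<bar>z\<bar> \<le> X")
    case True
    with h have "(\<tau>, z) \<in> Q" by (auto simp: Q_def)
    then show ?thesis by (rule max1)
  next
    case False
    then have z: "\<bar>z\<bar> > \<bar>N\<bar> / \<epsilon> + 1" by (auto simp: X_def)
    have "\<bar>z\<bar> \<ge> 1" using z \<epsilon> by (smt (verit) divide_nonneg_pos)
    then have "\<bar>z\<bar> \<le> z\<^sup>2" by (metis abs_ge_zero mult_left_mono mult.right_neutral power2_abs power2_eq_square)
    then have "\<bar>N\<bar> / \<epsilon> \<le> 1 + z\<^sup>2" using z by linarith
    then have "\<bar>N\<bar> \<le> \<epsilon> * (1 + z\<^sup>2)" using \<epsilon> by (simp add: field_simps)
    also have "\<dots> \<le> \<epsilon> * \<psi> \<tau> z"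
    proof -
      have "1 \<le> exp (m * (\<tau> - a))" using h K by (simp add: m_def)
      then have "1 * (1 + z\<^sup>2) \<le> \<psi> \<tau> z" unfolding \<psi>_def by (intro mult_right_mono) auto
      then show ?thesis using \<epsilon> by simp
    qed
    finally have "W \<tau> z - \<epsilon> * \<psi> \<tau> z \<le> 0" using bdd[OF h] by linarith
    then have "V \<tau> z \<le> 0" unfolding V_def by (simp add: mult_nonneg_nonpos)
    then show ?thesis using Vs by linarith
  qed
  have Z: "0 < W s y - \<epsilon> * \<psi> s y" using Vs unfolding V_def by (simp add: zero_less_mult_iff)
  then have Wpos: "0 < W s y" using \<psi>pos[of s y] \<epsilon> by (smt (verit) mult_pos_pos)
  have as: "a < s" using init[OF y] Wpos s by (cases "s = a") auto
  obtain r where intr: "y \<in> interior D" and r: "residual c W s y r" "r \<le> K * W s y"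
    using pos[OF as s(2) y Wpos] by blast
  obtain e where e: "e > 0" "\<And>z. \<bar>z - y\<bar> < e \<Longrightarrow> z \<in> D"
    using intr unfolding mem_interior by (auto simp: subset_iff dist_real_def abs_minus_commute)
  obtain wt wx wxx where w: "((\<lambda>\<tau>. W \<tau> y) has_real_derivative wt) (at s)"
     "\<And>z. (W s has_real_derivative wx z) (at z)" "(wx has_real_derivative wxx) (at y)"
     "r = wt - c * wx y - wxx" using r(1) unfolding residual_def by blast
  define E where "E = exp (m * (s - a))"
  define Z where "Z = W s y - \<epsilon> * \<psi> s y"
  have d1: "((\<lambda>z. W s z - \<epsilon> * \<psi> s z) has_real_derivative (wx z - \<epsilon> * (E * (2 * z)))) (at z)" for z
    unfolding \<psi>_def E_def by (auto intro!: derivative_eq_intros w(2))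
  have d2: "((\<lambda>z. wx z - \<epsilon> * (E * (2 * z))) has_real_derivative (wxx - \<epsilon> * (E * 2))) (at y)"
    by (auto intro!: derivative_eq_intros w(3))
  have le: "W s z - \<epsilon> * \<psi> s z \<le> W s y - \<epsilon> * \<psi> s y" if "\<bar>z - y\<bar> < e" for z
    using maxV[of s z] e(2)[OF that] s unfolding V_def by simp
  from second_derivative_test[OF d1 d2 e(1) le]
  have sx: "wx y = \<epsilon> * (E * (2 * y))" and sxx: "wxx \<le> \<epsilon> * (E * 2)" by auto
  have dt: "((\<lambda>\<tau>. V \<tau> y) has_real_derivative
      (exp (- (K + 1) * (s - a)) * (wt - \<epsilon> * (m * E * (1 + y\<^sup>2)) - (K + 1) * Z))) (at s)"
    unfolding V_def \<psi>_def E_def Z_def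
    by (auto intro!: derivative_eq_intros w(1) simp: algebra_simps)
  have "0 \<le> exp (- (K + 1) * (s - a)) * (wt - \<epsilon> * (m * E * (1 + y\<^sup>2)) - (K + 1) * Z)"
    by (rule deriv_left_max[OF dt as]) (use maxV y s in auto)
  then have "(K + 1) * Z \<le> wt - \<epsilon> * (m * E * (1 + y\<^sup>2))"
    by (simp add: zero_le_mult_iff)
  also have "wt = r + c * wx y + wxx" using w(4) by simp
  also have "\<dots> \<le> K * W s y + \<epsilon> * E * (c * (2 * y) + 2)"
    using r(2) sx sxx by (simp add: algebra_simps)
  also have "K * W s y = K * Z + \<epsilon> * E * (K * (1 + y\<^sup>2))"
    unfolding Z_def \<psi>_def E_def by (simp add: algebra_simps)
  finally have "Z \<le> \<epsilon> * E * (K * (1 + y\<^sup>2) + c * (2 * y) + 2 - m * (1 + y\<^sup>2))"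
    by (simp add: algebra_simps)
  also have "\<dots> \<le> 0"
  proof -
    have "c * (2 * y) \<le> \<bar>c\<bar> * (1 + y\<^sup>2)" by (rule drift_le)
    then have "K * (1 + y\<^sup>2) + c * (2 * y) + 2 - m * (1 + y\<^sup>2) \<le> 0"
      unfolding m_def by (simp add: algebra_simps) (smt (verit) zero_le_power2)
    then show ?thesis using \<epsilon> by (simp add: E_def mult_nonneg_nonpos)
  qed
  finally show False using \<open>0 < W s y - \<epsilon> * \<psi> s y\<close> by (simp add: Z_def)
qed

section \<open>Solutions in the moving frame and their symmetries\<close>

definition sol :: "(real \<Rightarrow> real \<Rightarrow> real) \<Rightarrow> real \<Rightarrow> real \<Rightarrow> (real \<Rightarrow> real \<Rightarrow> real) \<Rightarrow> bool" where
  "sol f c a v \<longleftrightarrow> continuous_on ({a..} \<times> UNIV) (\<lambda>(t, x). v t x) \<and>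
     (\<forall>t\<ge>a. \<forall>x. 0 \<le> v t x \<and> v t x \<le> 1) \<and> (\<forall>t>a. \<forall>x. residual c v t x (f t (v t x)))"

lemma sol_later: "sol f c a v \<Longrightarrow> a \<le> b \<Longrightarrow> sol f c b v"
  unfolding sol_def by (auto elim!: continuous_on_subset)

lemma sol_cont: "sol f c a v \<Longrightarrow> a \<le> b \<Longrightarrow> continuous_on ({b..d} \<times> D) (\<lambda>(t, x). v t x)"
  unfolding sol_def by (auto elim!: continuous_on_subset)

lemma sol_range: "sol f c a v \<Longrightarrow> a \<le> t \<Longrightarrow> 0 \<le> v t x" "sol f c a v \<Longrightarrow> a \<le> t \<Longrightarrow> v t x \<le> 1"
  unfolding sol_def by auto

lemma sol_residual: "sol f c a v \<Longrightarrow> a < t \<Longrightarrow> residual c v t x (f t (v t x))"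
  unfolding sol_def by auto

lemma sol_shift:
  assumes "sol f c a v" shows "sol f c a (\<lambda>t x. v t (x + s))"
proof -
  have "continuous_on ({a..} \<times> UNIV) ((\<lambda>(t, x). v t x) \<circ> (\<lambda>(t, x). (t, x + s)))"
    using assms unfolding sol_def
    by (intro continuous_on_compose) (auto simp: case_prod_beta intro!: continuous_intros elim!: continuous_on_subset)
  then have "continuous_on ({a..} \<times> UNIV) (\<lambda>(t, x). v t (x + s))"
    by (simp add: o_def case_prod_beta)
  then show ?thesis using assms by (auto simp: sol_def residual_shift)
qed

lemma sol_reflect:
  assumes "sol f c a v" shows "sol f (- c) a (\<lambda>t x. v t (- x))"
proof -
  have "continuous_on ({a..} \<times> UNIV) ((\<lambda>(t, x). v t x) \<circ> (\<lambda>(t, x). (t, - x)))"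
    using assms unfolding sol_def
    by (intro continuous_on_compose) (auto simp: case_prod_beta intro!: continuous_intros elim!: continuous_on_subset)
  then have "continuous_on ({a..} \<times> UNIV) (\<lambda>(t, x). v t (- x))"
    by (simp add: o_def case_prod_beta)
  then show ?thesis using assms by (auto simp: sol_def residual_reflect)
qed

lemma sol_dual:
  assumes "sol f c a v" shows "sol (\<lambda>t u. - f t (1 - u)) (- c) a (\<lambda>t x. 1 - v t (- x))"
proof -
  note v = sol_reflect[OF assms]
  have "residual (- c) (\<lambda>t x. 1 - v t (- x)) t x (- f t (v t (- x)))" if "t > a" for t x
    using residual_diff[OF residual_time[OF DERIV_const] sol_residual[OF v that]] by simp
  then show ?thesis using v
    by (auto simp: sol_def case_prod_beta intro!: continuous_intros)
qed

section \<open>Comparison, Lipschitz bounds and spreading of positivity\<close>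

text \<open>
  \<open>a0\<close> and \<open>a1\<close> are \<open>f\<^sub>u(\<cdot>, 0)\<close> and \<open>f\<^sub>u(\<cdot>, 1)\<close> up to additive constants that give both the same mean
  \<open>- 2 \<mu>\<close>; hence their shifts by \<open>2 \<mu>\<close> have the bounded primitives \<open>P0\<close> and \<open>P1\<close>.
\<close>

locale reaction =
  fixes f :: "real \<Rightarrow> real \<Rightarrow> real" and K g \<mu> B :: real
    and a0 a1 P0 P1 :: "real \<Rightarrow> real"
  assumes K: "0 < K" and g: "0 < g" "g < 1/2" and \<mu>: "0 < \<mu>" and B: "0 \<le> B"
    and lip: "0 \<le> v \<Longrightarrow> v \<le> u \<Longrightarrow> u \<le> 1 \<Longrightarrow> \<bar>f t u - f t v\<bar> \<le> K * (u - v)"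
    and near0: "0 \<le> v \<Longrightarrow> v \<le> u \<Longrightarrow> u \<le> g \<Longrightarrow> f t u - f t v \<le> (a0 t + \<mu>) * (u - v)"
    and near1: "1 - g \<le> v \<Longrightarrow> v \<le> u \<Longrightarrow> u \<le> 1 \<Longrightarrow> f t u - f t v \<le> (a1 t + \<mu>) * (u - v)"
    and f0: "f t 0 = 0" and f1: "f t 1 = 0"
    and aK: "a0 t + \<mu> \<le> K" "a1 t + \<mu> \<le> K"
    and P0: "0 \<le> t \<Longrightarrow> (P0 has_real_derivative (a0 t + 2 * \<mu>)) (at t)"
    and P1: "0 \<le> t \<Longrightarrow> (P1 has_real_derivative (a1 t + 2 * \<mu>)) (at t)"
    and P0B: "0 \<le> t \<Longrightarrow> \<bar>P0 t\<bar> \<le> B" and P1B: "0 \<le> t \<Longrightarrow> \<bar>P1 t\<bar> \<le> B"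

text \<open>The two rest states exchange roles, so \<open>a0\<close>, \<open>P0\<close> and
  \<open>a1\<close>, \<open>P1\<close> are swapped. Both states share \<open>K\<close>,
  \<open>g\<close>, \<open>\<mu>\<close> and \<open>B\<close> precisely so that the reflected
  problem is an instance with the same constants and hence the same threshold.\<close>

lemma reaction_dual:
  assumes "reaction f K g \<mu> B a0 a1 P0 P1"
  shows "reaction (\<lambda>t u. - f t (1 - u)) K g \<mu> B a1 a0 P1 P0"
proof -
  interpret reaction f K g \<mu> B a0 a1 P0 P1 by fact
  show ?thesis
  proof
    fix v u t :: real
    show "\<bar>- f t (1 - u) - - f t (1 - v)\<bar> \<le> K * (u - v)" if "0 \<le> v" "v \<le> u" "u \<le> 1"
      using lip[of "1 - u" "1 - v" t] that by simp
    show "- f t (1 - u) - - f t (1 - v) \<le> (a1 t + \<mu>) * (u - v)" if "0 \<le> v" "v \<le> u" "u \<le> g"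
      using near1[of "1 - u" "1 - v" t] that by simp
    show "- f t (1 - u) - - f t (1 - v) \<le> (a0 t + \<mu>) * (u - v)" if "1 - g \<le> v" "v \<le> u" "u \<le> 1"
      using near0[of "1 - u" "1 - v" t] that by simp
  qed (use K g \<mu> B f0 f1 aK P0 P1 P0B P1B in auto)
qed

context reaction
begin

lemma lip_abs: "u \<in> {0..1} \<Longrightarrow> v \<in> {0..1} \<Longrightarrow> \<bar>f t u - f t v\<bar> \<le> K * \<bar>u - v\<bar>"
  using lip[of v u t] lip[of u v t] by (cases "v \<le> u") (auto simp: abs_minus_commute)

lemma residual_exp_time:
  "residual c (\<lambda>t x. q * exp (K * (t - a))) t x (K * (q * exp (K * (t - a))))"
  by (rule residual_time) (auto intro!: derivative_eq_intros)

text \<open>The reaction separates two solutions at most at the Lipschitz rate \<open>K\<close>, and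
  the error term grows at exactly this rate. Where the comparison fails, \<open>v1\<close> lies
  above \<open>v2\<close>, so the ordered bound \<open>lip\<close> applies.\<close>

lemma compare:
  assumes v1: "sol f c a v1" and v2: "sol f c a v2" and q: "0 \<le> q"
    and init: "\<And>x. v1 a x \<le> v2 a x + q" and t: "a \<le> t"
  shows "v1 t x \<le> v2 t x + q * exp (K * (t - a))"
proof -
  define W where "W = (\<lambda>t x. v1 t x - v2 t x - q * exp (K * (t - a)))"
  have "W t x \<le> 0"
  proof (rule max_principle[where W = W and D = UNIV and a = a and b = t and N = 1 and K = K and c = c])
    show "continuous_on ({a..t} \<times> UNIV) (\<lambda>(t, x). W t x)"
      using sol_cont[OF v1, of a t UNIV] sol_cont[OF v2, of a t UNIV] unfolding W_def case_prod_beta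
      by (auto intro!: continuous_intros)
    fix \<tau> y
    show "W \<tau> y \<le> 1" if "\<tau> \<in> {a..t}" "y \<in> UNIV"
    proof -
      have "0 \<le> q * exp (K * (\<tau> - a))" using q by simp
      then show ?thesis
      using sol_range[OF v1, of \<tau> y] sol_range[OF v2, of \<tau> y] that unfolding W_def by auto
    qed
    show "W a y \<le> 0" using init[of y] by (simp add: W_def)
    assume h: "a < \<tau>" "0 < W \<tau> y"
    let ?r = "f \<tau> (v1 \<tau> y) - f \<tau> (v2 \<tau> y) - K * (q * exp (K * (\<tau> - a)))"
    have "residual c W \<tau> y ?r"
      unfolding W_def by (intro residual_diff sol_residual[OF v1] sol_residual[OF v2] residual_exp_time h)
    moreover have "?r \<le> K * W \<tau> y"
    proof -
      have "v2 \<tau> y \<le> v1 \<tau> y" using h(2) q unfolding W_def by (smt (verit) exp_ge_zero mult_nonneg_nonneg)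
      then have "\<bar>f \<tau> (v1 \<tau> y) - f \<tau> (v2 \<tau> y)\<bar> \<le> K * (v1 \<tau> y - v2 \<tau> y)"
        using sol_range[OF v1, of \<tau> y] sol_range[OF v2, of \<tau> y] h(1) by (intro lip) auto
      then show ?thesis unfolding W_def by (simp add: algebra_simps)
    qed
    ultimately show "y \<in> interior UNIV \<and> (\<exists>r. residual c W \<tau> y r \<and> r \<le> K * W \<tau> y)" by auto
  qed (use t K in auto)
  then show ?thesis by (simp add: W_def)
qed

text \<open>\<open>M - 1\<close> is the concavity coefficient \<open>N\<close> of the barrier below.
  The equation \<open>4 * N = K + 2\<close> beats the reaction difference (at most \<open>K\<close>)
  and the time term 1 with 1 to spare; adding 1 lifts the barrier above the identity on
  \<open>[0, 1]\<close>.\<close>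

definition M :: real where "M = (K + 2) / 4 + 1"

text \<open>
  Doubling of variables: on the strip \<open>0 \<le> x - y \<le> 1\<close> the function \<open>v t x - v t y\<close> stays below the
  supersolution \<open>1 - (t - s) + M (x - y) - N (x - y)\<^sup>2\<close>, whose first term has vanished at \<open>t = s + 1\<close>.
  The drift cancels because the bound depends on \<open>x - y\<close> only.
\<close>

lemma lipschitz_right:
  assumes v: "sol f c a v" and t1: "a + 1 \<le> t1" and xy: "y1 \<le> x1"
  shows "v t1 x1 - v t1 y1 \<le> M * (x1 - y1)"
proof (cases "x1 - y1 \<le> 1")
  case False
  have "v t1 x1 - v t1 y1 \<le> 1"
    using sol_range[OF v, of t1 x1] sol_range[OF v, of t1 y1] t1 by auto
  also have "1 \<le> M * (x1 - y1)" using False K by (simp add: M_def) (smt (verit) mult_le_cancel_left1 divide_nonneg_pos mult_less_cancel_left1)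
  finally show ?thesis .
next
  case True
  define N where "N = (K + 2) / 4"
  define s where "s = t1 - 1"
  define m where "m = \<bar>c\<bar> + 2"
  define G where "G = (\<lambda>t. exp (m * (t - s)))"
  have N: "4 * N = K + 2" "M = N + 1" "0 < N" using K by (auto simp: N_def M_def)
  have as: "a \<le> s" "s \<le> t1" using t1 by (auto simp: s_def)
  have key: "v t1 x1 - v t1 y1 \<le> M * (x1 - y1) - N * (x1 - y1)\<^sup>2 + \<epsilon> * (G t1 * (1 + x1\<^sup>2))" if \<epsilon>: "0 < \<epsilon>" for \<epsilon>
  proof (rule ccontr)
    define W where "W = (\<lambda>t x y. v t x - v t y - (1 - (t - s)) - (M * (x - y) - N * (x - y)\<^sup>2)
       - \<epsilon> * (G t * (1 + x\<^sup>2)))"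
    assume "\<not> ?thesis"
    then have W0: "0 < W t1 x1 y1" by (simp add: W_def s_def)
    define X where "X = max \<bar>x1\<bar> (1 / \<epsilon> + 1)"
    \<comment> \<open>Penalising \<open>x\<close> alone gives compactness, since \<open>y\<close>
      stays within distance 1 of \<open>x\<close> on the strip.\<close>
    define Q where "Q = {s..t1} \<times> ({-X..X} \<times> {-X-1..X+1} \<inter> {p. 0 \<le> fst p - snd p \<and> fst p - snd p \<le> 1})"
    have "closed {p :: real \<times> real. 0 \<le> fst p - snd p \<and> fst p - snd p \<le> 1}"
      by (intro closed_Collect_conj closed_Collect_le continuous_intros)
    then have "compact Q" unfolding Q_def by (intro compact_Times compact_Int_closed) auto
    moreover have "continuous_on Q (\<lambda>(t, x, y). W t x y)"
    proof -
      have 1: "continuous_on Q ((\<lambda>(t, x). v t x) \<circ> (\<lambda>(t, x, y). (t, x)))"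
        using v as unfolding sol_def Q_def
        by (intro continuous_on_compose) (auto simp: case_prod_beta intro!: continuous_intros elim!: continuous_on_subset)
      have 2: "continuous_on Q ((\<lambda>(t, x). v t x) \<circ> (\<lambda>(t, x, y). (t, y)))"
        using v as unfolding sol_def Q_def
        by (intro continuous_on_compose) (auto simp: case_prod_beta intro!: continuous_intros elim!: continuous_on_subset)
      show ?thesis using 1 2 unfolding W_def G_def
        by (auto simp: case_prod_beta o_def intro!: continuous_intros)
    qed
    moreover have mem: "(t1, x1, y1) \<in> Q" using True xy as by (auto simp: Q_def X_def)
    ultimately obtain p where p: "p \<in> Q" "\<And>q. q \<in> Q \<Longrightarrow> (\<lambda>(t, x, y). W t x y) q \<le> (\<lambda>(t, x, y). W t x y) p"
      using continuous_attains_sup[of Q "\<lambda>(t, x, y). W t x y"] by blast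
    obtain t x y where txy: "p = (t, x, y)" by (cases p)
    have Wp: "0 < W t x y" using p(2)[OF mem] W0 by (simp add: txy)
    have t: "s \<le> t" "t \<le> t1" and xy: "0 \<le> x - y" "x - y \<le> 1" using p(1) by (auto simp: txy Q_def)
    have vr: "0 \<le> v t x" "v t x \<le> 1" if "s \<le> t" for t x using sol_range[OF v] that as by auto
    have pen: "0 < \<epsilon> * (G t * (1 + x\<^sup>2))" for t x
      using \<epsilon> by (simp add: G_def add_pos_nonneg)
    have maxW: "W \<tau> \<xi> \<eta> \<le> W t x y"
      if h: "\<tau> \<in> {s..t1}" "0 \<le> \<xi> - \<eta>" "\<xi> - \<eta> \<le> 1" for \<tau> \<xi> \<eta>
    proof (cases "\<bar>\<xi>\<bar> \<le> X")
      case True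
      then have "(\<tau>, \<xi>, \<eta>) \<in> Q" using h by (auto simp: Q_def)
      from p(2)[OF this] show ?thesis by (simp add: txy)
    next
      case False
      then have z: "\<bar>\<xi>\<bar> > 1 / \<epsilon> + 1" by (auto simp: X_def)
      have "\<bar>\<xi>\<bar> \<ge> 1" using z \<epsilon> by (smt (verit) divide_nonneg_pos)
      then have "\<bar>\<xi>\<bar> \<le> \<xi>\<^sup>2" by (metis abs_ge_zero mult_left_mono mult.right_neutral power2_abs power2_eq_square)
      then have "1 / \<epsilon> \<le> 1 + \<xi>\<^sup>2" using z by linarith
      then have "1 \<le> \<epsilon> * (1 + \<xi>\<^sup>2)" using \<epsilon> by (simp add: field_simps)
      also have "\<dots> \<le> \<epsilon> * (G \<tau> * (1 + \<xi>\<^sup>2))"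
      proof -
        have "1 \<le> G \<tau>" using h by (simp add: G_def m_def)
        then have "1 * (1 + \<xi>\<^sup>2) \<le> G \<tau> * (1 + \<xi>\<^sup>2)" by (intro mult_right_mono) auto
        then show ?thesis using \<epsilon> by simp
      qed
      finally have 1: "1 \<le> \<epsilon> * (G \<tau> * (1 + \<xi>\<^sup>2))" .
      have "N * (\<xi> - \<eta>)\<^sup>2 \<le> N * (\<xi> - \<eta>)" using h N(3)
        by (intro mult_left_mono) (auto simp: power2_eq_square mult_left_le)
      then have "0 \<le> M * (\<xi> - \<eta>) - N * (\<xi> - \<eta>)\<^sup>2" using h unfolding N(2) by (simp add: algebra_simps)
      then have "W \<tau> \<xi> \<eta> \<le> 0" using 1 vr[of \<tau> \<xi>] vr[of \<tau> \<eta>] h unfolding W_def s_def by auto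
      then show ?thesis using Wp by linarith
    qed
    define z where "z = x - y"
    have Nz: "N * z\<^sup>2 \<le> N * z" using xy N(3)
      by (intro mult_left_mono) (auto simp: power2_eq_square mult_left_le z_def)
    have Mz: "M * z - N * z\<^sup>2 \<ge> z" using Nz unfolding N(2) by (simp add: algebra_simps)
    \<comment> \<open>The maximum avoids every face except the final time: at the initial time and
      on \<open>z = 1\<close> the barrier is at least 1, on \<open>z = 0\<close> the difference of
      the values of \<open>v\<close> vanishes.\<close>
    have "t \<noteq> s"
    proof
      assume "t = s"
      then show False using Wp pen[of t x] vr[of t x] vr[of t y] t Mz xy unfolding W_def z_def by auto
    qed
    with t have st: "s < t" by simp
    have "z \<noteq> 0"
    proof
      assume "z = 0"
      then show False using Wp pen[of t x] t unfolding W_def z_def by (auto simp: s_def)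
    qed
    moreover have "z \<noteq> 1"
    proof
      assume "z = 1"
      then show False using Wp pen[of t x] t vr[of t x] vr[of t y] Mz unfolding W_def z_def
        by (auto simp: s_def)
    qed
    ultimately have z: "0 < z" "z < 1" using xy by (auto simp: z_def)
    define e where "e = min z (1 - z)"
    have e: "0 < e" using z by (auto simp: e_def)
    have at: "a < t" using as st by simp
    obtain vt vx vxx where V: "((\<lambda>s. v s x) has_real_derivative vt) (at t)"
     "\<And>y. (v t has_real_derivative vx y) (at y)" "(vx has_real_derivative vxx) (at x)"
     "f t (v t x) = vt - c * vx x - vxx" using sol_residual[OF v at, of x] unfolding residual_def by blast
    obtain wt wx wxx where U: "((\<lambda>s. v s y) has_real_derivative wt) (at t)"
     "\<And>y. (v t has_real_derivative wx y) (at y)" "(wx has_real_derivative wxx) (at y)"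
     "f t (v t y) = wt - c * wx y - wxx" using sol_residual[OF v at, of y] unfolding residual_def by blast
    have x1: "((\<lambda>x. W t x y) has_real_derivative
        (vx x - (M - 2 * N * (x - y)) - \<epsilon> * (G t * (2 * x)))) (at x)" for x
      unfolding W_def by (auto intro!: derivative_eq_intros V(2) simp: algebra_simps power2_eq_square)
    have x2: "((\<lambda>x. vx x - (M - 2 * N * (x - y)) - \<epsilon> * (G t * (2 * x)))
        has_real_derivative (vxx + 2 * N - \<epsilon> * (G t * 2))) (at x)"
      by (auto intro!: derivative_eq_intros V(3) simp: algebra_simps)
    have mx: "W t \<xi> y \<le> W t x y" if "\<bar>\<xi> - x\<bar> < e" for \<xi>
      by (rule maxW) (use t that in \<open>auto simp: e_def z_def\<close>)
    note X = second_derivative_test[OF x1 x2 e mx]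
    have y1: "((\<lambda>y. W t x y) has_real_derivative
        (- wx y + (M - 2 * N * (x - y)))) (at y)" for y
      unfolding W_def by (auto intro!: derivative_eq_intros U(2) simp: algebra_simps power2_eq_square)
    have y2: "((\<lambda>y. - wx y + (M - 2 * N * (x - y)))
        has_real_derivative (- wxx + 2 * N)) (at y)"
      by (auto intro!: derivative_eq_intros U(3) simp: algebra_simps)
    have my: "W t x \<xi> \<le> W t x y" if "\<bar>\<xi> - y\<bar> < e" for \<xi>
      by (rule maxW) (use t that in \<open>auto simp: e_def z_def\<close>)
    note Y = second_derivative_test[OF y1 y2 e my]
    have td: "((\<lambda>t. W t x y) has_real_derivative (vt - wt + 1 - \<epsilon> * (m * G t * (1 + x\<^sup>2)))) (at t)"
      unfolding W_def G_def by (auto intro!: derivative_eq_intros V(1) U(1) simp: algebra_simps)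
    have "0 \<le> vt - wt + 1 - \<epsilon> * (m * G t * (1 + x\<^sup>2))"
      by (rule deriv_left_max[OF td st]) (use maxW t xy in auto)
    moreover have "vt - wt = f t (v t x) - f t (v t y) + c * (vx x - wx y) + (vxx - wxx)"
      using V(4) U(4) by (simp add: algebra_simps)
    moreover have "vx x - wx y = \<epsilon> * (G t * (2 * x))" using X Y by (simp add: algebra_simps)
    \<comment> \<open>The tests in \<open>x\<close> and in \<open>y\<close> are made separately, and
      each contributes \<open>2 * N\<close>.\<close>
    moreover have "vxx - wxx \<le> - 4 * N + \<epsilon> * (G t * 2)" using X Y by (simp add: algebra_simps)
    moreover have "f t (v t x) - f t (v t y) \<le> K"
    proof -
      have "\<bar>f t (v t x) - f t (v t y)\<bar> \<le> K * \<bar>v t x - v t y\<bar>"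
        using vr t by (intro lip_abs) auto
      also have "\<dots> \<le> K * 1" using vr[of t x] vr[of t y] t K by (intro mult_left_mono) auto
      finally show ?thesis by simp
    qed
    ultimately have "0 \<le> - 1 + \<epsilon> * G t * (c * (2 * x) + 2 - m * (1 + x\<^sup>2))"
      using N(1) by (simp add: algebra_simps)
    moreover have "\<epsilon> * G t * (c * (2 * x) + 2 - m * (1 + x\<^sup>2)) \<le> 0"
    proof -
      have "c * (2 * x) \<le> \<bar>c\<bar> * (1 + x\<^sup>2)" by (rule drift_le)
      then have "c * (2 * x) + 2 - m * (1 + x\<^sup>2) \<le> 0"
        unfolding m_def by (simp add: algebra_simps) (smt (verit) zero_le_power2)
      then show ?thesis using \<epsilon> by (simp add: G_def mult_nonneg_nonpos)
    qed
    ultimately show False by linarith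
  qed
  have "v t1 x1 - v t1 y1 \<le> M * (x1 - y1) - N * (x1 - y1)\<^sup>2"
  proof (rule field_le_epsilon)
    fix e :: real assume e: "0 < e"
    have p: "0 < G t1 * (1 + x1\<^sup>2)" by (simp add: G_def add_pos_nonneg)
    show "v t1 x1 - v t1 y1 \<le> M * (x1 - y1) - N * (x1 - y1)\<^sup>2 + e"
      using key[of "e / (G t1 * (1 + x1\<^sup>2))"] p e
      by (smt (verit) divide_pos_pos nonzero_eq_divide_eq)
  qed
  also have "\<dots> \<le> M * (x1 - y1)" using N(3) by simp
  finally show ?thesis .
qed

text \<open>The opposite one-sided bound is the same bound for the reflected solution; its speed is
  \<open>- c\<close>, but \<open>M\<close> does not involve the speed. The unit waiting time is the
  price for data of arbitrary modulus of continuity.\<close>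

lemma lipschitz:
  assumes v: "sol f c a v" and t: "a + 1 \<le> t"
  shows "\<bar>v t x - v t y\<bar> \<le> M * \<bar>x - y\<bar>"
proof -

  have *: "\<bar>v t x - v t y\<bar> \<le> M * (x - y)" if "y \<le> x" for x y
  proof -
    have "v t x - v t y \<le> M * (x - y)" by (rule lipschitz_right[OF v t that])
    moreover have "v t y - v t x \<le> M * (- y - (- x))"
      using lipschitz_right[OF sol_reflect[OF v] t, of "-x" "-y"] that by simp
    ultimately show ?thesis by simp
  qed
  show ?thesis using *[of x y] *[of y x] by (cases "y \<le> x") (auto simp: abs_minus_commute)
qed

text \<open>
  A quantitative strong maximum principle. The barrier is \<open>exp (- l (t - s)) q\<^sup>3\<close> with
  \<open>q = (r + k (t - s))\<^sup>2 - (x - x0 + c (t - s))\<^sup>2\<close>; the odd power makes it smooth everywhere and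
  negative outside the expanding interval.
\<close>

definition spreads :: "real \<Rightarrow> real \<Rightarrow> real \<Rightarrow> real \<Rightarrow> real \<Rightarrow> real \<Rightarrow> bool" where
  "spreads c r \<tau> R L \<eta> \<longleftrightarrow> (\<forall>v1 v2 s \<epsilon> \<delta> x0 x t. sol f c s v1 \<longrightarrow> sol f c s v2 \<longrightarrow> 0 \<le> \<epsilon> \<longrightarrow> 0 \<le> \<delta> \<longrightarrow>
     (\<forall>x. v1 s x \<le> v2 s x + \<epsilon>) \<longrightarrow> (\<forall>x. \<bar>x - x0\<bar> \<le> r \<longrightarrow> \<delta> \<le> v2 s x - v1 s x) \<longrightarrow>
     \<bar>x - x0\<bar> \<le> R \<longrightarrow> s + \<tau> \<le> t \<longrightarrow> t \<le> s + L \<longrightarrow>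
     \<eta> * \<delta> - \<epsilon> * exp (K * L) \<le> v2 t x - v1 t x)"

lemma spreadsD:
  assumes "spreads c r \<tau> R L \<eta>" "sol f c s v1" "sol f c s v2" "0 \<le> \<epsilon>" "0 \<le> \<delta>"
    "\<And>x. v1 s x \<le> v2 s x + \<epsilon>" "\<And>x. \<bar>x - x0\<bar> \<le> r \<Longrightarrow> \<delta> \<le> v2 s x - v1 s x"
    "\<bar>x - x0\<bar> \<le> R" "s + \<tau> \<le> t" "t \<le> s + L"
  shows "\<eta> * \<delta> - \<epsilon> * exp (K * L) \<le> v2 t x - v1 t x"
  using assms unfolding spreads_def by blast

lemma spread:
  assumes r: "0 < r" and \<tau>: "0 < \<tau>"
  obtains \<eta> where "0 < \<eta>" and "spreads c r \<tau> R L \<eta>"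
proof -
  \<comment> \<open>The interval must expand fast enough to cover radius \<open>R\<close>, the drift
    accumulated up to time \<open>L\<close>, and one unit of margin, all within the delay
    \<tau>.\<close>
  define k where "k = (\<bar>R\<bar> + \<bar>c\<bar> * \<bar>L\<bar> + 1) / \<tau>"
  \<comment> \<open>In the residual of the barrier the \<open>c\<close> terms cancel, and
    \<open>(6 * \<rho> * k + 30) * Q\<close> is at most \<open>H * \<rho> * Q\<close> because
    \<open>r \<le> \<rho>\<close>. The 30 is 24 from rewriting the square of \<open>z\<close> as
    \<open>\<rho>\<^sup>2 - Q\<close>, plus 6 from the second derivative of \<open>q\<close>. The
    choice of \<open>l\<close> completes the square with \<open>24 * \<rho>\<^sup>2\<close>.\<close>
  define H where "H = 6 * k + 30 / r"
  define l where "l = K + H\<^sup>2 / 96"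
  \<comment> \<open>Division by \<open>r ^ 6\<close> normalises the initial height of the barrier to
    1; the exponential is its worst loss, and \<open>q\<close> is at least 1 at the points of
    interest.\<close>
  define \<eta> where "\<eta> = exp (- (l * \<bar>L\<bar>)) / r ^ 6"
  have k: "0 \<le> k" using \<tau> by (simp add: k_def)
  have l: "0 \<le> l" using K by (simp add: l_def)
  have "0 < \<eta>" using r by (simp add: \<eta>_def)
  moreover have "\<eta> * \<delta> - \<epsilon> * exp (K * L) \<le> v2 t x - v1 t x"
    if v1: "sol f c s v1" and v2: "sol f c s v2" and \<epsilon>: "0 \<le> \<epsilon>" and \<delta>: "0 \<le> \<delta>" and
       le: "\<And>x. v1 s x \<le> v2 s x + \<epsilon>" and init: "\<And>x. \<bar>x - x0\<bar> \<le> r \<Longrightarrow> \<delta> \<le> v2 s x - v1 s x"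
       and x: "\<bar>x - x0\<bar> \<le> R" and t: "s + \<tau> \<le> t" "t \<le> s + L"
     for v1 v2 s \<epsilon> \<delta> x0 x t
  proof -
    define q where "q = (\<lambda>t x. (r + k * (t - s))\<^sup>2 - (x - x0 + c * (t - s))\<^sup>2)"
    define \<psi> where "\<psi> = (\<lambda>t x. exp (- l * (t - s)) * q t x ^ 3)"
    define W where "W = (\<lambda>t x. (\<delta> / r ^ 6) * \<psi> t x - (v2 t x - v1 t x + \<epsilon> * exp (K * (t - s))))"
    have st: "s < t" using t \<tau> by linarith
    have "W t x \<le> 0"
    proof (rule max_principle[where W = W and D = UNIV and a = s and b = t and N = "(\<delta> / r ^ 6) * ((r + k * (t - s))\<^sup>2) ^ 3" and K = K and c = c])
      show "continuous_on ({s..t} \<times> UNIV) (\<lambda>(t, x). W t x)"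
        using sol_cont[OF v1, of s t UNIV] sol_cont[OF v2, of s t UNIV] r unfolding W_def \<psi>_def q_def case_prod_beta
        by (auto intro!: continuous_intros)
      \<comment> \<open>Comparison makes the corrected difference nonnegative. This bounds
        \<open>\<bar>v2 - v1\<bar>\<close> linearly in it, although \<open>v1\<close> and
        \<open>v2\<close> need not be ordered.\<close>
      have z0: "0 \<le> v2 \<tau> y - v1 \<tau> y + \<epsilon> * exp (K * (\<tau> - s))" if "s \<le> \<tau>" for \<tau> y
        using compare[OF v1 v2 \<epsilon> le that, of y] by simp
      fix \<tau> y
      show "W \<tau> y \<le> \<delta> / r ^ 6 * ((r + k * (t - s))\<^sup>2) ^ 3" if h: "\<tau> \<in> {s..t}"
      proof -
        have "(r + k * (\<tau> - s))\<^sup>2 \<le> (r + k * (t - s))\<^sup>2"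
          using h r k by (intro power_mono) (auto intro!: mult_left_mono)
        then have "q \<tau> y \<le> (r + k * (t - s))\<^sup>2" unfolding q_def by (smt (verit) zero_le_power2)
        then have 1: "q \<tau> y ^ 3 \<le> ((r + k * (t - s))\<^sup>2) ^ 3" by (intro power_mono_odd) auto
        have "\<psi> \<tau> y \<le> ((r + k * (t - s))\<^sup>2) ^ 3"
        proof (cases "0 \<le> q \<tau> y")
          case True
          have "\<psi> \<tau> y \<le> 1 * q \<tau> y ^ 3" unfolding \<psi>_def
            using True h l by (intro mult_right_mono) auto
          then show ?thesis using 1 by simp
        next
          case False
          then have "q \<tau> y ^ 3 \<le> 0" by (simp add: power_le_zero_eq)
          then have "\<psi> \<tau> y \<le> 0" unfolding \<psi>_def by (simp add: mult_nonneg_nonpos)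
          then show ?thesis by (smt (verit) zero_le_power2 zero_le_power)
        qed
        then have "(\<delta> / r ^ 6) * \<psi> \<tau> y \<le> \<delta> / r ^ 6 * ((r + k * (t - s))\<^sup>2) ^ 3"
          using \<delta> r by (intro mult_left_mono) auto
        then show ?thesis using z0[of \<tau> y] h unfolding W_def by auto
      qed
      show "W s y \<le> 0"
      proof (cases "\<bar>y - x0\<bar> \<le> r")
        case True
        have "q s y \<le> r\<^sup>2" by (simp add: q_def)
        then have "q s y ^ 3 \<le> (r\<^sup>2) ^ 3" by (intro power_mono_odd) auto
        then have "\<psi> s y \<le> r ^ 6" by (simp add: \<psi>_def flip: power_mult)
        then have "(\<delta> / r ^ 6) * \<psi> s y \<le> (\<delta> / r ^ 6) * r ^ 6" using \<delta> r by (intro mult_left_mono) auto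
        also have "\<dots> = \<delta>" using r by simp
        finally show ?thesis using init[OF True] \<epsilon> by (simp add: W_def)
      next
        case False
        then have "r\<^sup>2 \<le> (y - x0)\<^sup>2" using r by (simp add: abs_le_square_iff[symmetric])
        then have "q s y \<le> 0" by (simp add: q_def)
        then have "q s y ^ 3 \<le> 0" by (simp add: power_le_zero_eq)
        then have "\<psi> s y \<le> 0" by (simp add: \<psi>_def)
        then have "(\<delta> / r ^ 6) * \<psi> s y \<le> 0" using \<delta> r by (intro mult_nonneg_nonpos) auto
        then show ?thesis using le[of y] by (simp add: W_def)
      qed
      assume h: "s < \<tau>" "\<tau> \<le> t" "0 < W \<tau> y"
      define \<rho> where "\<rho> = r + k * (\<tau> - s)"
      define z where "z = y - x0 + c * (\<tau> - s)"
      define Q where "Q = q \<tau> y"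
      define E where "E = exp (- l * (\<tau> - s))"
      have Qe: "Q = \<rho>\<^sup>2 - z\<^sup>2" by (simp add: Q_def q_def \<rho>_def z_def)
      have qt: "((\<lambda>s. q s y) has_real_derivative 2 * \<rho> * k - 2 * z * c) (at \<tau>)"
        unfolding q_def \<rho>_def z_def by (auto intro!: derivative_eq_intros simp: algebra_simps)
      have qx: "(q \<tau> has_real_derivative - 2 * (y - x0 + c * (\<tau> - s))) (at y)" for y
        unfolding q_def by (auto intro!: derivative_eq_intros)
      have \<rho>: "r \<le> \<rho>" using h k by (simp add: \<rho>_def)
      let ?\<psi>r = "E * (- l * Q ^ 3 + 3 * Q\<^sup>2 * (2 * \<rho> * k - 2 * z * c)) - c * (E * (3 * Q\<^sup>2 * (- 2 * z)))
         - E * (6 * Q * (- 2 * z) * (- 2 * z) + 3 * Q\<^sup>2 * (- 2))"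
      have "residual c \<psi> \<tau> y ?\<psi>r"
      proof (rule residualI[where wx = "\<lambda>y. E * (3 * (q \<tau> y)\<^sup>2 * (- 2 * (y - x0 + c * (\<tau> - s))))"])
        show "((\<lambda>s. \<psi> s y) has_real_derivative E * (- l * Q ^ 3 + 3 * Q\<^sup>2 * (2 * \<rho> * k - 2 * z * c))) (at \<tau>)"
          unfolding \<psi>_def E_def Q_def
          by (rule derivative_eq_intros qt refl)+ (simp add: algebra_simps)
        show "(\<psi> \<tau> has_real_derivative E * (3 * (q \<tau> y)\<^sup>2 * (- 2 * (y - x0 + c * (\<tau> - s))))) (at y)" for y
          unfolding \<psi>_def E_def
          by (rule derivative_eq_intros qx refl)+ (simp add: algebra_simps)
        show "((\<lambda>y. E * (3 * (q \<tau> y)\<^sup>2 * (- 2 * (y - x0 + c * (\<tau> - s))))) has_real_derivative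
          E * (6 * Q * (- 2 * z) * (- 2 * z) + 3 * Q\<^sup>2 * (- 2))) (at y)"
          unfolding Q_def z_def
          by (rule derivative_eq_intros qx refl)+ (simp add: algebra_simps power2_eq_square)
      qed (simp add: Q_def z_def)
      \<comment> \<open>The inequality is checked only where \<open>W\<close> is positive. There the
        barrier is positive, so \<open>Q\<close> is positive and may be used as a factor.\<close>
      moreover have "?\<psi>r \<le> - K * \<psi> \<tau> y"
      proof -
        have "0 < \<delta> / r ^ 6 * \<psi> \<tau> y" using h(3) z0[of \<tau> y] h(1) unfolding W_def by auto
        then have "0 < \<psi> \<tau> y" using \<delta> r by (simp add: zero_less_mult_iff zero_less_divide_iff)
        then have "0 < q \<tau> y ^ 3" unfolding \<psi>_def by (simp add: zero_less_mult_iff)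
        then have Q: "0 < Q" by (simp add: Q_def zero_less_power_eq)
        have "?\<psi>r = E * Q * (- l * Q\<^sup>2 + (6 * \<rho> * k + 30) * Q - 24 * \<rho>\<^sup>2)"
          unfolding Qe by (simp add: power2_eq_square power3_eq_cube algebra_simps)
        also have "\<dots> \<le> E * Q * (- K * Q\<^sup>2)"
        proof (rule mult_left_mono)
          have "30 \<le> 30 / r * \<rho>" using \<rho> r by (simp add: field_simps)
          then have "(6 * \<rho> * k + 30) * Q \<le> (H * \<rho>) * Q"
            using Q unfolding H_def by (intro mult_right_mono) (auto simp: algebra_simps)
          moreover have "0 \<le> (H * Q - 48 * \<rho>)\<^sup>2 / 96" by simp
          ultimately show "- l * Q\<^sup>2 + (6 * \<rho> * k + 30) * Q - 24 * \<rho>\<^sup>2 \<le> - K * Q\<^sup>2"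
            unfolding l_def by (simp add: power2_eq_square algebra_simps add_divide_distrib diff_divide_distrib)
        qed (use Q in \<open>simp add: E_def\<close>)
        also have "\<dots> = - K * \<psi> \<tau> y" by (simp add: \<psi>_def E_def Q_def power2_eq_square power3_eq_cube)
        finally show ?thesis .
      qed
      moreover define \<psi>r where "\<psi>r = ?\<psi>r"
      ultimately have \<psi>r: "residual c \<psi> \<tau> y \<psi>r" "\<psi>r \<le> - K * \<psi> \<tau> y" by auto
      let ?z = "v2 \<tau> y - v1 \<tau> y + \<epsilon> * exp (K * (\<tau> - s))"
      let ?r = "(\<delta> / r ^ 6) * \<psi>r - (f \<tau> (v2 \<tau> y) - f \<tau> (v1 \<tau> y) + K * (\<epsilon> * exp (K * (\<tau> - s))))"
      have "residual c W \<tau> y ?r"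
        unfolding W_def by (intro residual_diff residual_add residual_cmult sol_residual[OF v1] sol_residual[OF v2] residual_exp_time h \<psi>r)
      moreover have "?r \<le> K * W \<tau> y"
      proof -
        have *: "- K * ?z \<le> f \<tau> (v2 \<tau> y) - f \<tau> (v1 \<tau> y) + K * (\<epsilon> * exp (K * (\<tau> - s)))"
        proof -
          have "\<bar>f \<tau> (v2 \<tau> y) - f \<tau> (v1 \<tau> y)\<bar> \<le> K * \<bar>v2 \<tau> y - v1 \<tau> y\<bar>"
            using sol_range[OF v1, of \<tau> y] sol_range[OF v2, of \<tau> y] h(1) by (intro lip_abs) auto
          moreover have "K * \<bar>v2 \<tau> y - v1 \<tau> y\<bar> \<le> K * (v2 \<tau> y - v1 \<tau> y + 2 * (\<epsilon> * exp (K * (\<tau> - s))))"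
          proof (rule mult_left_mono)
            have "0 \<le> \<epsilon> * exp (K * (\<tau> - s))" using \<epsilon> by simp
            then show "\<bar>v2 \<tau> y - v1 \<tau> y\<bar> \<le> v2 \<tau> y - v1 \<tau> y + 2 * (\<epsilon> * exp (K * (\<tau> - s)))"
              using z0[of \<tau> y] h(1) by auto
          qed (use K in simp)
          ultimately show ?thesis by (simp add: algebra_simps)
        qed
        have "(\<delta> / r ^ 6) * \<psi>r \<le> (\<delta> / r ^ 6) * (- K * \<psi> \<tau> y)"
          using \<psi>r(2) \<delta> r by (intro mult_left_mono) auto
        then have "?r \<le> - K * W \<tau> y" using * unfolding W_def by (simp add: algebra_simps)
        also have "\<dots> \<le> K * W \<tau> y" using K h(3) by simp
        finally show ?thesis .
      qed
      ultimately show "y \<in> interior UNIV \<and> (\<exists>r. residual c W \<tau> y r \<and> r \<le> K * W \<tau> y)" by auto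
    qed (use st K in auto)
    moreover have "\<eta> * \<delta> \<le> (\<delta> / r ^ 6) * \<psi> t x"
    proof -
      define z where "z = x - x0 + c * (t - s)"
      have L: "t - s \<le> \<bar>L\<bar>" using t by simp
      have "\<bar>z\<bar> \<le> \<bar>R\<bar> + \<bar>c\<bar> * \<bar>L\<bar>"
      proof -
        have "\<bar>c * (t - s)\<bar> \<le> \<bar>c\<bar> * \<bar>L\<bar>" using L st by (auto simp: abs_mult intro!: mult_left_mono)
        then show ?thesis using x unfolding z_def by linarith
      qed
      moreover have "\<bar>R\<bar> + \<bar>c\<bar> * \<bar>L\<bar> + 1 \<le> k * (t - s)"
      proof -
        have "\<bar>R\<bar> + \<bar>c\<bar> * \<bar>L\<bar> + 1 = k * \<tau>" using \<tau> by (simp add: k_def)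
        also have "\<dots> \<le> k * (t - s)" using t k by (intro mult_left_mono) auto
        finally show ?thesis .
      qed
      ultimately have "\<bar>z\<bar> + 1 \<le> r + k * (t - s)" using r by linarith
      then have "(\<bar>z\<bar> + 1)\<^sup>2 \<le> (r + k * (t - s))\<^sup>2" by (intro power_mono) auto
      moreover have "(\<bar>z\<bar> + 1)\<^sup>2 = z\<^sup>2 + 2 * \<bar>z\<bar> + 1" by (simp add: power2_eq_square algebra_simps)
      moreover have "q t x = (r + k * (t - s))\<^sup>2 - z\<^sup>2" by (simp add: q_def z_def)
      ultimately have "1 \<le> q t x" by linarith
      then have "1 \<le> q t x ^ 3" by simp
      moreover have "exp (- (l * \<bar>L\<bar>)) \<le> exp (- l * (t - s))" using l L by (simp add: mult_left_mono)
      ultimately have "exp (- (l * \<bar>L\<bar>)) * 1 \<le> \<psi> t x" unfolding \<psi>_def by (intro mult_mono) auto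
      then have "(\<delta> / r ^ 6) * exp (- (l * \<bar>L\<bar>)) \<le> (\<delta> / r ^ 6) * \<psi> t x"
        using \<delta> r by (intro mult_left_mono) auto
      then show ?thesis by (simp add: \<eta>_def mult.commute)
    qed
    moreover have "\<epsilon> * exp (K * (t - s)) \<le> \<epsilon> * exp (K * L)"
      using \<epsilon> K t by (intro mult_left_mono) auto
    ultimately show ?thesis unfolding W_def by linarith
  qed
  ultimately have "spreads c r \<tau> R L \<eta>" unfolding spreads_def by blast
  with \<open>0 < \<eta>\<close> show ?thesis by (rule that)
qed

end

section \<open>Tails, monotonicity and stability of the front\<close>

context reaction
begin

text \<open>The weight \<open>exp (P t - \<mu> (t - a))\<close> solves the linearisation at the rest state with exponential decay,
  because \<open>P\<close> is bounded.\<close>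

lemma tail:
  assumes D: "closed D" and a: "0 \<le> a" and v1: "sol f c a v1" and v2: "sol f c a v2"
    and q: "0 \<le> q" and b: "0 \<le> b"
    and P: "\<And>t. 0 \<le> t \<Longrightarrow> (P has_real_derivative (\<alpha> t + 2 * \<mu>)) (at t)"
    and PB: "\<And>t. 0 \<le> t \<Longrightarrow> \<bar>P t\<bar> \<le> B" and \<alpha>K: "\<And>t. \<alpha> t + \<mu> \<le> K"
    and init: "\<And>x. x \<in> D \<Longrightarrow> v1 a x - v2 a x \<le> q"
    and near: "\<And>t x. a < t \<Longrightarrow> t \<le> e \<Longrightarrow> x \<in> D \<Longrightarrow> v2 t x < v1 t x \<Longrightarrow>
       f t (v1 t x) - f t (v2 t x) \<le> (\<alpha> t + \<mu>) * (v1 t x - v2 t x)"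
    and bd: "\<And>t x. a < t \<Longrightarrow> t \<le> e \<Longrightarrow> x \<in> D \<Longrightarrow> x \<notin> interior D \<Longrightarrow> v1 t x - v2 t x \<le> b"
    and t: "t \<in> {a..e}" and x: "x \<in> D"
  shows "v1 t x - v2 t x \<le> exp (2 * B) * (q * exp (- \<mu> * (t - a)) + b)"
proof -
  \<comment> \<open>Adding \<open>B\<close> in the exponent makes the weight at least 1, so \<psi>
    dominates the data at the initial time and at the boundary; the weight never exceeds
    \<open>exp (2 * B)\<close>.\<close>
  define \<psi> where "\<psi> = (\<lambda>t. exp (P t + B) * (q * exp (- \<mu> * (t - a)) + b))"
  have \<psi>1: "q * exp (- \<mu> * (t - a)) + b \<le> \<psi> t" if "0 \<le> t" for t
  proof -
    have "1 * (q * exp (- \<mu> * (t - a)) + b) \<le> \<psi> t"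
      unfolding \<psi>_def using PB[OF that] q b by (intro mult_right_mono) auto
    then show ?thesis by simp
  qed
  have \<psi>0: "0 \<le> \<psi> t" for t using q b by (simp add: \<psi>_def)
  have \<psi>': "(\<psi> has_real_derivative ((\<alpha> t + \<mu>) * \<psi> t + \<mu> * exp (P t + B) * b)) (at t)" if "0 \<le> t" for t
    unfolding \<psi>_def by (auto intro!: derivative_eq_intros P that simp: algebra_simps)
  define W where "W = (\<lambda>t x. v1 t x - v2 t x - \<psi> t)"
  have "W t x \<le> 0"
  proof (rule max_principle[where W = W and D = D and a = a and b = e and N = 1 and K = K and c = c])
    have "continuous_on {a..e} \<psi>"
      by (rule DERIV_continuous_on, rule has_field_derivative_at_within, rule \<psi>') (use a in auto)
    then have "continuous_on ({a..e} \<times> D) (\<lambda>p. \<psi> (fst p))"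
      by (rule continuous_on_compose2) (auto intro!: continuous_intros)
    then show "continuous_on ({a..e} \<times> D) (\<lambda>(t, x). W t x)"
      using sol_cont[OF v1, of a e D] sol_cont[OF v2, of a e D] unfolding W_def case_prod_beta
      by (auto intro!: continuous_intros)
    fix \<tau> y assume y: "y \<in> D"
    show "W \<tau> y \<le> 1" if "\<tau> \<in> {a..e}"
      using sol_range[OF v1, of \<tau> y] sol_range[OF v2, of \<tau> y] that \<psi>0[of \<tau>] unfolding W_def by auto
    show "W a y \<le> 0" using init[OF y] \<psi>1[OF a] b by (simp add: W_def)
    assume h: "a < \<tau>" "\<tau> \<le> e" "0 < W \<tau> y"
    have \<tau>: "0 \<le> \<tau>" using h a by simp
    let ?r = "f \<tau> (v1 \<tau> y) - f \<tau> (v2 \<tau> y) - ((\<alpha> \<tau> + \<mu>) * \<psi> \<tau> + \<mu> * exp (P \<tau> + B) * b)"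
    have pos: "v2 \<tau> y < v1 \<tau> y" using h(3) \<psi>0[of \<tau>] unfolding W_def by linarith
    have "residual c W \<tau> y ?r"
      unfolding W_def by (intro residual_diff sol_residual[OF v1] sol_residual[OF v2] residual_time \<psi>' h \<tau>)
    moreover have "?r \<le> K * W \<tau> y"
    proof -
      have "0 \<le> \<mu> * exp (P \<tau> + B) * b" using \<mu> b by simp
      then have "?r \<le> (\<alpha> \<tau> + \<mu>) * W \<tau> y"
        using near[OF h(1,2) y pos] unfolding W_def by (simp add: algebra_simps)
      also have "\<dots> \<le> K * W \<tau> y" using \<alpha>K h(3) by (intro mult_right_mono) auto
      finally show ?thesis .
    qed
    moreover have "y \<in> interior D"
    proof (rule ccontr)
      assume "y \<notin> interior D"
      then have "v1 \<tau> y - v2 \<tau> y \<le> b" by (rule bd[OF h(1,2) y])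
      also have "b \<le> \<psi> \<tau>" using \<psi>1[OF \<tau>] q by (smt (verit) exp_ge_zero mult_nonneg_nonneg)
      finally show False using h(3) by (simp add: W_def)
    qed
    ultimately show "y \<in> interior D \<and> (\<exists>r. residual c W \<tau> y r \<and> r \<le> K * W \<tau> y)" by blast
  qed (use t x K D in auto)
  then have "v1 t x - v2 t x \<le> \<psi> t" by (simp add: W_def)
  also have "\<psi> t \<le> exp (2 * B) * (q * exp (- \<mu> * (t - a)) + b)"
  proof -
    have "0 \<le> t" using a t by simp
    then have "P t + B \<le> 2 * B" using PB[of t] by simp
    then show ?thesis unfolding \<psi>_def using q b by (intro mult_right_mono) auto
  qed
  finally show ?thesis .
qed

text \<open>Each half-line is a domain for \<open>tail\<close>, with the central bound as boundary
  value. Where the difference is positive, \<open>v2\<close> lies below \<open>v1\<close>, so it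
  suffices that the larger function is near 0 on the right and the smaller one near 1 on the
  left.\<close>

lemma outer:
  assumes a: "0 \<le> a" and v1: "sol f c a v1" and v2: "sol f c a v2"
    and q: "0 \<le> q" and b: "0 \<le> b" and lr: "l \<le> r"
    and init: "\<And>x. v1 a x - v2 a x \<le> q"
    and center: "\<And>t x. a < t \<Longrightarrow> t \<le> e \<Longrightarrow> l \<le> x \<Longrightarrow> x \<le> r \<Longrightarrow> v1 t x - v2 t x \<le> b"
    and right: "\<And>t x. a < t \<Longrightarrow> t \<le> e \<Longrightarrow> r \<le> x \<Longrightarrow> v2 t x < v1 t x \<Longrightarrow> v1 t x \<le> g"
    and left: "\<And>t x. a < t \<Longrightarrow> t \<le> e \<Longrightarrow> x \<le> l \<Longrightarrow> v2 t x < v1 t x \<Longrightarrow> 1 - g \<le> v2 t x"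
    and t: "t \<in> {a..e}"
  shows "v1 t x - v2 t x \<le> exp (2 * B) * (q * exp (- \<mu> * (t - a)) + b)"
proof -
  have R: "v1 t x - v2 t x \<le> exp (2 * B) * (q * exp (- \<mu> * (t - a)) + b)" if "x \<in> {r..}"
  proof (rule tail[where D = "{r..}" and P = P0 and \<alpha> = a0 and e = e, OF _ a v1 v2 q b])
    fix t x assume h: "a < t" "t \<le> e" "x \<in> {r..}"
    show "f t (v1 t x) - f t (v2 t x) \<le> (a0 t + \<mu>) * (v1 t x - v2 t x)" if "v2 t x < v1 t x"
      using near0 right[of t x] that h sol_range[OF v2] by simp
    show "v1 t x - v2 t x \<le> b" if "x \<notin> interior {r..}"
      using that h center[of t x] lr by simp
  qed (use P0 P0B aK init t that in auto)
  have L: "v1 t x - v2 t x \<le> exp (2 * B) * (q * exp (- \<mu> * (t - a)) + b)" if "x \<in> {..l}"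
  proof (rule tail[where D = "{..l}" and P = P1 and \<alpha> = a1 and e = e, OF _ a v1 v2 q b])
    fix t x assume h: "a < t" "t \<le> e" "x \<in> {..l}"
    show "f t (v1 t x) - f t (v2 t x) \<le> (a1 t + \<mu>) * (v1 t x - v2 t x)" if "v2 t x < v1 t x"
      using near1 left[of t x] that h sol_range[OF v1] by simp
    show "v1 t x - v2 t x \<le> b" if "x \<notin> interior {..l}"
      using that h center[of t x] lr by simp
  qed (use P1 P1B aK init t that in auto)
  have C: "v1 t x - v2 t x \<le> exp (2 * B) * (q * exp (- \<mu> * (t - a)) + b)" if "l \<le> x" "x \<le> r"
  proof -
    have *: "1 * (q * exp (- \<mu> * (t - a)) + b) \<le> exp (2 * B) * (q * exp (- \<mu> * (t - a)) + b)"
      using B q b by (intro mult_right_mono) auto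
    have "v1 t x - v2 t x \<le> q * exp (- \<mu> * (t - a)) + b"
    proof (cases "t = a")
      case True
      then show ?thesis using init[of x] b by simp
    next
      case False
      then have "v1 t x - v2 t x \<le> b" using center that t by auto
      then show ?thesis using q by (smt (verit) exp_ge_zero mult_nonneg_nonneg)
    qed
    then show ?thesis using * by simp
  qed
  show ?thesis using R L C by (cases "x \<le> l"; cases "r \<le> x") auto
qed

end

section \<open>The periodic front and its elementary bounds\<close>

locale front = reaction +
  fixes T c :: real and U :: "real \<Rightarrow> real \<Rightarrow> real"
  assumes T: "0 < T" and U: "sol f c 0 U" and per: "U (t + T) x = U t x"
    and lim0: "0 < e \<Longrightarrow> \<exists>R. \<forall>t. \<forall>x\<ge>R. U t x \<le> e"
    and lim1: "0 < e \<Longrightarrow> \<exists>R. \<forall>t. \<forall>x\<le>R. 1 - e \<le> U t x"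

lemma front_dual:
  assumes "front f K g \<mu> B a0 a1 P0 P1 T c U"
  shows "front (\<lambda>t u. - f t (1 - u)) K g \<mu> B a1 a0 P1 P0 T (- c) (\<lambda>t x. 1 - U t (- x))"
proof -
  interpret front f K g \<mu> B a0 a1 P0 P1 T c U by fact
  interpret dual: reaction "\<lambda>t u. - f t (1 - u)" K g \<mu> B a1 a0 P1 P0
    by (rule reaction_dual) unfold_locales
  show ?thesis
  proof
    show "0 < T" by (rule T)
    show "sol (\<lambda>t u. - f t (1 - u)) (- c) 0 (\<lambda>t x. 1 - U t (- x))" by (rule sol_dual[OF U])
    show "1 - U (t + T) (- x) = 1 - U t (- x)" for t x by (simp add: per)
    fix e :: real assume e: "0 < e"
    show "\<exists>R. \<forall>t. \<forall>x\<ge>R. 1 - U t (- x) \<le> e"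
    proof -
      obtain R where R: "\<forall>t. \<forall>x\<le>R. 1 - e \<le> U t x" using lim1[OF e] by blast
      have "1 - U t (- x) \<le> e" if "- R \<le> x" for t x using R[rule_format, of "-x" t] that by simp
      then show ?thesis by blast
    qed
    show "\<exists>R. \<forall>t. \<forall>x\<le>R. 1 - e \<le> 1 - U t (- x)"
    proof -
      obtain R where R: "\<forall>t. \<forall>x\<ge>R. U t x \<le> e" using lim0[OF e] by blast
      have "1 - e \<le> 1 - U t (- x)" if "x \<le> - R" for t x using R[rule_format, of "-x" t] that by simp
      then show ?thesis by blast
    qed
  qed
qed

lemma exp_decay:
  fixes \<mu> C \<epsilon> :: real
  assumes "0 < \<mu>" "0 < \<epsilon>"
  obtains L where "0 < L" "\<And>t. L \<le> t \<Longrightarrow> C * exp (- \<mu> * t) \<le> \<epsilon>"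
proof
  define L where "L = \<bar>C\<bar> / (\<epsilon> * \<mu>) + 1"
  show "0 < L" using assms by (simp add: L_def add_nonneg_pos)
  fix t assume t: "L \<le> t"
  have "\<bar>C\<bar> \<le> \<epsilon> * (\<mu> * t)"
  proof -
    have "\<bar>C\<bar> / (\<epsilon> * \<mu>) \<le> t" using t by (simp add: L_def)
    then show ?thesis using assms by (simp add: field_simps)
  qed
  also have "\<mu> * t \<le> exp (\<mu> * t)" using exp_ge_add_one_self[of "\<mu> * t"] by linarith
  finally have "\<bar>C\<bar> \<le> \<epsilon> * exp (\<mu> * t)" using assms by simp
  then have "C \<le> \<epsilon> * exp (\<mu> * t)" by linarith
  then show "C * exp (- \<mu> * t) \<le> \<epsilon>" by (simp add: exp_minus field_simps)
qed

lemma mod_period: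
  fixes T t :: real
  assumes "0 < T" "0 \<le> t"
  obtains n s where "t = s + real n * T" "0 \<le> s" "s < T"
proof -
  define n where "n = nat \<lfloor>t / T\<rfloor>"
  have "0 \<le> t / T" using assms by simp
  then have "real n \<le> t / T" "t / T < real n + 1"
    unfolding n_def by linarith+
  then have "real n * T \<le> t" "t < real n * T + T" using assms by (simp_all add: field_simps)
  then show ?thesis using that[of "t - real n * T" n] by simp
qed

context front
begin

lemma per_n: "U (t + real n * T) x = U t x"
proof (induction n)
  case (Suc n)
  have "U (t + real (Suc n) * T) x = U ((t + real n * T) + T) x" by (simp add: algebra_simps)
  then show ?case using Suc per by simp
qed simp

lemma late_period:
  obtains n where "s \<le> t + real n * T"
proof -
  obtain n where "(s - t) / T \<le> real n" using real_arch_simple by blast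
  then have "s \<le> t + real n * T" using T by (simp add: field_simps)
  then show ?thesis by (rule that)
qed

text \<open>Adding periods moves \<open>t\<close> beyond the waiting time of
  \<open>lipschitz\<close>.\<close>

lemma U_lip:
  assumes "0 \<le> t" shows "\<bar>U t x - U t y\<bar> \<le> M * \<bar>x - y\<bar>"
proof -
  obtain n where "1 \<le> t + real n * T" by (rule late_period)
  then have "\<bar>U (t + real n * T) x - U (t + real n * T) y\<bar> \<le> M * \<bar>x - y\<bar>"
    using U by (intro lipschitz) auto
  then show ?thesis by (simp add: per_n)
qed

lemma M_pos: "0 < M"
  unfolding M_def using K by (intro add_pos_pos divide_pos_pos) auto

lemma U_shift: "sol f c 0 (\<lambda>t x. U t (x - s))"
  using sol_shift[OF U, of "- s"] by simp

lemma radius: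
  assumes "0 < e"
  obtains R where "0 < R" "\<And>t x. R \<le> x \<Longrightarrow> U t x \<le> e" "\<And>t x. x \<le> - R \<Longrightarrow> 1 - e \<le> U t x"
proof -
  obtain R1 where R1: "\<forall>t. \<forall>x\<ge>R1. U t x \<le> e" using lim0[OF assms] by blast
  obtain R2 where R2: "\<forall>t. \<forall>x\<le>R2. 1 - e \<le> U t x" using lim1[OF assms] by blast
  show ?thesis using that[of "1 + \<bar>R1\<bar> + \<bar>R2\<bar>"] R1 R2 by auto
qed

section \<open>The sliding method\<close>

definition slides :: "real \<Rightarrow> bool" where
  "slides s \<longleftrightarrow> (\<forall>t\<ge>0. \<forall>x. U t x \<le> U t (x - s))"

text \<open>Periodicity turns the exponential decay in the tails into an exact inequality.\<close>

lemma slidesI: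
  assumes lr: "l \<le> r" and center: "\<And>t x. 0 \<le> t \<Longrightarrow> l \<le> x \<Longrightarrow> x \<le> r \<Longrightarrow> U t x \<le> U t (x - s)"
    and right: "\<And>t x. 0 \<le> t \<Longrightarrow> r \<le> x \<Longrightarrow> U t x \<le> g"
    and left: "\<And>t x. 0 \<le> t \<Longrightarrow> x \<le> l \<Longrightarrow> 1 - g \<le> U t (x - s)"
  shows "slides s"
  unfolding slides_def
proof (intro allI impI)
  fix t x :: real assume t: "0 \<le> t"
  have *: "U t x - U t (x - s) \<le> exp (2 * B) * (1 * exp (- \<mu> * (t - 0)) + 0)" if t: "0 \<le> t" for t
  proof (rule outer[where l = l and r = r and e = t, OF _ U U_shift])
    show "U 0 x - U 0 (x - s) \<le> 1" for x
      using sol_range[OF U, of 0 x] sol_range[OF U, of 0 "x - s"] by simp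
  qed (use lr center right left t in auto)
  have "U t x - U t (x - s) \<le> 0"
  proof (rule field_le_epsilon)
    fix e :: real assume "0 < e"
    then obtain L where L: "\<And>t. L \<le> t \<Longrightarrow> exp (2 * B) * exp (- \<mu> * t) \<le> e"
      using exp_decay[OF \<mu>, of e "exp (2 * B)"] by blast
    obtain n where n: "max L 0 \<le> t + real n * T" by (rule late_period)
    show "U t x - U t (x - s) \<le> 0 + e"
      using *[of "t + real n * T"] L[of "t + real n * T"] n by (simp add: per_n)
  qed
  then show "U t x \<le> U t (x - s)" by simp
qed

text \<open>By spreading, any strict inequality at time 0 would become strict at \<open>x\<close> at
  a later time congruent to \<open>t\<close>. A contact point thus forces \<open>U 0\<close> to be
  \<open>s\<close>-periodic in space, which contradicts its different limits at the two
  ends.\<close>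

lemma slides_strict:
  assumes s: "0 < s" and sl: "slides s" and t: "0 \<le> t"
  shows "U t x < U t (x - s)"
proof (rule ccontr)
  assume "\<not> ?thesis"
  then have eq: "U t x = U t (x - s)" using sl t unfolding slides_def by (metis not_le order.antisym)
  have zero: "U 0 x0 = U 0 (x0 - s)" for x0
  proof (rule ccontr)
    assume "U 0 x0 \<noteq> U 0 (x0 - s)"
    then have "U 0 x0 < U 0 (x0 - s)" using sl by (metis slides_def order_refl order.not_eq_order_implies_strict)
    define \<delta> where "\<delta> = (U 0 (x0 - s) - U 0 x0) / 2"
    have \<delta>: "0 < \<delta>" using \<open>U 0 x0 < U 0 (x0 - s)\<close> by (simp add: \<delta>_def)
    \<comment> \<open>The gap at \<open>x0\<close> is \<open>2 * \<delta>\<close>; over distance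
      \<open>r\<close> the front and its shift each lose at most \<open>\<delta> / 2\<close>, so
      \<delta> remains.\<close>
    define r where "r = \<delta> / (2 * M)"
    have r: "0 < r" using \<delta> M_pos by (simp add: r_def)
    obtain n where n: "1 \<le> t + real n * T" by (rule late_period)
    define R0 where "R0 = \<bar>x - x0\<bar>"
    obtain \<eta> where \<eta>: "0 < \<eta>" and sp: "spreads c r 1 R0 (t + real n * T) \<eta>"
      by (rule spread[OF r zero_less_one])
    have "\<eta> * \<delta> - 0 * exp (K * (t + real n * T)) \<le> U (t + real n * T) (x - s) - U (t + real n * T) x"
    proof (rule spreadsD[OF sp U U_shift])
      show "U 0 x \<le> U 0 (x - s) + 0" for x using sl by (simp add: slides_def)
      show "\<delta> \<le> U 0 (x - s) - U 0 x" if "\<bar>x - x0\<bar> \<le> r" for x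
      proof -
        have "M * \<bar>x - x0\<bar> \<le> \<delta> / 2" using that M_pos by (simp add: r_def field_simps)
        then show ?thesis using U_lip[of 0 x x0] U_lip[of 0 "x - s" "x0 - s"] by (simp add: \<delta>_def)
      qed
    qed (use \<delta> n in \<open>auto simp: R0_def\<close>)
    then show False using mult_pos_pos[OF \<eta> \<delta>] eq by (simp add: per_n)
  qed
  have shift: "U 0 x0 = U 0 (x0 - real n * s)" for x0 n
  proof (induction n)
    case (Suc n)
    then show ?case using zero[of "x0 - real n * s"] by (simp add: algebra_simps)
  qed simp
  obtain R where R: "0 < R" "\<And>t x. R \<le> x \<Longrightarrow> U t x \<le> 1 / 4" "\<And>t x. x \<le> - R \<Longrightarrow> 1 - 1 / 4 \<le> U t x"
    using radius[of "1 / 4"] by auto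
  obtain n where "2 * R / s \<le> real n" using real_arch_simple by blast
  then have "R - real n * s \<le> - R" using s by (simp add: field_simps)
  from R(3)[OF this, of 0] R(2)[of R 0] shift[of R n] show False by simp
qed

text \<open>Large shifts order the front trivially. At a positive infimum \<open>m\<close> the
  ordering is strict, hence uniform on one period times \<open>[-R, R]\<close> and by periodicity at
  all later times. The shift can then be decreased, since the conditions of \<open>slidesI\<close>
  on the tails hold for every nonnegative shift.\<close>

lemma slides_all:
  assumes "0 \<le> s" shows "slides s"
proof -
  obtain R where R: "0 < R" "\<And>t x. R \<le> x \<Longrightarrow> U t x \<le> g" "\<And>t x. x \<le> - R \<Longrightarrow> 1 - g \<le> U t x"
    using radius[OF g(1)] by blast
  \<comment> \<open>Including all larger shifts in the condition makes every shift above the infimum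
    admissible.\<close>
  define A where "A = {s. 0 \<le> s \<and> (\<forall>s'\<ge>s. slides s')}"
  have large: "slides s" if "2 * R \<le> s" for s
  proof (rule slidesI[of R R])
    fix t x :: real
    show "U t x \<le> U t (x - s)" if "R \<le> x" "x \<le> R"
    proof -
      have "x = R" using that by simp
      then show ?thesis using R(2)[of R t] R(3)[of "R - s" t] \<open>2 * R \<le> s\<close> g(2) by auto
    qed
  qed (use R that in auto)
  have A: "2 * R \<in> A" using large R(1) by (simp add: A_def)
  have bdd: "bdd_below A" unfolding A_def by (auto intro: bdd_belowI[of _ 0])
  define m where "m = Inf A"
  have m0: "0 \<le> m" unfolding m_def using A cInf_greatest[of A 0] unfolding A_def by blast
  have above: "slides s" if ms: "m < s" for s
  proof -
    have "A \<noteq> {}" using A by auto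
    then obtain a where "a \<in> A" "a < s" using cInf_lessD[of A s] ms unfolding m_def by blast
    then show ?thesis by (auto simp: A_def)
  qed
  have "m = 0"
  proof (rule ccontr)
    assume "m \<noteq> 0"
    then have mpos: "0 < m" using m0 by simp
    have slm: "slides m" unfolding slides_def
    proof (intro allI impI)
      fix t x :: real assume t: "0 \<le> t"
      show "U t x \<le> U t (x - m)"
      proof (rule field_le_epsilon)
        fix e :: real assume e: "0 < e"
        have "U t x \<le> U t (x - (m + e / M))"
          using above[of "m + e / M"] e M_pos t by (simp add: slides_def)
        also have "\<dots> \<le> U t (x - m) + M * \<bar>(x - (m + e / M)) - (x - m)\<bar>"
          using U_lip[OF t, of "x - (m + e / M)" "x - m"] by linarith
        also have "\<dots> = U t (x - m) + e" using e M_pos by simp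
        finally show "U t x \<le> U t (x - m) + e" .
      qed
    qed
    define gap where "gap = (\<lambda>(t, x). U t (x - m) - U t x)"
    have "continuous_on ({0..T} \<times> {- R..R}) gap"
      unfolding gap_def using sol_cont[OF U, of 0 T "{- R..R}"] sol_cont[OF U_shift, of 0 T "{- R..R}" m]
      by (auto simp: case_prod_beta intro!: continuous_intros)
    moreover have "compact ({0..T} \<times> {- R..R})" by (intro compact_Times) auto
    moreover have "{0..T} \<times> {- R..R} \<noteq> {}" using T R by auto
    ultimately obtain p where p: "p \<in> {0..T} \<times> {- R..R}"
      "\<And>q. q \<in> {0..T} \<times> {- R..R} \<Longrightarrow> gap p \<le> gap q"
      using continuous_attains_inf[of "{0..T} \<times> {- R..R}" gap] by metis
    define d where "d = gap p"
    have d: "0 < d" using p(1) slides_strict[OF mpos slm] by (auto simp: d_def gap_def)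
    have dU: "d \<le> U t (x - m) - U t x" if t: "0 \<le> t" and x: "- R \<le> x" "x \<le> R" for t x
    proof -
      obtain n \<tau> where "t = \<tau> + real n * T" "0 \<le> \<tau>" "\<tau> < T" using mod_period[OF T t] .
      then show ?thesis using p(2)[of "(\<tau>, x)"] x by (simp add: d_def gap_def per_n)
    qed
    \<comment> \<open>Decreasing the shift by \<open>d / M\<close> costs at most \<open>d\<close> by
      the Lipschitz bound; the maximum with 0 keeps the shift nonnegative.\<close>
    define s where "s = max 0 (m - d / M)"
    have s: "0 \<le> s" "s < m" using d M_pos mpos by (auto simp: s_def)
    have "slides s'" if "s \<le> s'" for s'
    proof (cases "m < s'")
      case False
      show ?thesis
      proof (rule slidesI[of "- R" R])
        fix t x :: real assume t: "0 \<le> t" and x: "- R \<le> x" "x \<le> R"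
        have "m - d / M \<le> s'" using that by (simp add: s_def)
        then have "M * (m - s') \<le> d" using M_pos by (simp add: field_simps)
        moreover have "U t (x - m) \<le> U t (x - s') + M * (m - s')"
          using U_lip[OF t, of "x - m" "x - s'"] False by simp
        ultimately show "U t x \<le> U t (x - s')" using dU[OF t x] by simp
      qed (use R s that in auto)
    qed (rule above)
    then have "s \<in> A" using s by (simp add: A_def)
    then have "m \<le> s" unfolding m_def using bdd by (intro cInf_lower)
    then show False using s by simp
  qed
  then show ?thesis using above[of s] assms by (cases "s = 0") (auto simp: slides_def)
qed

lemma U_antimono: "0 \<le> t \<Longrightarrow> x \<le> y \<Longrightarrow> U t y \<le> U t x"
  using slides_all[of "y - x", unfolded slides_def, rule_format, of t y] by simp

lemma U_strict: "0 \<le> t \<Longrightarrow> x < y \<Longrightarrow> U t y < U t x"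
  using slides_strict[of "y - x" t y] slides_all[of "y - x"] by simp

section \<open>Stability with a controlled shift\<close>

text \<open>Linearity in \<open>s\<close> makes the shifts in the iteration of \<open>stability_upper\<close> summable.\<close>

lemma linear_gap:
  obtains \<beta> r where "0 < \<beta>" "0 < r"
    "\<And>t x s. 0 \<le> t \<Longrightarrow> \<bar>x\<bar> \<le> R \<Longrightarrow> 0 \<le> s \<Longrightarrow> s \<le> r \<Longrightarrow> \<beta> * s \<le> U t (x - s) - U t x"
proof -
  obtain wx where wx: "\<And>y. (U T has_real_derivative wx y) (at y)"
    using sol_residual[OF U T] unfolding residual_def by blast
  \<comment> \<open>A strictly decreasing function can have critical points, but the mean value
    theorem supplies one point with negative slope, and spreading does the rest.\<close>
  obtain z where z: "wx z < 0"
  proof -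
    obtain z where "U T 1 - U T 0 = (1 - 0) * wx z"
      using MVT2[of 0 1 "U T" wx] wx by auto
    moreover have "U T 1 < U T 0" using U_strict[of T 0 1] T by simp
    ultimately have "wx z < 0" by simp
    then show ?thesis by (rule that)
  qed
  obtain wx' wxx where w: "\<And>y. (U T has_real_derivative wx' y) (at y)" "(wx' has_real_derivative wxx) (at z)"
    using sol_residual[OF U T, of z] unfolding residual_def by blast
  \<comment> \<open>Each use of \<open>residual\<close> comes with its own derivative function.
    Identifying the two makes \<open>wx\<close> differentiable, hence continuous, at
    \<open>z\<close>.\<close>
  have "wx' = wx" using wx w(1) DERIV_unique by blast
  then have "isCont wx z" using w(2) DERIV_isCont by blast
  define d where "d = - wx z / 2"
  have d: "0 < d" using z by (simp add: d_def)
  obtain e where e: "0 < e" "\<And>y. \<bar>y - z\<bar> < e \<Longrightarrow> \<bar>wx y - wx z\<bar> < d"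
    using \<open>isCont wx z\<close>[unfolded continuous_at_eps_delta, rule_format, OF d]
    by (auto simp: dist_real_def)
  define r where "r = e / 3"
  have r: "0 < r" using e by (simp add: r_def)
  have gap: "d * s \<le> U T (x - s) - U T x" if xs: "\<bar>x - z\<bar> \<le> r" "0 \<le> s" "s \<le> r" for x s
  proof (cases "s = 0")
    case False
    then obtain y where y: "x - s < y" "y < x" "U T x - U T (x - s) = (x - (x - s)) * wx y"
      using MVT2[of "x - s" x "U T" wx] wx xs by auto
    have "\<bar>y - z\<bar> < e" using y(1,2) xs e(1) unfolding r_def by arith
    from e(2)[OF this] have "wx y \<le> - d" by (simp add: d_def)
    then have "s * wx y \<le> s * (- d)" using that by (intro mult_left_mono) auto
    then show ?thesis using y by (simp add: mult.commute)
  qed simp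
  \<comment> \<open>Spreading is linear in the initial gap \<open>d * s\<close>, and \<eta> does not
    depend on \<open>s\<close>. Starting at time \<open>T\<close>, the delays from \<open>T\<close>
    to \<open>2 * T\<close> cover a full period.\<close>
  obtain \<eta> where \<eta>: "0 < \<eta>" and sp: "spreads c r T (R + \<bar>z\<bar>) (2 * T) \<eta>"
    by (rule spread[OF r T])
  have "\<eta> * d * s \<le> U t (x - s) - U t x" if t: "0 \<le> t" and x: "\<bar>x\<bar> \<le> R" and s: "0 \<le> s" "s \<le> r" for t x s
  proof -
    obtain n \<tau> where n: "t = \<tau> + real n * T" "0 \<le> \<tau>" "\<tau> < T" using mod_period[OF T t] .
    have sT: "sol f c T (\<lambda>t x. U t (x - s))" "sol f c T U" using sol_later[OF U_shift] sol_later[OF U] T by auto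
    have "\<eta> * (d * s) - 0 * exp (K * (2 * T)) \<le> U (\<tau> + real 2 * T) (x - s) - U (\<tau> + real 2 * T) x"
    proof (rule spreadsD[OF sp sT(2) sT(1), where ?x0.0 = z])
      show "U T x \<le> U T (x - s) + 0" for x using U_antimono[of T "x - s" x] T s by simp
    qed (use gap s d n x in auto)
    then show ?thesis unfolding per_n n by simp
  qed
  then show ?thesis using that[of "\<eta> * d" r] \<eta> d r by auto
qed

text \<open>On a window of length \<open>L\<close> an error \<open>q\<close> grows at most to
  \<open>q * E\<close>. Shifting by \<open>\<kappa> * q\<close> absorbs this in the centre, so the
  error decays and is halved by the end of the window. Halved errors call for halved shifts, whose
  sum is at most \<open>2 * \<kappa> * q\<close>.\<close>

lemma stability_upper:
  obtains q0 \<Lambda> where "0 < q0" "0 \<le> \<Lambda>"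
    "\<And>t0 v q \<sigma> \<epsilon>. \<lbrakk>0 \<le> t0; sol f c t0 v; 0 \<le> q; q \<le> q0; \<And>x. v t0 x \<le> U t0 (x - \<sigma>) + q; 0 < \<epsilon>\<rbrakk>
      \<Longrightarrow> \<exists>\<tau>. \<forall>t\<ge>\<tau>. \<forall>x. v t x \<le> U t (x - \<sigma> - \<Lambda> * q) + \<epsilon>"
proof -
  define C where "C = exp (2 * B)"
  have C: "0 < C" by (simp add: C_def)
  obtain L where L: "0 < L" "C * exp (- \<mu> * L) \<le> 1 / 2"
    using exp_decay[OF \<mu>, of "1 / 2" C] by auto
  obtain R where R: "0 < R" "\<And>t x. R \<le> x \<Longrightarrow> U t x \<le> g / 2" "\<And>t x. x \<le> - R \<Longrightarrow> 1 - g / 2 \<le> U t x"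
    using radius[of "g / 2"] g(1) by auto
  obtain \<beta> r where \<beta>: "0 < \<beta>" "0 < r"
    and gap: "\<And>t x s. 0 \<le> t \<Longrightarrow> \<bar>x\<bar> \<le> R \<Longrightarrow> 0 \<le> s \<Longrightarrow> s \<le> r \<Longrightarrow> \<beta> * s \<le> U t (x - s) - U t x"
    using linear_gap[of R] by metis
  define E where "E = exp (K * L)"
  have E: "0 < E" by (simp add: E_def)
  define \<kappa> where "\<kappa> = E / \<beta>"
  have \<kappa>: "0 < \<kappa>" using E \<beta> by (simp add: \<kappa>_def)
  \<comment> \<open>The first bound keeps the right tail below \<open>g\<close> throughout the
    window, the second keeps the shift in the range of \<open>linear_gap\<close>.\<close>
  define q0 where "q0 = min (g / (2 * E)) (r / \<kappa>)"
  have q0: "0 < q0" using g(1) E \<beta> \<kappa> by (simp add: q0_def)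
  have step0: "v t x \<le> U t (x - \<kappa> * q) + C * (q * exp (- \<mu> * (t - t0)))"
    if t0: "0 \<le> t0" and v: "sol f c t0 v" and q: "0 \<le> q" "q \<le> q0"
      and init: "\<And>x. v t0 x \<le> U t0 x + q" and t: "t \<in> {t0..t0 + L}" for t0 v q t x
  proof -
    have qE: "q * E \<le> g / 2" "\<kappa> * q \<le> r" using q E \<kappa> by (auto simp: q0_def field_simps)
    have grow: "v t x \<le> U t x + q * E" if "t0 < t" "t \<le> t0 + L" for t x
    proof -
      have "v t x \<le> U t x + q * exp (K * (t - t0))"
        using that by (intro compare[OF v sol_later[OF U t0] q(1) init]) auto
      also have "q * exp (K * (t - t0)) \<le> q * E" unfolding E_def using that q K by (intro mult_left_mono) auto
      finally show ?thesis by simp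
    qed
    have "v t x - U t (x - \<kappa> * q) \<le> exp (2 * B) * (q * exp (- \<mu> * (t - t0)) + 0)"
    proof (rule outer[OF t0 v sol_later[OF U_shift t0] q(1), where l = "- R" and r = R and e = "t0 + L"])
      show "v t0 x - U t0 (x - \<kappa> * q) \<le> q" for x
        using init[of x] U_antimono[OF t0, of "x - \<kappa> * q" x] q \<kappa> by simp
      fix t x assume h: "t0 < t" "t \<le> t0 + L"
      show "v t x - U t (x - \<kappa> * q) \<le> 0" if "- R \<le> x" "x \<le> R"
      proof -
        have "\<beta> * (\<kappa> * q) \<le> U t (x - \<kappa> * q) - U t x"
          using that h t0 qE q \<kappa> by (intro gap) auto
        moreover have "\<beta> * (\<kappa> * q) = q * E" using \<beta> by (simp add: \<kappa>_def)
        ultimately show ?thesis using grow[OF h, of x] by simp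
      qed
      show "v t x \<le> g" if "R \<le> x" using grow[OF h, of x] R(2)[OF that, of t] qE by simp
      show "1 - g \<le> U t (x - \<kappa> * q)" if "x \<le> - R"
      proof -
        have "0 \<le> \<kappa> * q" using \<kappa> q by simp
        then have "1 - g / 2 \<le> U t (x - \<kappa> * q)" using that by (intro R(3)) linarith
        then show ?thesis using g(1) by simp
      qed
    qed (use R t in auto)
    then show ?thesis by (simp add: C_def)
  qed
  have step: "v t x \<le> U t (x - \<sigma> - \<kappa> * q) + C * (q * exp (- \<mu> * (t - t0)))"
    if t0: "0 \<le> t0" and v: "sol f c t0 v" and q: "0 \<le> q" "q \<le> q0"
      and init: "\<And>x. v t0 x \<le> U t0 (x - \<sigma>) + q" and t: "t \<in> {t0..t0 + L}" for t0 v q t x \<sigma>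
  proof -
    have "v t (x - \<sigma> + \<sigma>) \<le> U t (x - \<sigma> - \<kappa> * q) + C * (q * exp (- \<mu> * (t - t0)))"
      by (rule step0[OF t0 sol_shift[OF v] q _ t]) (use init[of "_ + \<sigma>"] in simp)
    then show ?thesis by simp
  qed
  have "\<exists>\<tau>. \<forall>t\<ge>\<tau>. \<forall>x. v t x \<le> U t (x - \<sigma> - 2 * \<kappa> * q) + \<epsilon>"
    if t0: "0 \<le> t0" and v: "sol f c t0 v" and q: "0 \<le> q" "q \<le> q0"
      and init: "\<And>x. v t0 x \<le> U t0 (x - \<sigma>) + q" and \<epsilon>: "0 < \<epsilon>" for t0 v q \<sigma> \<epsilon>
  proof -
    \<comment> \<open>Closed form of the partial sums of \<open>\<kappa> * q / 2 ^ i\<close> over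
      \<open>i < n\<close>.\<close>
    define sh where "sh = (\<lambda>n::nat. 2 * \<kappa> * q * (1 - 1 / 2 ^ n))"
    have sh: "sh n + \<kappa> * (q / 2 ^ n) = sh (Suc n)" for n by (simp add: sh_def field_simps)
    have qn: "0 \<le> q / 2 ^ n" "q / 2 ^ n \<le> q0" for n
    proof -
      have "q / 2 ^ n \<le> q / 1" using q by (intro divide_left_mono) auto
      then show "q / 2 ^ n \<le> q0" using q by simp
    qed (use q in simp)
    have iter: "\<forall>x. v (t0 + real n * L) x \<le> U (t0 + real n * L) (x - \<sigma> - sh n) + q / 2 ^ n" for n
    proof (induction n)
      case 0
      then show ?case using init by (simp add: sh_def)
    next
      case (Suc n)
      let ?t = "t0 + real n * L"
      have e: "?t + L = t0 + real (Suc n) * L" by (simp add: algebra_simps)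
      have t: "0 \<le> ?t" "t0 \<le> ?t" using t0 L by simp_all
      show ?case
      proof
        fix x
        have "v (?t + L) x \<le> U (?t + L) (x - (\<sigma> + sh n) - \<kappa> * (q / 2 ^ n)) + C * (q / 2 ^ n * exp (- \<mu> * (?t + L - ?t)))"
        proof (rule step[OF t(1) sol_later[OF v t(2)] qn])
          show "v ?t x \<le> U ?t (x - (\<sigma> + sh n)) + q / 2 ^ n" for x
            using Suc by (simp add: diff_diff_eq)
        qed (use L in auto)
        also have "x - (\<sigma> + sh n) - \<kappa> * (q / 2 ^ n) = x - \<sigma> - sh (Suc n)" using sh[of n] by simp
        also have "C * (q / 2 ^ n * exp (- \<mu> * (?t + L - ?t))) \<le> q / 2 ^ Suc n"
        proof -
          have "C * (q / 2 ^ n * exp (- \<mu> * (?t + L - ?t))) = q / 2 ^ n * (C * exp (- \<mu> * L))" by simp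
          also have "\<dots> \<le> q / 2 ^ n * (1 / 2)" by (rule mult_left_mono[OF L(2) qn(1)])
          finally show ?thesis by simp
        qed
        finally show "v (t0 + real (Suc n) * L) x \<le> U (t0 + real (Suc n) * L) (x - \<sigma> - sh (Suc n)) + q / 2 ^ Suc n"
          unfolding e by simp
      qed
    qed
    \<comment> \<open>From window \<open>N\<close> on, the error is below \<epsilon> without
      counting any decay inside the current window.\<close>
    obtain N where N: "C * q / \<epsilon> < 2 ^ N" using real_arch_pow[of 2 "C * q / \<epsilon>"] by auto
    have "v t x \<le> U t (x - \<sigma> - 2 * \<kappa> * q) + \<epsilon>" if t: "t0 + real N * L \<le> t" for t x
    proof -
      have tt0: "0 \<le> t - t0" using t L by (smt (verit) mult_nonneg_nonneg of_nat_0_le_iff)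
      obtain n s where n: "t - t0 = s + real n * L" "0 \<le> s" "s < L" using mod_period[OF L(1) tt0] .
      have "real N * L < real (Suc n) * L" using n t by (simp add: algebra_simps)
      then have "N \<le> n" using L(1) by (simp add: mult_less_cancel_right)
      let ?t = "t0 + real n * L"
      have t: "0 \<le> ?t" "t0 \<le> ?t" "0 \<le> t" using t0 L tt0 by auto
      have "v t x \<le> U t (x - (\<sigma> + sh n) - \<kappa> * (q / 2 ^ n)) + C * (q / 2 ^ n * exp (- \<mu> * (t - ?t)))"
      proof (rule step[OF t(1) sol_later[OF v t(2)] qn])
        show "v ?t x \<le> U ?t (x - (\<sigma> + sh n)) + q / 2 ^ n" for x
          using iter[of n] by (simp add: diff_diff_eq)
      qed (use n in auto)
      also have "x - (\<sigma> + sh n) - \<kappa> * (q / 2 ^ n) = x - \<sigma> - sh (Suc n)" using sh[of n] by simp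
      also have "U t (x - \<sigma> - sh (Suc n)) \<le> U t (x - \<sigma> - 2 * \<kappa> * q)"
      proof (rule U_antimono[OF t(3)])
        have "sh (Suc n) \<le> 2 * \<kappa> * q * 1" unfolding sh_def using \<kappa> q by (intro mult_left_mono) auto
        then show "x - \<sigma> - 2 * \<kappa> * q \<le> x - \<sigma> - sh (Suc n)" by simp
      qed
      also have "C * (q / 2 ^ n * exp (- \<mu> * (t - ?t))) \<le> \<epsilon>"
      proof -
        have "exp (- \<mu> * (t - ?t)) \<le> 1" using n \<mu> by simp
        then have "C * (q / 2 ^ n * exp (- \<mu> * (t - ?t))) \<le> C * (q / 2 ^ n * 1)"
          using C qn(1) by (intro mult_left_mono) auto
        also have "\<dots> = C * q / 2 ^ n" by simp
        also have "\<dots> \<le> C * q / 2 ^ N" using \<open>N \<le> n\<close> C q by (intro divide_left_mono) auto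
        also have "\<dots> \<le> \<epsilon>" using N \<epsilon> by (simp add: field_simps)
        finally show ?thesis .
      qed
      finally show ?thesis by simp
    qed
    then show ?thesis by blast
  qed
  then show ?thesis using that[of q0 "2 * \<kappa>"] q0 \<kappa> by auto
qed

end

section \<open>Convergence to a shift of the front\<close>

context front
begin

section \<open>Trapping between shifts of the front\<close>

definition upper :: "(real \<Rightarrow> real \<Rightarrow> real) \<Rightarrow> real \<Rightarrow> bool" where
  "upper v \<sigma> \<longleftrightarrow> (\<forall>\<epsilon>>0. \<exists>\<tau>. \<forall>t\<ge>\<tau>. \<forall>x. v t x \<le> U t (x - \<sigma>) + \<epsilon>)"

definition lower :: "(real \<Rightarrow> real \<Rightarrow> real) \<Rightarrow> real \<Rightarrow> bool" where
  "lower v \<sigma> \<longleftrightarrow> (\<forall>\<epsilon>>0. \<exists>\<tau>. \<forall>t\<ge>\<tau>. \<forall>x. U t (x - \<sigma>) - \<epsilon> \<le> v t x)"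

text \<open>The supersolution \<open>A + E\<close> covers data below \<gamma> on the right and
  arbitrary data on the left. \<open>A\<close> is the decaying linear solution near 0 and
  \<open>E\<close> an exponential wave. Waiting until \<open>A\<close> is small lowers the right
  tail from \<gamma> to any prescribed \<open>q\<close>, so \<gamma> need not be as small as the
  stability threshold.\<close>

lemma initial_upper:
  assumes v: "sol f c 0 v" and \<gamma>: "0 \<le> \<gamma>" "\<gamma> * exp (2 * B) \<le> g"
    and X: "\<And>x. X \<le> x \<Longrightarrow> v 0 x \<le> \<gamma>" and q: "0 < q"
  obtains t0 \<sigma> where "0 \<le> t0" "\<And>x. v t0 x \<le> U t0 (x - \<sigma>) + q"
proof -
  define A where "A = (\<lambda>t. \<gamma> * exp (P0 t + B - \<mu> * t))"
  \<comment> \<open>Solves \<open>k + c - 1 = K\<close>, so that the residual of \<open>E\<close> is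
    \<open>K * E\<close>.\<close>
  define k where "k = K + 1 - c"
  define E where "E = (\<lambda>t x. exp (X - x + k * t))"
  have A0: "0 \<le> A t" for t using \<gamma> by (simp add: A_def)
  have Ag: "A t \<le> \<gamma> * exp (2 * B) * exp (- \<mu> * t)" if "0 \<le> t" for t
  proof -
    have "exp (P0 t + B - \<mu> * t) \<le> exp (2 * B + (- \<mu> * t))" using P0B[OF that] by simp
    also have "\<dots> = exp (2 * B) * exp (- \<mu> * t)" by (rule exp_add)
    finally show ?thesis using \<gamma>(1) unfolding A_def by (simp add: mult.assoc mult_left_mono)
  qed
  have A': "(A has_real_derivative ((a0 t + \<mu>) * A t)) (at t)" if "0 \<le> t" for t
    unfolding A_def by (auto intro!: derivative_eq_intros P0 that simp: algebra_simps)
  have E': "residual c E t x (K * E t x)" for t x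
    by (rule residualI[where wx = "\<lambda>x. - E t x"])
      (auto simp: E_def k_def algebra_simps intro!: derivative_eq_intros)
  have bound: "v t x \<le> A t + E t x" if t: "0 \<le> t" for t x
  proof -
    define W where "W = (\<lambda>t x. v t x - A t - E t x)"
    have "W t x \<le> 0"
    proof (rule max_principle[where W = W and D = UNIV and a = 0 and b = t and N = 1 and K = K and c = c])
      have "continuous_on {0..t} A"
        by (rule DERIV_continuous_on, rule has_field_derivative_at_within, rule A') auto
      then have "continuous_on ({0..t} \<times> UNIV) (\<lambda>p. A (fst p))"
        by (rule continuous_on_compose2) (auto intro!: continuous_intros)
      then show "continuous_on ({0..t} \<times> UNIV) (\<lambda>(t, x). W t x)"
        using sol_cont[OF v, of 0 t UNIV] unfolding W_def E_def case_prod_beta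
        by (auto intro!: continuous_intros)
      fix \<tau> y
      have E0: "0 \<le> E \<tau> y" for \<tau> y by (simp add: E_def)
      show "W \<tau> y \<le> 1" if "\<tau> \<in> {0..t}"
        using sol_range[OF v, of \<tau> y] that A0[of \<tau>] E0[of \<tau> y] unfolding W_def by auto
      show "W 0 y \<le> 0"
      proof (cases "X \<le> y")
        case True
        have "\<gamma> * 1 \<le> A 0" unfolding A_def using P0B[of 0] \<gamma>(1) by (intro mult_left_mono) auto
        then show ?thesis using X[OF True] E0[of 0 y] unfolding W_def by linarith
      next
        case False
        then have "1 \<le> E 0 y" by (simp add: E_def)
        then show ?thesis using sol_range[OF v, of 0 y] A0[of 0] unfolding W_def by simp
      qed
      assume h: "0 < \<tau>" "\<tau> \<le> t" "0 < W \<tau> y"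
      let ?r = "f \<tau> (v \<tau> y) - (a0 \<tau> + \<mu>) * A \<tau> - K * E \<tau> y"
      have "residual c W \<tau> y ?r"
        unfolding W_def using h by (intro residual_diff sol_residual[OF v] residual_time A' E') auto
      moreover have "?r \<le> K * W \<tau> y"
      \<comment> \<open>The reaction is split at \<open>A\<close>: Lipschitz from \<open>A\<close>
        up to \<open>v\<close>, linear bound from 0 up to \<open>A\<close>. The second part needs
        \<open>A \<le> g\<close>, which is where the hypothesis on \<gamma> enters.\<close>
      proof -
        have "A \<tau> \<le> v \<tau> y" using h(3) E0[of \<tau> y] unfolding W_def by linarith
        then have "\<bar>f \<tau> (v \<tau> y) - f \<tau> (A \<tau>)\<bar> \<le> K * (v \<tau> y - A \<tau>)"
          using sol_range[OF v, of \<tau> y] h A0 by (intro lip) auto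
        moreover have "f \<tau> (A \<tau>) - f \<tau> 0 \<le> (a0 \<tau> + \<mu>) * (A \<tau> - 0)"
        proof (rule near0)
          have "A \<tau> \<le> \<gamma> * exp (2 * B) * exp (- \<mu> * \<tau>)" using Ag h by simp
          also have "\<dots> \<le> \<gamma> * exp (2 * B) * 1" using \<gamma>(1) \<mu> h by (intro mult_left_mono) auto
          finally show "A \<tau> \<le> g" using \<gamma>(2) by simp
        qed (use A0 in auto)
        ultimately show ?thesis using f0 unfolding W_def by (simp add: algebra_simps)
      qed
      ultimately show "y \<in> interior UNIV \<and> (\<exists>r. residual c W \<tau> y r \<and> r \<le> K * W \<tau> y)" by auto
    qed (use t K in auto)
    then show ?thesis by (simp add: W_def)
  qed
  have "0 < q / 2" using q by simp
  then obtain L where L: "0 < L" "\<gamma> * exp (2 * B) * exp (- \<mu> * L) \<le> q / 2"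
    using exp_decay[OF \<mu>, of "q / 2" "\<gamma> * exp (2 * B)"] by auto
  define X2 where "X2 = X + k * L - ln (q / 2)"
  have right: "v L x \<le> q" if "X2 \<le> x" for x
  proof -
    have "E L x \<le> exp (ln (q / 2))" using that unfolding E_def X2_def by simp
    then have "E L x \<le> q / 2" using q by simp
    then show ?thesis using bound[of L x] Ag[of L] L by simp
  qed
  obtain R where R: "0 < R" "\<And>t x. x \<le> - R \<Longrightarrow> 1 - q \<le> U t x"
    using radius[OF q] by metis
  \<comment> \<open>With this shift the front is at least \<open>1 - q\<close> to the left of
    \<open>X2\<close>, while \<open>v\<close> is at most \<open>q\<close> to the right of
    it.\<close>
  show ?thesis
  proof (rule that[of L "X2 + R"])
    show "v L x \<le> U L (x - (X2 + R)) + q" for x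
    proof (cases "X2 \<le> x")
      case True
      have "0 \<le> U L (x - (X2 + R))" using sol_range[OF U] L by simp
      then show ?thesis using right[OF True] by simp
    next
      case False
      then have "1 - q \<le> U L (x - (X2 + R))" by (intro R) simp
      then show ?thesis using sol_range[OF v, of L x] L by simp
    qed
  qed (use L in simp)
qed

lemma upper_exists:
  assumes v: "sol f c 0 v" and \<gamma>: "0 \<le> \<gamma>" "\<gamma> * exp (2 * B) \<le> g"
    and X: "\<And>x. X \<le> x \<Longrightarrow> v 0 x \<le> \<gamma>"
  obtains \<sigma> where "upper v \<sigma>"
proof -
  obtain q0 \<Lambda> where q0: "0 < q0" and st: "\<And>t0 v q \<sigma> \<epsilon>. \<lbrakk>0 \<le> t0; sol f c t0 v; 0 \<le> q; q \<le> q0;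
      \<And>x. v t0 x \<le> U t0 (x - \<sigma>) + q; 0 < \<epsilon>\<rbrakk>
      \<Longrightarrow> \<exists>\<tau>. \<forall>t\<ge>\<tau>. \<forall>x. v t x \<le> U t (x - \<sigma> - \<Lambda> * q) + \<epsilon>"
    using stability_upper by metis
  obtain t0 \<sigma> where t0: "0 \<le> t0" and i: "\<And>x. v t0 x \<le> U t0 (x - \<sigma>) + q0"
    using initial_upper[OF v \<gamma> X q0] by blast
  have "upper v (\<sigma> + \<Lambda> * q0)" unfolding upper_def
    using st[OF t0 sol_later[OF v t0] _ _ i] q0 by (simp add: diff_diff_eq)
  then show ?thesis by (rule that)
qed

section \<open>The critical shift\<close>

text \<open>
  If \<open>w\<close> never comes close to \<open>U\<close> on the whole of \<open>[-R, R]\<close>, positivity of \<open>U - w\<close> spreads over that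
  interval and there is room to slide \<open>U\<close>.
\<close>

lemma upper_improve:
  assumes w: "sol f c 0 w" and up: "upper w 0" and \<delta>: "0 < \<delta>"
    and R: "\<And>t x. R \<le> x \<Longrightarrow> U t x \<le> g / 2" "\<And>t x. x \<le> - R + 1 \<Longrightarrow> 1 - g \<le> U t x" "0 < R"
    and gap: "\<And>t. \<tau>0 \<le> t \<Longrightarrow> \<exists>x. \<bar>x\<bar> \<le> R \<and> \<delta> < U t x - w t x"
  obtains \<kappa> where "0 < \<kappa>" "upper w (- \<kappa>)"
proof -
  define r where "r = \<delta> / (4 * M)"
  have r: "0 < r" using \<delta> M_pos by (simp add: r_def)
  \<comment> \<open>The point with a gap may wander over \<open>[-R, R]\<close> in time, so the gap
    must spread by \<open>2 * R\<close>; the delay is exactly one time unit.\<close>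
  obtain \<eta> where \<eta>: "0 < \<eta>" and sp: "spreads c r 1 (2 * R) 1 \<eta>"
    by (rule spread[OF r zero_less_one])
  \<comment> \<open>The first bound keeps \<open>w\<close> below \<open>g\<close> in the right tail,
    the second leaves half of the spread gap \<open>\<eta> * \<delta> / 2\<close>.\<close>
  define \<epsilon> where "\<epsilon> = min (g / 2) (\<eta> * \<delta> / (4 * exp K))"
  have \<epsilon>: "0 < \<epsilon>" "\<epsilon> \<le> g / 2" "\<epsilon> * exp K \<le> \<eta> * \<delta> / 4"
  proof -
    show "0 < \<epsilon>" using g(1) \<eta> \<delta> by (simp add: \<epsilon>_def)
    have "\<epsilon> \<le> \<eta> * \<delta> / (4 * exp K)" by (simp add: \<epsilon>_def)
    then show "\<epsilon> * exp K \<le> \<eta> * \<delta> / 4" by (simp add: field_simps)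
  qed (simp add: \<epsilon>_def)
  obtain \<tau>' where \<tau>': "\<And>t x. \<tau>' \<le> t \<Longrightarrow> w t x \<le> U t x + \<epsilon>"
    using up \<epsilon>(1) unfolding upper_def by (metis diff_zero)
  define \<tau>1 where "\<tau>1 = max 1 (max \<tau>0 \<tau>')"
  have \<tau>1: "1 \<le> \<tau>1" "\<tau>0 \<le> \<tau>1" "\<tau>' \<le> \<tau>1" by (auto simp: \<tau>1_def)
  have mid: "\<eta> * \<delta> / 4 \<le> U t x - w t x" if t: "\<tau>1 + 1 \<le> t" and x: "\<bar>x\<bar> \<le> R" for t x
  proof -
    define s where "s = t - 1"
    have s: "\<tau>1 \<le> s" "0 \<le> s" "1 \<le> s" "s + 1 = t" using t \<tau>1 by (auto simp: s_def)
    obtain x0 where x0: "\<bar>x0\<bar> \<le> R" "\<delta> < U s x0 - w s x0" using gap[of s] s \<tau>1 by auto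
    have "\<eta> * (\<delta> / 2) - \<epsilon> * exp (K * 1) \<le> U t x - w t x"
    proof (rule spreadsD[OF sp sol_later[OF w s(2)] sol_later[OF U s(2)], where ?x0.0 = x0])
      show "w s x \<le> U s x + \<epsilon>" for x using \<tau>' s \<tau>1 by simp
      show "\<delta> / 2 \<le> U s y - w s y" if "\<bar>y - x0\<bar> \<le> r" for y
      proof -
        have "M * \<bar>y - x0\<bar> \<le> \<delta> / 4" using that M_pos by (simp add: r_def field_simps)
        then show ?thesis using U_lip[OF s(2), of y x0] lipschitz[OF w, of s y x0] s(3) x0(2) by simp
      qed
      show "\<bar>x - x0\<bar> \<le> 2 * R" using x x0 by simp
    qed (use \<epsilon> \<delta> s in auto)
    then show ?thesis using \<epsilon>(3) by simp
  qed
  \<comment> \<open>The bound 1 matches the margin in the hypothesis on the left tail; the other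
    makes the slide cost at most the gap found in the centre.\<close>
  define \<kappa> where "\<kappa> = min 1 (\<eta> * \<delta> / (4 * M))"
  have \<kappa>: "0 < \<kappa>" "\<kappa> \<le> 1" using \<eta> \<delta> M_pos by (auto simp: \<kappa>_def)
  have M\<kappa>: "M * \<kappa> \<le> \<eta> * \<delta> / 4"
  proof -
    have "\<kappa> \<le> \<eta> * \<delta> / (4 * M)" by (simp add: \<kappa>_def)
    then show ?thesis using M_pos by (simp add: field_simps)
  qed
  define a where "a = \<tau>1 + 1"
  have a: "0 \<le> a" using \<tau>1 by (simp add: a_def)
  have dec: "w t x - U t (x - (- \<kappa>)) \<le> exp (2 * B) * (1 * exp (- \<mu> * (t - a)) + 0)" if t: "a \<le> t" for t x
  proof (rule outer[OF a sol_later[OF w a] sol_later[OF U_shift a], where l = "- R" and r = R and e = t])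
    show "w a x - U a (x - (- \<kappa>)) \<le> 1" for x
      using sol_range[OF w, of a x] sol_range[OF U, of a "x - (- \<kappa>)"] a by simp
    fix t x assume h: "a < t"
    have t: "0 \<le> t" "\<tau>1 + 1 \<le> t" "\<tau>' \<le> t" using h \<tau>1 by (auto simp: a_def)
    show "w t x - U t (x - (- \<kappa>)) \<le> 0" if "- R \<le> x" "x \<le> R"
    proof -
      have "\<eta> * \<delta> / 4 \<le> U t x - w t x" using that by (intro mid t) auto
      moreover have "U t x - U t (x + \<kappa>) \<le> M * \<kappa>" using U_lip[OF t(1), of x "x + \<kappa>"] \<kappa> by simp
      ultimately show ?thesis using M\<kappa> by simp
    qed
    show "w t x \<le> g" if "R \<le> x" using \<tau>'[OF t(3), of x] R(1)[OF that, of t] \<epsilon>(2) by simp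
    show "1 - g \<le> U t (x - (- \<kappa>))" if "x \<le> - R" using that \<kappa> by (intro R(2)) simp
  qed (use R(3) t in auto)
  have "upper w (- \<kappa>)" unfolding upper_def
  proof (intro allI impI)
    fix e :: real assume "0 < e"
    then obtain L where L: "\<And>t. L \<le> t \<Longrightarrow> exp (2 * B) * exp (- \<mu> * t) \<le> e"
      using exp_decay[OF \<mu>, of e "exp (2 * B)"] by blast
    have "w t x \<le> U t (x - (- \<kappa>)) + e" if "a + max 0 L \<le> t" for t x
    proof -
      have "a \<le> t" "L \<le> t - a" using that by auto
      then show ?thesis using dec[of t x] L[of "t - a"] by simp
    qed
    then show "\<exists>\<tau>. \<forall>t\<ge>\<tau>. \<forall>x. w t x \<le> U t (x - (- \<kappa>)) + e" by blast
  qed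
  then show ?thesis using that \<kappa> by blast
qed

text \<open>A gap larger than \<open>d\<close> in \<open>[-R, R]\<close> at any time of the window
  before \<open>t - 1\<close> would spread to the origin at time \<open>t\<close>, where the gap is
  small. Hence \<open>U - w\<close> is small in the centre during the whole window, and
  \<open>outer\<close>, now with \<open>U\<close> as the larger function, controls the tails at its
  end.\<close>

lemma global_touch:
  assumes w: "sol f c 0 w" and up: "upper w 0" and lo: "lower w \<sigma>"
    and touch: "\<And>R \<delta> \<tau>. 0 < \<delta> \<Longrightarrow> \<exists>t\<ge>\<tau>. \<forall>x. \<bar>x\<bar> \<le> R \<longrightarrow> U t x - w t x \<le> \<delta>"
    and q: "0 < q"
  shows "\<exists>t\<ge>\<tau>. \<forall>x. U t x - w t x \<le> q"
proof -
  obtain R0 where R0: "0 < R0" "\<And>t x. R0 \<le> x \<Longrightarrow> U t x \<le> g / 2" "\<And>t x. x \<le> - R0 \<Longrightarrow> 1 - g / 2 \<le> U t x"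
    using radius[of "g / 2"] g(1) by auto
  \<comment> \<open>The term \<open>\<bar>\<sigma>\<bar>\<close> lets the lower bound by the shifted
    front keep \<open>w\<close> near 1 to the left of \<open>- R\<close>.\<close>
  define R where "R = R0 + \<bar>\<sigma>\<bar>"
  have R: "0 < R" using R0 by (simp add: R_def)
  define d where "d = q / (2 * exp (2 * B))"
  have d: "0 < d" "exp (2 * B) * d = q / 2" using q by (auto simp: d_def)
  obtain L where L: "0 < L" "exp (2 * B) * exp (- \<mu> * L) \<le> q / 2"
    using exp_decay[OF \<mu>, of "q / 2" "exp (2 * B)"] q by auto
  define r where "r = d / (4 * M)"
  have r: "0 < r" using d M_pos by (simp add: r_def)
  obtain \<eta> where \<eta>: "0 < \<eta>" and sp: "spreads c r 1 R (L + 1) \<eta>"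
    by (rule spread[OF r zero_less_one])
  \<comment> \<open>A gap would leave at least three eighths of \<open>\<eta> * d\<close> at the
    origin, against the one eighth that \<open>touch\<close> allows.\<close>
  define \<epsilon> where "\<epsilon> = \<eta> * d / (8 * exp (K * (L + 1)))"
  have \<epsilon>: "0 < \<epsilon>" "\<epsilon> * exp (K * (L + 1)) = \<eta> * d / 8" using \<eta> d by (auto simp: \<epsilon>_def)
  obtain \<tau>1 where \<tau>1: "\<And>t x. \<tau>1 \<le> t \<Longrightarrow> w t x \<le> U t x + \<epsilon>"
    using up \<epsilon>(1) unfolding upper_def by (metis diff_zero)
  have "0 < g / 2" using g by simp
  then obtain \<tau>2 where \<tau>2: "\<And>t x. \<tau>2 \<le> t \<Longrightarrow> U t (x - \<sigma>) - g / 2 \<le> w t x"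
    using lo unfolding lower_def by metis
  define \<tau>3 where "\<tau>3 = max (max 1 \<tau>) (max \<tau>1 \<tau>2)"
  have \<tau>3: "1 \<le> \<tau>3" "\<tau> \<le> \<tau>3" "\<tau>1 \<le> \<tau>3" "\<tau>2 \<le> \<tau>3" by (auto simp: \<tau>3_def)
  have "0 < \<eta> * d / 8" using \<eta> d by simp
  then obtain t where t: "\<tau>3 + L + 1 \<le> t" and small: "\<And>x. \<bar>x\<bar> \<le> R \<Longrightarrow> U t x - w t x \<le> \<eta> * d / 8"
    using touch by metis
  have past: "U s x0 - w s x0 \<le> d" if s: "t - 1 - L \<le> s" "s \<le> t - 1" and x0: "\<bar>x0\<bar> \<le> R" for s x0
  proof (rule ccontr)
    assume n: "\<not> U s x0 - w s x0 \<le> d"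
    have s': "0 \<le> s" "1 \<le> s" "\<tau>1 \<le> s" using s t \<tau>3 by auto
    have "\<eta> * (d / 2) - \<epsilon> * exp (K * (L + 1)) \<le> U t 0 - w t 0"
    proof (rule spreadsD[OF sp sol_later[OF w s'(1)] sol_later[OF U s'(1)], where ?x0.0 = x0])
      show "w s x \<le> U s x + \<epsilon>" for x using \<tau>1 s' by simp
      show "d / 2 \<le> U s y - w s y" if "\<bar>y - x0\<bar> \<le> r" for y
      proof -
        have "M * \<bar>y - x0\<bar> \<le> d / 4" using that M_pos by (simp add: r_def field_simps)
        then show ?thesis using U_lip[OF s'(1), of y x0] lipschitz[OF w, of s y x0] s'(2) n by simp
      qed
    qed (use \<epsilon> d s x0 in auto)
    moreover have "U t 0 - w t 0 \<le> \<eta> * d / 8" using small R by simp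
    moreover have "0 < \<eta> * d" using \<eta> d by simp
    ultimately show False using \<epsilon>(2) by simp
  qed
  define a where "a = t - 1 - L"
  have a: "0 \<le> a" "\<tau>3 \<le> a" using t \<tau>3 by (auto simp: a_def)
  have "U (t - 1) x - w (t - 1) x \<le> exp (2 * B) * (1 * exp (- \<mu> * (t - 1 - a)) + d)" for x
  proof (rule outer[OF a(1) sol_later[OF U a(1)] sol_later[OF w a(1)], where l = "- R" and r = R and e = "t - 1"])
    show "U a x - w a x \<le> 1" for x
      using sol_range[OF w, of a x] sol_range[OF U, of a x] a by simp
    fix s x assume h: "a < s" "s \<le> t - 1"
    show "U s x - w s x \<le> d" if "- R \<le> x" "x \<le> R"
      using past[of s x] h that by (simp add: a_def)
    show "U s x \<le> g" if "R \<le> x"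
    proof -
      have "R0 \<le> x" using that unfolding R_def by linarith
      then show ?thesis using R0(2)[of x s] g(1) by simp
    qed
    show "1 - g \<le> w s x" if "x \<le> - R"
    proof -
      have "1 - g / 2 \<le> U s (x - \<sigma>)" using that by (intro R0(3)) (simp add: R_def)
      then show ?thesis using \<tau>2[of s x] h a \<tau>3 by simp
    qed
  qed (use R d L a_def in auto)
  moreover have "exp (2 * B) * (1 * exp (- \<mu> * (t - 1 - a)) + d) \<le> q"
    using L(2) d(2) by (simp add: a_def distrib_left)
  ultimately have "U (t - 1) x - w (t - 1) x \<le> q" for x by (rule order_trans)
  moreover have "\<tau> \<le> t - 1" using t \<tau>3 L by simp
  ultimately show ?thesis by blast
qed

text \<open>Criticality excludes a persistent gap on any bounded interval, for
  \<open>upper_improve\<close> would then lower the shift. Thus \<open>global_touch\<close> yields a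
  time when \<open>U - w\<close> is below any \<open>q\<close>, and stability of the reflected front
  propagates this with a shift of order \<open>q\<close>.\<close>

lemma critical_limit:
  assumes w: "sol f c 0 w" and up: "upper w 0" and lo: "lower w \<sigma>"
    and crit: "\<And>\<kappa>. 0 < \<kappa> \<Longrightarrow> \<not> upper w (- \<kappa>)"
  shows "lower w 0"
proof -
  interpret dual: front "\<lambda>t u. - f t (1 - u)" K g \<mu> B a1 a0 P1 P0 T "- c" "\<lambda>t x. 1 - U t (- x)"
    by (rule front_dual) unfold_locales
  have touch: "\<exists>t\<ge>\<tau>. \<forall>x. \<bar>x\<bar> \<le> R \<longrightarrow> U t x - w t x \<le> \<delta>" if \<delta>: "0 < \<delta>" for R \<delta> \<tau>
  proof (rule ccontr)
    assume n: "\<not> ?thesis"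
    obtain R0 where R0: "0 < R0" "\<And>t x. R0 \<le> x \<Longrightarrow> U t x \<le> g / 2" "\<And>t x. x \<le> - R0 \<Longrightarrow> 1 - g / 2 \<le> U t x"
      using radius[of "g / 2"] g(1) by auto
    define R' where "R' = max R (R0 + 1)"
    obtain \<kappa> where "0 < \<kappa>" "upper w (- \<kappa>)"
    proof (rule upper_improve[OF w up \<delta>, of R' \<tau>])
      show "U t x \<le> g / 2" if "R' \<le> x" for t x using that by (intro R0) (simp add: R'_def)
      show "1 - g \<le> U t x" if "x \<le> - R' + 1" for t x
      proof -
        have "1 - g / 2 \<le> U t x" using that by (intro R0(3)) (simp add: R'_def)
        then show ?thesis using g(1) by simp
      qed
      show "0 < R'" using R0 by (simp add: R'_def)
      show "\<exists>x. \<bar>x\<bar> \<le> R' \<and> \<delta> < U t x - w t x" if t: "\<tau> \<le> t" for t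
      proof -
        obtain x where "\<bar>x\<bar> \<le> R" "\<delta> < U t x - w t x" using n t by (meson not_le)
        then show ?thesis by (intro exI[of _ x]) (simp add: R'_def)
      qed
    qed
    then show False using crit by blast
  qed
  obtain q0 \<Lambda> where q0: "0 < q0" "0 \<le> \<Lambda>" and st: "\<And>t0 v q \<sigma> \<epsilon>. \<lbrakk>0 \<le> t0; sol (\<lambda>t u. - f t (1 - u)) (- c) t0 v; 0 \<le> q; q \<le> q0;
      \<And>x. v t0 x \<le> 1 - U t0 (- (x - \<sigma>)) + q; 0 < \<epsilon>\<rbrakk>
      \<Longrightarrow> \<exists>\<tau>. \<forall>t\<ge>\<tau>. \<forall>x. v t x \<le> 1 - U t (- (x - \<sigma> - \<Lambda> * q)) + \<epsilon>"
    using dual.stability_upper by metis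
  show ?thesis unfolding lower_def
  proof (intro allI impI)
    fix \<epsilon> :: real assume \<epsilon>: "0 < \<epsilon>"
    \<comment> \<open>Half of \<epsilon> is for the stability error, half for undoing the shift
      \<open>\<Lambda> * q\<close> at Lipschitz cost \<open>M\<close>.\<close>
    define q where "q = min q0 (\<epsilon> / (2 * (M * \<Lambda> + 1)))"
    have M\<Lambda>: "0 < M * \<Lambda> + 1" using M_pos q0 by (simp add: add_nonneg_pos)
    then have q: "0 < q" "q \<le> q0" using q0 \<epsilon> by (auto simp: q_def)
    have "q \<le> \<epsilon> / (2 * (M * \<Lambda> + 1))" by (simp add: q_def)
    then have "q * (M * \<Lambda> + 1) \<le> \<epsilon> / 2" using M\<Lambda> by (simp add: field_simps)
    then have qM: "M * (\<Lambda> * q) \<le> \<epsilon> / 2" using q(1) by (simp add: algebra_simps)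
    obtain t0 where t0: "0 \<le> t0" "\<And>x. U t0 x - w t0 x \<le> q"
      using global_touch[OF w up lo touch q(1), of 0] by blast
    have "\<exists>\<tau>. \<forall>t\<ge>\<tau>. \<forall>x. 1 - w t (- x) \<le> 1 - U t (- (x - 0 - \<Lambda> * q)) + \<epsilon> / 2"
    proof (rule st[OF t0(1) sol_dual[OF sol_later[OF w t0(1)]]])
      show "1 - w t0 (- x) \<le> 1 - U t0 (- (x - 0)) + q" for x using t0(2)[of "-x"] by simp
    qed (use q \<epsilon> in auto)
    then obtain \<tau> where \<tau>: "\<And>t x. \<tau> \<le> t \<Longrightarrow> 1 - w t (- x) \<le> 1 - U t (- (x - 0 - \<Lambda> * q)) + \<epsilon> / 2"
      by blast
    have "U t (x - 0) - \<epsilon> \<le> w t x" if "max 0 \<tau> \<le> t" for t x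
    proof -
      have t: "0 \<le> t" "\<tau> \<le> t" using that by auto
      have "0 \<le> \<Lambda> * q" using q q0 by simp
      then have "U t x - U t (x + \<Lambda> * q) \<le> M * (\<Lambda> * q)" using U_lip[OF t(1), of x "x + \<Lambda> * q"] by simp
      moreover have "U t (x + \<Lambda> * q) - \<epsilon> / 2 \<le> w t x" using \<tau>[OF t(2), of "- x"] by (simp add: add.commute)
      ultimately have "U t x - \<epsilon> \<le> w t x" using qM by linarith
      then show ?thesis by simp
    qed
    then show "\<exists>\<tau>. \<forall>t\<ge>\<tau>. \<forall>x. U t (x - 0) - \<epsilon> \<le> w t x" by blast
  qed
qed

text \<open>At multiples of \<open>T\<close> the front has its profile of time 0, whose strict
  monotonicity separates the two bounds at the origin. This bounds the admissible upper shifts from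
  below.\<close>

lemma upper_ge_lower:
  assumes up: "upper v \<sigma>" and lo: "lower v \<sigma>'"
  shows "\<sigma>' \<le> \<sigma>"
proof (rule ccontr)
  assume "\<not> \<sigma>' \<le> \<sigma>"
  then have "U 0 (- \<sigma>) < U 0 (- \<sigma>')" by (intro U_strict) auto
  define e where "e = (U 0 (- \<sigma>') - U 0 (- \<sigma>)) / 4"
  have e: "0 < e" "4 * e = U 0 (- \<sigma>') - U 0 (- \<sigma>)" using \<open>U 0 (- \<sigma>) < U 0 (- \<sigma>')\<close> by (simp_all add: e_def)
  obtain \<tau>1 where 1: "\<And>t x. \<tau>1 \<le> t \<Longrightarrow> v t x \<le> U t (x - \<sigma>) + e" using up e(1) unfolding upper_def by metis
  obtain \<tau>2 where 2: "\<And>t x. \<tau>2 \<le> t \<Longrightarrow> U t (x - \<sigma>') - e \<le> v t x" using lo e(1) unfolding lower_def by metis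
  obtain n where n: "max \<tau>1 \<tau>2 \<le> 0 + real n * T" by (rule late_period)
  then have "v (0 + real n * T) 0 \<le> U 0 (- \<sigma>) + e" "U 0 (- \<sigma>') - e \<le> v (0 + real n * T) 0"
    using 1[of "0 + real n * T" 0] 2[of "0 + real n * T" 0] unfolding per_n by simp_all
  then show False using e by linarith
qed

text \<open>The Lipschitz bound on \<open>U\<close> makes the infimum of the upper shifts itself
  admissible; translating by it puts the critical shift at 0.\<close>

lemma convergence:
  assumes v: "sol f c 0 v" and up: "upper v \<sigma>" and lo: "lower v \<sigma>'"
  shows "\<exists>\<sigma>. upper v \<sigma> \<and> lower v \<sigma>"
proof -
  define S where "S = {\<sigma>. upper v \<sigma>}"
  have S: "\<sigma> \<in> S" using up by (simp add: S_def)
  have bdd: "bdd_below S" by (rule bdd_belowI[of _ \<sigma>']) (use upper_ge_lower lo in \<open>simp add: S_def\<close>)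
  define m where "m = Inf S"
  have um: "upper v m" unfolding upper_def
  proof (intro allI impI)
    fix \<epsilon> :: real assume \<epsilon>: "0 < \<epsilon>"
    have "m < m + \<epsilon> / (2 * M)" using \<epsilon> M_pos by simp
    moreover have "S \<noteq> {}" using S by auto
    ultimately obtain s where s: "s \<in> S" "s < m + \<epsilon> / (2 * M)"
      using cInf_lessD[of S "m + \<epsilon> / (2 * M)"] unfolding m_def by blast
    have "m \<le> s" unfolding m_def using s bdd by (intro cInf_lower)
    have "M * (s - m) \<le> \<epsilon> / 2" using s(2) M_pos by (simp add: field_simps)
    obtain \<tau> where \<tau>: "\<And>t x. \<tau> \<le> t \<Longrightarrow> v t x \<le> U t (x - s) + \<epsilon> / 2"
      using s(1)[unfolded S_def mem_Collect_eq upper_def, rule_format, OF half_gt_zero[OF \<epsilon>]] by blast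
    have "v t x \<le> U t (x - m) + \<epsilon>" if "max 0 \<tau> \<le> t" for t x
    proof -
      have t: "0 \<le> t" "\<tau> \<le> t" using that by auto
      have "U t (x - s) - U t (x - m) \<le> M * (s - m)" using U_lip[OF t(1), of "x - s" "x - m"] \<open>m \<le> s\<close> by simp
      then show ?thesis using \<tau>[OF t(2), of x] \<open>M * (s - m) \<le> \<epsilon> / 2\<close> by linarith
    qed
    then show "\<exists>\<tau>. \<forall>t\<ge>\<tau>. \<forall>x. v t x \<le> U t (x - m) + \<epsilon>" by blast
  qed
  define w where "w = (\<lambda>t x. v t (x + m))"
  have upw: "upper w s \<longleftrightarrow> upper v (s + m)" for s
  proof -
    have "(\<forall>x. w t x \<le> U t (x - s) + \<epsilon>) \<longleftrightarrow> (\<forall>x. v t x \<le> U t (x - (s + m)) + \<epsilon>)" (is "?L \<longleftrightarrow> ?R") for t \<epsilon>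
    proof (intro iffI allI)
      show "v t x \<le> U t (x - (s + m)) + \<epsilon>" if ?L for x
        using that[rule_format, of "x - m"] by (simp add: w_def diff_diff_eq add.commute)
      show "w t x \<le> U t (x - s) + \<epsilon>" if ?R for x
        using that[rule_format, of "x + m"] by (simp add: w_def)
    qed
    then show ?thesis unfolding upper_def by simp
  qed
  have low: "lower w s \<longleftrightarrow> lower v (s + m)" for s
  proof -
    have "(\<forall>x. U t (x - s) - \<epsilon> \<le> w t x) \<longleftrightarrow> (\<forall>x. U t (x - (s + m)) - \<epsilon> \<le> v t x)" (is "?L \<longleftrightarrow> ?R") for t \<epsilon>
    proof (intro iffI allI)
      show "U t (x - (s + m)) - \<epsilon> \<le> v t x" if ?L for x
        using that[rule_format, of "x - m"] by (simp add: w_def diff_diff_eq add.commute)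
      show "U t (x - s) - \<epsilon> \<le> w t x" if ?R for x
        using that[rule_format, of "x + m"] by (simp add: w_def)
    qed
    then show ?thesis unfolding lower_def by simp
  qed
  have "lower w 0"
  proof (rule critical_limit)
    show "sol f c 0 w" unfolding w_def by (rule sol_shift[OF v])
    show "upper w 0" using um by (simp add: upw)
    show "lower w (\<sigma>' - m)" using lo by (simp add: low)
    show "\<not> upper w (- \<kappa>)" if "0 < \<kappa>" for \<kappa>
    proof
      assume "upper w (- \<kappa>)"
      then have "- \<kappa> + m \<in> S" by (simp add: upw S_def)
      then have "m \<le> - \<kappa> + m" unfolding m_def using bdd by (intro cInf_lower)
      then show False using that by simp
    qed
  qed
  then show ?thesis using um low by auto
qed

lemma front_attracts:
  assumes v: "sol f c 0 v" and \<gamma>: "0 \<le> \<gamma>" "\<gamma> * exp (2 * B) \<le> g"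
    and X: "\<And>x. X \<le> x \<Longrightarrow> v 0 x \<le> \<gamma>" and Y: "\<And>x. x \<le> Y \<Longrightarrow> 1 - \<gamma> \<le> v 0 x"
  shows "\<exists>\<sigma>. \<forall>\<epsilon>>0. \<exists>\<tau>. \<forall>t\<ge>\<tau>. \<forall>x. \<bar>v t x - U t (x - \<sigma>)\<bar> \<le> \<epsilon>"
proof -
  interpret dual: front "\<lambda>t u. - f t (1 - u)" K g \<mu> B a1 a0 P1 P0 T "- c" "\<lambda>t x. 1 - U t (- x)"
    by (rule front_dual) unfold_locales
  obtain \<sigma> where \<sigma>: "upper v \<sigma>" using upper_exists[OF v \<gamma> X] by blast
  obtain \<sigma>' where \<sigma>': "dual.upper (\<lambda>t x. 1 - v t (- x)) \<sigma>'"
  proof (rule dual.upper_exists[OF sol_dual[OF v] \<gamma>, of "- Y"])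
    show "1 - v 0 (- x) \<le> \<gamma>" if "- Y \<le> x" for x using Y[of "- x"] that by simp
  qed
  have "lower v (- \<sigma>')" unfolding lower_def
  proof (intro allI impI)
    fix \<epsilon> :: real assume "0 < \<epsilon>"
    then obtain \<tau> where \<tau>: "\<And>t x. \<tau> \<le> t \<Longrightarrow> 1 - v t (- x) \<le> 1 - U t (- (x - \<sigma>')) + \<epsilon>"
      using \<sigma>' unfolding dual.upper_def by metis
    have "U t (x - (- \<sigma>')) - \<epsilon> \<le> v t x" if "\<tau> \<le> t" for t x
      using \<tau>[OF that, of "- x"] by (simp add: add.commute)
    then show "\<exists>\<tau>. \<forall>t\<ge>\<tau>. \<forall>x. U t (x - (- \<sigma>')) - \<epsilon> \<le> v t x" by blast
  qed
  then obtain s where s: "upper v s" "lower v s" using convergence[OF v \<sigma>] by blast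
  show ?thesis
  proof (rule exI[of _ s], intro allI impI)
    fix \<epsilon> :: real assume e: "0 < \<epsilon>"
    obtain \<tau>1 where 1: "\<And>t x. \<tau>1 \<le> t \<Longrightarrow> v t x \<le> U t (x - s) + \<epsilon>" using s(1) e unfolding upper_def by metis
    obtain \<tau>2 where 2: "\<And>t x. \<tau>2 \<le> t \<Longrightarrow> U t (x - s) - \<epsilon> \<le> v t x" using s(2) e unfolding lower_def by metis
    have "\<bar>v t x - U t (x - s)\<bar> \<le> \<epsilon>" if "max \<tau>1 \<tau>2 \<le> t" for t x
      using 1[of t x] 2[of t x] that by simp
    then show "\<exists>\<tau>. \<forall>t\<ge>\<tau>. \<forall>x. \<bar>v t x - U t (x - s)\<bar> \<le> \<epsilon>" by blast
  qed
qed

end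

section \<open>Reduction of the theorem to the locale\<close>

lemma mvt_unit_interval:
  fixes F F' :: "real \<Rightarrow> real"
  assumes F: "\<And>x. x \<in> {0..1} \<Longrightarrow> (F has_real_derivative F' x) (at x within {0..1})"
    and ab: "0 \<le> a" "a \<le> b" "b \<le> 1"
  obtains x where "a \<le> x" "x \<le> b" "F b - F a = F' x * (b - a)"
proof (cases "a = b")
  case False
  have "\<exists>x\<in>{a<..<b}. F b - F a = F' x * (b - a)"
  proof (rule mvt_simple)
    fix x assume x: "a \<le> x" "x \<le> b"
    then have "(F has_real_derivative F' x) (at x within {a..b})"
      using ab by (intro has_field_derivative_subset[OF F]) auto
    then show "(F has_derivative (\<lambda>h. F' x * h)) (at x within {a..b})"
      by (simp add: has_field_derivative_def)
  qed (use False ab in simp)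
  then obtain x where "a < x" "x < b" "F b - F a = F' x * (b - a)" by auto
  then show ?thesis by (intro that[of x]) auto
qed (use that[of a] in simp)

lemma periodic_shift:
  fixes F :: "real \<Rightarrow> real"
  assumes "\<And>t. 0 \<le> t \<Longrightarrow> F (t + T) = F t" "0 \<le> t" "0 \<le> T"
  shows "F (t + real n * T) = F t"
proof (induction n)
  case (Suc n)
  have "F (t + real (Suc n) * T) = F ((t + real n * T) + T)" by (simp add: algebra_simps)
  then show ?case using Suc assms by simp
qed simp

lemma periodic_bounded_nonneg:
  fixes F :: "real \<Rightarrow> real"
  assumes T: "0 < T" and cont: "continuous_on {0..T} F" and per: "\<And>t. 0 \<le> t \<Longrightarrow> F (t + T) = F t"
  obtains N where "0 \<le> N" "\<And>t. 0 \<le> t \<Longrightarrow> \<bar>F t\<bar> \<le> N"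
proof -
  have "bounded (F ` {0..T})" using cont by (intro compact_imp_bounded compact_continuous_image) auto
  then obtain N where N: "\<And>t. t \<in> {0..T} \<Longrightarrow> \<bar>F t\<bar> \<le> N"
    unfolding bounded_iff real_norm_def by blast
  have "\<bar>F t\<bar> \<le> N" if t: "0 \<le> t" for t
  proof -
    obtain n s where n: "t = s + real n * T" "0 \<le> s" "s < T" using mod_period[OF T t] .
    have "F t = F s" unfolding n(1) using per n(2) T by (intro periodic_shift) auto
    then show ?thesis using N[of s] n by simp
  qed
  moreover have "0 \<le> N" using N[of 0] T by (auto intro: order_trans[OF abs_ge_zero])
  ultimately show ?thesis using that by blast
qed

lemma periodic_bounded:
  fixes F :: "real \<Rightarrow> real"
  assumes T: "0 < T" and cont: "continuous_on UNIV F" and per: "\<And>t. F (t + T) = F t"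
  obtains N where "0 \<le> N" "\<And>t. \<bar>F t\<bar> \<le> N"
proof -
  obtain N where N: "0 \<le> N" "\<And>t. 0 \<le> t \<Longrightarrow> \<bar>F t\<bar> \<le> N"
    using periodic_bounded_nonneg[of T F] T per continuous_on_subset[OF cont] by blast
  have "\<bar>F t\<bar> \<le> N" for t
  proof -
    obtain n where "- t / T \<le> real n" using real_arch_simple by blast
    then have "0 \<le> t + real n * T" using T by (simp add: field_simps)
    moreover have "F (t + real n * T) = F t" for n
    proof (induction n)
      case (Suc n)
      have "F (t + real (Suc n) * T) = F ((t + real n * T) + T)" by (simp add: algebra_simps)
      then show ?case using Suc per by simp
    qed simp
    ultimately show ?thesis using N(2) by metis
  qed
  then show ?thesis using that N(1) by blast
qed

lemma bounded_antiderivative: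
  fixes b :: "real \<Rightarrow> real"
  assumes T: "0 < T" and cont: "continuous_on UNIV b" and per: "\<And>t. b (t + T) = b t"
    and mean: "integral {0..T} b = 0"
  obtains P B where "0 \<le> B" "\<And>t. 0 \<le> t \<Longrightarrow> (P has_real_derivative b t) (at t)"
    "\<And>t. 0 \<le> t \<Longrightarrow> \<bar>P t\<bar> \<le> B"
proof -
  \<comment> \<open>Starting the integral at -1 rather than 0 gives a two-sided derivative at
    \<open>t = 0\<close>.\<close>
  define P where "P = (\<lambda>t. integral {-1..t} b)"
  have P': "(P has_real_derivative b t) (at t)" if "0 \<le> t" for t
  proof -
    have "(P has_real_derivative b t) (at t within {-1..t + 1})"
      unfolding P_def using that by (intro integral_has_real_derivative continuous_on_subset[OF cont]) auto
    moreover have "at t within {-1..t + 1} = at t" using that by (intro at_within_Icc_at) auto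
    ultimately show ?thesis by simp
  qed
  have int: "b integrable_on {-1..T}"
    by (intro integrable_continuous_interval continuous_on_subset[OF cont]) auto
  have "integral {-1..0} b + integral {0..T} b = integral {-1..T} b"
    by (rule Henstock_Kurzweil_Integration.integral_combine) (use T int in auto)
  then have P0: "P T = P 0" unfolding P_def mean by simp
  have "P (t + T) = P t" if t: "0 \<le> t" for t
  proof (cases "t = 0")
    case False
    define d where "d = (\<lambda>t. P (t + T) - P t)"
    have d': "(d has_real_derivative 0) (at s)" if "0 \<le> s" for s
    proof -
      have "((\<lambda>t. P (t + T)) has_real_derivative b (s + T)) (at s)"
        using P'[of "s + T"] that T by (simp add: DERIV_shift)
      from DERIV_diff[OF this P'[OF that]] show ?thesis by (simp add: d_def per)
    qed
    have "d t = d 0"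
    proof (rule DERIV_isconst_end[where f = d])
      show "continuous_on {0..t} d"
        by (rule DERIV_continuous_on, rule has_field_derivative_at_within, rule d') auto
    qed (use t False d' in auto)
    then show ?thesis using P0 by (simp add: d_def)
  qed (use P0 in simp)
  moreover have "continuous_on {0..T} P"
    by (rule DERIV_continuous_on, rule has_field_derivative_at_within, rule P') auto
  ultimately obtain B where "0 \<le> B" "\<And>t. 0 \<le> t \<Longrightarrow> \<bar>P t\<bar> \<le> B"
    using periodic_bounded_nonneg[OF T] by metis
  then show ?thesis using that P' by blast
qed

text \<open>The regularity assumptions control the \<open>t\<close>-dependence of \<open>f\<close>
  itself but do not state continuity of \<open>f_u\<close> in \<open>t\<close>. The slope at a rest
  state inherits continuity and periodicity as the uniform limit of the difference quotients
  \<open>G t u / u\<close>.\<close>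

lemma slope_continuous:
  fixes G :: "real \<Rightarrow> real \<Rightarrow> real" and a :: "real \<Rightarrow> real"
  assumes G: "\<And>t u. u \<in> {0..1} \<Longrightarrow> \<bar>G t u - a t * u\<bar> \<le> C * u\<^sup>2"
    and cont: "\<And>u. u \<in> {0..1} \<Longrightarrow> continuous_on UNIV (\<lambda>t. G t u)"
    and per: "\<And>t u. u \<in> {0..1} \<Longrightarrow> G (t + T) u = G t u"
  shows "continuous_on UNIV a" "a (t + T) = a t"
proof -
  have est: "\<bar>G t u / u - a t\<bar> \<le> C * u" if u: "0 < u" "u \<le> 1" for t u
  proof -
    have "\<bar>G t u / u - a t\<bar> = \<bar>G t u - a t * u\<bar> / u" using u by (simp add: field_simps abs_div)
    also have "\<dots> \<le> C * u\<^sup>2 / u" using G[of u t] u by (intro divide_right_mono) auto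
    also have "\<dots> = C * u" using u by (simp add: power2_eq_square)
    finally show ?thesis .
  qed
  have C: "0 \<le> C" using est[of 1 0] by (auto intro: order_trans[OF abs_ge_zero])
  have small: "\<exists>u. 0 < u \<and> u \<le> 1 \<and> (\<forall>t. \<bar>G t u / u - a t\<bar> \<le> e)" if e: "0 < e" for e
  proof -
    define u where "u = min 1 (e / (C + 1))"
    have u: "0 < u" "u \<le> 1" using e C by (auto simp: u_def)
    have "C * u \<le> C * (e / (C + 1))" using C by (intro mult_left_mono) (auto simp: u_def)
    also have "\<dots> \<le> e" using C e by (simp add: field_simps)
    finally have "C * u \<le> e" .
    then have "\<bar>G t u / u - a t\<bar> \<le> e" for t using est[OF u, of t] by linarith
    then show ?thesis using u by blast
  qed
  show "a (t + T) = a t"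
  proof (rule ccontr)
    assume "a (t + T) \<noteq> a t"
    define e where "e = \<bar>a (t + T) - a t\<bar> / 3"
    have e: "0 < e" "3 * e = \<bar>a (t + T) - a t\<bar>" using \<open>a (t + T) \<noteq> a t\<close> by (auto simp: e_def)
    obtain u where u: "0 < u" "u \<le> 1" "\<And>t. \<bar>G t u / u - a t\<bar> \<le> e" using small[OF e(1)] by blast
    have "G (t + T) u = G t u" using u by (intro per) auto
    then show False using u(3)[of t] u(3)[of "t + T"] e by (simp add: abs_if split: if_splits)
  qed
  define F where "F = (\<lambda>n t. G t (inverse (real (Suc n))) / inverse (real (Suc n)))"
  show "continuous_on UNIV a"
  proof (rule uniform_limit_theorem[where f = F and F = sequentially])
    have inv: "inverse (real (Suc n)) \<in> {0..1}" for n by (simp add: inverse_le_1_iff)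
    show "\<forall>\<^sub>F n in sequentially. continuous_on UNIV (F n)"
      unfolding F_def using inv by (intro always_eventually allI continuous_on_divide cont continuous_on_const) auto
    show "uniform_limit UNIV F a sequentially"
    proof (rule uniform_limitI)
      fix e :: real assume e: "0 < e"
      have "(\<lambda>n. C * inverse (real (Suc n))) \<longlonglongrightarrow> C * 0"
        by (intro tendsto_mult tendsto_const LIMSEQ_inverse_real_of_nat)
      then have "\<forall>\<^sub>F n in sequentially. C * inverse (real (Suc n)) < e"
        using e by (intro order_tendstoD(2)) auto
      then show "\<forall>\<^sub>F n in sequentially. \<forall>t\<in>UNIV. dist (F n t) (a t) < e"
      proof eventually_elim
        case (elim n)
        have "dist (F n t) (a t) \<le> C * inverse (real (Suc n))" for t
          unfolding F_def dist_real_def using inv[of n] by (intro est) auto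
        then show ?case using elim by (auto intro: le_less_trans)
      qed
    qed
  qed simp
qed

section \<open>Quantitative bounds for the nonlinearity\<close>

lemma bistable_derivatives:
  assumes "bistable_on_average T f" "u \<in> {0..1}"
  shows "(f t has_real_derivative f_u f t u) (at u within {0..1})"
    and "(f_u f t has_real_derivative f_uu f t u) (at u within {0..1})"
  using assms unfolding bistable_on_average_def C2_in_u_uniformly_def f_u_def f_uu_def
  by (simp_all add: has_real_derivative_iff_has_vector_derivative vector_derivative_works[symmetric])

text \<open>Bolzano's bisection lemma replaces a compactness argument that would be uniform in \<open>t\<close>.\<close>

lemma f_uu_oscillation:
  assumes f: "bistable_on_average T f"
  obtains N where "0 \<le> N" "\<And>t u. u \<in> {0..1} \<Longrightarrow> \<bar>f_uu f t u - f_uu f t 0\<bar> \<le> N"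
proof -
  define Q where "Q = (\<lambda>a b. \<exists>N. \<forall>t. \<forall>u\<in>{a..b} \<inter> {0..1}. \<forall>w\<in>{a..b} \<inter> {0..1}. \<bar>f_uu f t u - f_uu f t w\<bar> \<le> N)"
  have "Q 0 1"
  proof (rule Bolzano)
    fix a b c :: real assume "Q a b" "Q b c" and abc: "a \<le> b" "b \<le> c"
    then obtain N1 N2 where N1: "\<And>t u w. u \<in> {a..b} \<inter> {0..1} \<Longrightarrow> w \<in> {a..b} \<inter> {0..1} \<Longrightarrow> \<bar>f_uu f t u - f_uu f t w\<bar> \<le> N1"
      and N2: "\<And>t u w. u \<in> {b..c} \<inter> {0..1} \<Longrightarrow> w \<in> {b..c} \<inter> {0..1} \<Longrightarrow> \<bar>f_uu f t u - f_uu f t w\<bar> \<le> N2"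
      unfolding Q_def by blast
    have *: "\<bar>f_uu f t u - f_uu f t w\<bar> \<le> \<bar>N1\<bar> + \<bar>N2\<bar>"
      if "u \<in> {a..c} \<inter> {0..1}" "w \<in> {a..c} \<inter> {0..1}" "u \<le> w" for t u w
    proof -
      consider "w \<le> b" | "b \<le> u" | "u \<le> b" "b \<le> w" by linarith
      then show ?thesis
      proof cases
        case 1
        then show ?thesis using N1[of u w t] that by auto
      next
        case 2
        then show ?thesis using N2[of u w t] that by auto
      next
        case 3
        then show ?thesis using N1[of u b t] N2[of b w t] that abc by auto
      qed
    qed
    have "\<bar>f_uu f t u - f_uu f t w\<bar> \<le> \<bar>N1\<bar> + \<bar>N2\<bar>"
      if "u \<in> {a..c} \<inter> {0..1}" "w \<in> {a..c} \<inter> {0..1}" for t u w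
      using *[of u w t] *[of w u t] that by (cases "u \<le> w") (auto simp: abs_minus_commute)
    then show "Q a c" unfolding Q_def by blast
  next
    fix x :: real assume x: "0 \<le> x" "x \<le> 1"
    then have "uniform_limit UNIV (\<lambda>w t. f_uu f t w) (\<lambda>t. f_uu f t x) (at x within {0..1})"
      using f unfolding bistable_on_average_def C2_in_u_uniformly_def by simp
    from uniform_limitD[OF this zero_less_one] obtain d where d: "0 < d"
      "\<And>w t. w \<in> {0..1} \<Longrightarrow> w \<noteq> x \<Longrightarrow> dist w x < d \<Longrightarrow> dist (f_uu f t w) (f_uu f t x) < 1"
      unfolding eventually_at by auto
    have d': "\<bar>f_uu f t w - f_uu f t x\<bar> \<le> 1" if "w \<in> {0..1}" "\<bar>w - x\<bar> < d" for w t
      using d(2)[of w t] that by (cases "w = x") (auto simp: dist_real_def)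
    have "Q a b" if "a \<le> x" "x \<le> b" "b - a < d" for a b
      unfolding Q_def
    proof (intro exI[of _ 2] allI ballI)
      fix t u w assume "u \<in> {a..b} \<inter> {0..1}" "w \<in> {a..b} \<inter> {0..1}"
      then have "\<bar>f_uu f t u - f_uu f t x\<bar> \<le> 1" "\<bar>f_uu f t w - f_uu f t x\<bar> \<le> 1"
        using that by (auto intro!: d')
      then show "\<bar>f_uu f t u - f_uu f t w\<bar> \<le> 2" by linarith
    qed
    then show "\<exists>d>0. \<forall>a b. a \<le> x \<and> x \<le> b \<and> b - a < d \<longrightarrow> Q a b" using d(1) by blast
  qed simp
  then obtain N where N: "\<And>t u w. u \<in> {0..1} \<Longrightarrow> w \<in> {0..1} \<Longrightarrow> \<bar>f_uu f t u - f_uu f t w\<bar> \<le> N"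
    unfolding Q_def Int_absorb by blast
  have "0 \<le> N" using N[of 0 0] by simp
  then show ?thesis using that N[of _ 0] by simp
qed

lemma bistable_continuous:
  assumes f: "bistable_on_average T f" and u: "u \<in> {0..1}"
  shows "continuous_on UNIV (\<lambda>t. f t u)"
  using assms unfolding bistable_on_average_def C1_in_t_uniformly_def
  by (intro differentiable_imp_continuous_on) (auto simp: differentiable_on_def)

text \<open>The oscillation bound leaves \<open>f_uu\<close> at 0 unknown. Expanding at 0 and
  evaluating at 1, where \<open>f\<close> vanishes, and at 1/2, where \<open>f\<close> is bounded by
  periodicity, gives two independent linear relations for \<open>f_u\<close> and \<open>f_uu\<close>
  at 0.\<close>

lemma bistable_bounds:
  assumes T: "0 < T" and f: "bistable_on_average T f"
  obtains C where "0 < C" "\<And>t u. u \<in> {0..1} \<Longrightarrow> \<bar>f_u f t u\<bar> \<le> C"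
    "\<And>t u w. u \<in> {0..1} \<Longrightarrow> w \<in> {0..1} \<Longrightarrow> \<bar>f_u f t u - f_u f t w\<bar> \<le> C * \<bar>u - w\<bar>"
proof -
  note D = bistable_derivatives[OF f]
  have zero: "f t 0 = 0" "f t 1 = 0" for t using f by (auto simp: bistable_on_average_def)
  obtain N where N: "0 \<le> N" "\<And>t u. u \<in> {0..1} \<Longrightarrow> \<bar>f_uu f t u - f_uu f t 0\<bar> \<le> N"
    using f_uu_oscillation[OF f] by metis
  have "f (t + T) (1/2) = f t (1/2)" for t using f by (auto simp: bistable_on_average_def)
  moreover have "continuous_on UNIV (\<lambda>t. f t (1/2))" by (rule bistable_continuous[OF f]) simp
  ultimately obtain A where A: "0 \<le> A" "\<And>t. \<bar>f t (1/2)\<bar> \<le> A"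
    using periodic_bounded[OF T, of "\<lambda>t. f t (1/2)"] by metis
  have E1: "\<bar>f_u f t u - f_u f t 0 - f_uu f t 0 * u\<bar> \<le> N" if u: "u \<in> {0..1}" for t u
  proof -
    have "((\<lambda>u. f_u f t u - f_uu f t 0 * u) has_real_derivative (f_uu f t x - f_uu f t 0)) (at x within {0..1})"
      if "x \<in> {0..1}" for x
      by (auto intro!: derivative_eq_intros D(2) that)
    then obtain x where x: "0 \<le> x" "x \<le> u"
      "f_u f t u - f_uu f t 0 * u - (f_u f t 0 - f_uu f t 0 * 0) = (f_uu f t x - f_uu f t 0) * (u - 0)"
      using u by (elim mvt_unit_interval[where a = 0 and b = u]) auto
    have "\<bar>(f_uu f t x - f_uu f t 0) * (u - 0)\<bar> \<le> N * 1"
      unfolding abs_mult using x u N by (intro mult_mono) auto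
    then show ?thesis using x(3) by (simp add: algebra_simps)
  qed
  have E2: "\<bar>f t u - f_u f t 0 * u - f_uu f t 0 * u\<^sup>2 / 2\<bar> \<le> N * u" if u: "u \<in> {0..1}" for t u
  proof -
    have "((\<lambda>u. f t u - f_u f t 0 * u - f_uu f t 0 * u\<^sup>2 / 2) has_real_derivative (f_u f t x - f_u f t 0 - f_uu f t 0 * x)) (at x within {0..1})"
      if "x \<in> {0..1}" for x
      by (auto intro!: derivative_eq_intros D(1) that)
    then obtain x where x: "0 \<le> x" "x \<le> u"
      "f t u - f_u f t 0 * u - f_uu f t 0 * u\<^sup>2 / 2 - (f t 0 - f_u f t 0 * 0 - f_uu f t 0 * 0\<^sup>2 / 2)
        = (f_u f t x - f_u f t 0 - f_uu f t 0 * x) * (u - 0)"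
      using u by (elim mvt_unit_interval[where a = 0 and b = u]) auto
    have "\<bar>(f_u f t x - f_u f t 0 - f_uu f t 0 * x) * (u - 0)\<bar> \<le> N * u"
      unfolding abs_mult using x u N E1[of x t] by (intro mult_mono) auto
    then show ?thesis using x(3) zero by simp
  qed
  define C2 where "C2 = 9 * N + 8 * A"
  \<comment> \<open>Half of the relation at 1 combined with the relation at 1/2 eliminates
    \<open>f_u\<close>.\<close>
  have g: "\<bar>f_uu f t 0\<bar> \<le> 8 * N + 8 * A" for t
  proof -
    have "\<bar>- f_u f t 0 - f_uu f t 0 / 2\<bar> \<le> N" using E2[of 1 t] zero by simp
    moreover have "\<bar>f t (1/2) - f_u f t 0 / 2 - f_uu f t 0 / 8\<bar> \<le> N / 2"
      using E2[of "1/2" t] by (simp add: power2_eq_square)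
    ultimately show ?thesis using A(2)[of t] unfolding abs_le_iff by argo
  qed
  have p: "\<bar>f_u f t 0\<bar> \<le> 5 * N + 4 * A" for t
    using E2[of 1 t] zero g[of t] by (simp add: abs_le_iff)
  have uu: "\<bar>f_uu f t u\<bar> \<le> C2" if "u \<in> {0..1}" for t u
    using N(2)[OF that, of t] g[of t] by (simp add: C2_def abs_le_iff)
  have lip: "\<bar>f_u f t u - f_u f t w\<bar> \<le> C2 * \<bar>u - w\<bar>" if uw: "w \<le> u" "u \<in> {0..1}" "w \<in> {0..1}" for t u w
  proof -
    obtain x where x: "w \<le> x" "x \<le> u" "f_u f t u - f_u f t w = f_uu f t x * (u - w)"
      by (rule mvt_unit_interval[where a = w and b = u and F = "f_u f t" and F' = "f_uu f t"]) (use uw D(2) in auto)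
    have "\<bar>f_uu f t x\<bar> \<le> C2" using x uw by (intro uu) auto
    then show ?thesis unfolding x(3) abs_mult by (intro mult_right_mono) auto
  qed
  have lip': "\<bar>f_u f t u - f_u f t w\<bar> \<le> C2 * \<bar>u - w\<bar>" if "u \<in> {0..1}" "w \<in> {0..1}" for t u w
    using lip[of w u t] lip[of u w t] that by (cases "w \<le> u") (auto simp: abs_minus_commute)
  define C where "C = C2 + 5 * N + 4 * A + 1"
  show ?thesis
  proof (rule that[of C])
    have C2: "0 \<le> C2" using N A by (simp add: C2_def)
    then show "0 < C" using N A by (simp add: C_def)
    fix t u w :: real assume u: "u \<in> {0..1}"
    have "C2 * \<bar>u - 0\<bar> \<le> C2 * 1" using u C2 by (intro mult_left_mono) auto
    then show "\<bar>f_u f t u\<bar> \<le> C" using lip'[OF u, of 0 t] p[of t] by (simp add: C_def abs_le_iff)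
    assume w: "w \<in> {0..1}"
    have "C2 * \<bar>u - w\<bar> \<le> C * \<bar>u - w\<bar>" using N A by (intro mult_right_mono) (auto simp: C_def)
    then show "\<bar>f_u f t u - f_u f t w\<bar> \<le> C * \<bar>u - w\<bar>" using lip'[OF u w, of t] by linarith
  qed
qed

lemma bistable_reaction:
  assumes T: "0 < T" and f: "bistable_on_average T f"
  obtains K g \<mu> B a0 a1 P0 P1 where "reaction f K g \<mu> B a0 a1 P0 P1"
proof -
  note D = bistable_derivatives(1)[OF f]
  have zero: "f t 0 = 0" "f t 1 = 0" for t using f by (auto simp: bistable_on_average_def)
  have per: "f (t + T) u = f t u" if "u \<in> {0..1}" for t u using f that by (auto simp: bistable_on_average_def)
  obtain C where C: "0 < C" "\<And>t u. u \<in> {0..1} \<Longrightarrow> \<bar>f_u f t u\<bar> \<le> C"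
    "\<And>t u w. u \<in> {0..1} \<Longrightarrow> w \<in> {0..1} \<Longrightarrow> \<bar>f_u f t u - f_u f t w\<bar> \<le> C * \<bar>u - w\<bar>"
    using bistable_bounds[OF T f] by metis
  have mvt: "\<exists>x. v \<le> x \<and> x \<le> u \<and> f t u - f t v = f_u f t x * (u - v)" if "0 \<le> v" "v \<le> u" "u \<le> 1" for t u v
    by (rule mvt_unit_interval[where F = "f t" and F' = "f_u f t" and a = v and b = u]) (use D that in auto)
  have G0: "\<bar>f t u - f_u f t 0 * u\<bar> \<le> C * u\<^sup>2" if u: "u \<in> {0..1}" for t u
  proof -
    obtain x where x: "0 \<le> x" "x \<le> u" "f t u - f t 0 = f_u f t x * (u - 0)" using mvt[of 0 u t] u by auto
    have "f t u - f_u f t 0 * u = (f_u f t x - f_u f t 0) * u" using x(3) zero by (simp add: algebra_simps)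
    also have "\<bar>\<dots>\<bar> \<le> (C * u) * u"
    proof -
      have "\<bar>f_u f t x - f_u f t 0\<bar> \<le> C * \<bar>x - 0\<bar>" using x u by (intro C) auto
      also have "\<dots> \<le> C * u" using x C(1) by (intro mult_left_mono) auto
      finally show ?thesis unfolding abs_mult using u C(1) by (intro mult_mono) auto
    qed
    finally show ?thesis by (simp add: power2_eq_square mult.assoc)
  qed
  have G1: "\<bar>- f t (1 - u) - f_u f t 1 * u\<bar> \<le> C * u\<^sup>2" if u: "u \<in> {0..1}" for t u
  proof -
    obtain x where x: "1 - u \<le> x" "x \<le> 1" "f t 1 - f t (1 - u) = f_u f t x * (1 - (1 - u))"
      using mvt[of "1 - u" 1 t] u by auto
    have "- f t (1 - u) - f_u f t 1 * u = (f_u f t x - f_u f t 1) * u" using x(3) zero by (simp add: algebra_simps)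
    also have "\<bar>\<dots>\<bar> \<le> (C * u) * u"
    proof -
      have "\<bar>f_u f t x - f_u f t 1\<bar> \<le> C * \<bar>x - 1\<bar>" using x u by (intro C) auto
      also have "\<dots> \<le> C * u" using x C(1) by (intro mult_left_mono) auto
      finally show ?thesis unfolding abs_mult using u C(1) by (intro mult_mono) auto
    qed
    finally show ?thesis by (simp add: power2_eq_square mult.assoc)
  qed
  have s0: "continuous_on UNIV (\<lambda>t. f_u f t 0)" "f_u f (t + T) 0 = f_u f t 0" for t
    using slope_continuous[of f "\<lambda>t. f_u f t 0" C T, OF G0 bistable_continuous[OF f] per] by auto
  have s1: "continuous_on UNIV (\<lambda>t. f_u f t 1)" "f_u f (t + T) 1 = f_u f t 1" for t
  proof -
    have c: "continuous_on UNIV (\<lambda>t. - f t (1 - u))" if "u \<in> {0..1}" for u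
      using that by (intro continuous_on_minus bistable_continuous[OF f]) auto
    have p: "- f (t + T) (1 - u) = - f t (1 - u)" if "u \<in> {0..1}" for t u
      using per[of "1 - u" t] that by simp
    show "continuous_on UNIV (\<lambda>t. f_u f t 1)" "f_u f (t + T) 1 = f_u f t 1"
      using slope_continuous[of "\<lambda>t u. - f t (1 - u)" "\<lambda>t. f_u f t 1" C T, OF G1 c p] by auto
  qed
  define m0 where "m0 = - integral {0..T} (\<lambda>s. f_u f s 0) / T"
  define m1 where "m1 = - integral {0..T} (\<lambda>s. f_u f s 1) / T"
  have m: "0 < m0" "0 < m1" using f T by (auto simp: m0_def m1_def bistable_on_average_def divide_less_0_iff)
  have int: "(\<lambda>s. f_u f s 0) integrable_on {0..T}" "(\<lambda>s. f_u f s 1) integrable_on {0..T}"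
    using s0 s1 by (auto intro!: integrable_continuous_interval elim: continuous_on_subset)
  obtain P0 B0 where P0: "0 \<le> B0" "\<And>t. 0 \<le> t \<Longrightarrow> (P0 has_real_derivative f_u f t 0 + m0) (at t)"
    "\<And>t. 0 \<le> t \<Longrightarrow> \<bar>P0 t\<bar> \<le> B0"
  proof (rule bounded_antiderivative[OF T, of "\<lambda>t. f_u f t 0 + m0"])
    show "integral {0..T} (\<lambda>t. f_u f t 0 + m0) = 0"
      by (subst integral_add[OF int(1) integrable_const_ivl]) (use T in \<open>simp add: m0_def\<close>)
  qed (use s0 in \<open>auto intro!: continuous_intros\<close>)
  obtain P1 B1 where P1: "0 \<le> B1" "\<And>t. 0 \<le> t \<Longrightarrow> (P1 has_real_derivative f_u f t 1 + m1) (at t)"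
    "\<And>t. 0 \<le> t \<Longrightarrow> \<bar>P1 t\<bar> \<le> B1"
  proof (rule bounded_antiderivative[OF T, of "\<lambda>t. f_u f t 1 + m1"])
    show "integral {0..T} (\<lambda>t. f_u f t 1 + m1) = 0"
      by (subst integral_add[OF int(2) integrable_const_ivl]) (use T in \<open>simp add: m1_def\<close>)
  qed (use s1 in \<open>auto intro!: continuous_intros\<close>)
  \<comment> \<open>The smaller of the two decay rates is halved and used at both rest states,
    leaving the other half to absorb the nonlinear error.\<close>
  define \<mu> where "\<mu> = min m0 m1 / 2"
  have \<mu>: "0 < \<mu>" "2 * \<mu> \<le> m0" "2 * \<mu> \<le> m1" using m by (auto simp: \<mu>_def)
  \<comment> \<open>Within distance \<open>\<mu> / C\<close> of a rest state \<open>f_u\<close>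
    changes by at most \<mu>; the bound 1/4 separates the two neighbourhoods.\<close>
  define g where "g = min (1 / 4) (\<mu> / C)"
  have g: "0 < g" "g < 1 / 2" using \<mu> C(1) by (auto simp: g_def)
  have Cg: "C * g \<le> \<mu>"
  proof -
    have "C * g \<le> C * (\<mu> / C)" using C(1) by (intro mult_left_mono) (auto simp: g_def)
    then show ?thesis using C(1) by simp
  qed
  have near: "f t u - f t v \<le> (f_u f t e + d + \<mu>) * (u - v)"
    if uv: "0 \<le> v" "v \<le> u" "u \<le> 1" and e: "e \<in> {0..1}" "\<And>x. v \<le> x \<Longrightarrow> x \<le> u \<Longrightarrow> \<bar>x - e\<bar> \<le> g" and d: "0 \<le> d" for t u v e d
  proof -
    obtain x where x: "v \<le> x" "x \<le> u" "f t u - f t v = f_u f t x * (u - v)" using mvt[OF uv, of t] by blast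
    have "\<bar>f_u f t x - f_u f t e\<bar> \<le> C * \<bar>x - e\<bar>" using x uv e by (intro C) auto
    also have "\<dots> \<le> C * g" using e(2)[OF x(1,2)] C(1) by (intro mult_left_mono) auto
    finally have "f_u f t x \<le> f_u f t e + d + \<mu>" using Cg d by linarith
    then show ?thesis unfolding x(3) using uv by (intro mult_right_mono) auto
  qed
  define a0 where "a0 = (\<lambda>t. f_u f t 0 + (m0 - 2 * \<mu>))"
  define a1 where "a1 = (\<lambda>t. f_u f t 1 + (m1 - 2 * \<mu>))"
  \<comment> \<open>Besides \<open>\<bar>f_u\<bar> \<le> C\<close>, this must dominate the shifted
    slopes \<open>a0 t + \<mu>\<close> and \<open>a1 t + \<mu>\<close>.\<close>
  define K where "K = C + m0 + m1"
  have "reaction f K g \<mu> (B0 + B1) a0 a1 P0 P1"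
  proof
    show "0 < K" using C m by (simp add: K_def)
    show "0 \<le> B0 + B1" using P0 P1 by simp
    fix u v t :: real
    show "\<bar>f t u - f t v\<bar> \<le> K * (u - v)" if uv: "0 \<le> v" "v \<le> u" "u \<le> 1"
    proof -
      obtain x where x: "v \<le> x" "x \<le> u" "f t u - f t v = f_u f t x * (u - v)" using mvt[OF uv, of t] by blast
      have "\<bar>f_u f t x\<bar> \<le> C" using x uv by (intro C) auto
      then have "\<bar>f_u f t x\<bar> \<le> K" using m by (simp add: K_def)
      then show ?thesis unfolding x(3) abs_mult using uv by (intro mult_mono) auto
    qed
    show "f t u - f t v \<le> (a0 t + \<mu>) * (u - v)" if "0 \<le> v" "v \<le> u" "u \<le> g"
      unfolding a0_def using that g \<mu> by (intro near) auto
    show "f t u - f t v \<le> (a1 t + \<mu>) * (u - v)" if "1 - g \<le> v" "v \<le> u" "u \<le> 1"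
      unfolding a1_def using that g \<mu> by (intro near) auto
    show "a0 t + \<mu> \<le> K" "a1 t + \<mu> \<le> K"
      using C(2)[of 0 t] C(2)[of 1 t] \<mu> m by (auto simp: a0_def a1_def K_def)
    show "(P0 has_real_derivative a0 t + 2 * \<mu>) (at t)" "(P1 has_real_derivative a1 t + 2 * \<mu>) (at t)"
      "\<bar>P0 t\<bar> \<le> B0 + B1" "\<bar>P1 t\<bar> \<le> B0 + B1" if "0 \<le> t"
      using P0(2,3)[OF that] P1(2,3)[OF that] P0(1) P1(1) by (simp_all add: a0_def a1_def)
  qed (use g \<mu> zero in auto)
  then show ?thesis by (rule that)
qed

section \<open>From classical solutions to the moving frame\<close>

lemma C12_on_derivatives:
  assumes "C12_on I w" "t \<in> I"
  shows "((\<lambda>s. w s x) has_real_derivative D_t w t x) (at t)"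
    and "(w t has_real_derivative D_x w t x) (at x)"
    and "(D_x w t has_real_derivative D_xx w t x) (at x)"
  using assms unfolding C12_on_def D_t_def D_x_def D_xx_def
  by (simp_all add: DERIV_deriv_iff_real_differentiable)

text \<open>The time derivative along a moving line needs joint differentiability, which follows
  from the \<open>t\<close>-partial at the point and continuity of the \<open>x\<close>-partial. The
  parameter \<open>d\<close> is the additional speed: \<open>d = c\<close> turns a Cauchy solution
  at rest into the moving frame, \<open>d = 0\<close> serves the front.\<close>

lemma C12_on_residual_moving:
  assumes w: "C12_on I w" and I: "open I" and t: "t \<in> I"
  shows "residual (c + d) (\<lambda>t x. w t (x + d * t)) t x
     (D_t w t (x + d * t) - c * D_x w t (x + d * t) - D_xx w t (x + d * t))"
proof -
  define y where "y = x + d * t"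
  have "((\<lambda>(s, z). w s z) has_derivative (\<lambda>(ts, tz). D_t w t y * ts + blinfun_mult_right (D_x w t y) tz))
      (at (t, y) within I \<times> UNIV)"
  proof (rule has_derivative_partialsI)
    show "((\<lambda>s. w s y) has_derivative (*) (D_t w t y)) (at t within I)"
      using C12_on_derivatives(1)[OF w t, of y] unfolding has_field_derivative_def
      by (rule has_derivative_at_withinI)
    show "((\<lambda>z. w s z) has_derivative blinfun_mult_right (D_x w s z)) (at z)" if "s \<in> I" for s z
      using C12_on_derivatives(2)[OF w that, of z] by (simp add: has_field_derivative_def)
    have "continuous_on (I \<times> UNIV) (\<lambda>(s, z). D_x w s z)" using w by (simp add: C12_on_def)
    then have "continuous_on (I \<times> UNIV) (\<lambda>p. blinfun_mult_right ((\<lambda>(s, z). D_x w s z) p))"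
      by (rule bounded_linear.continuous_on[OF bounded_linear_blinfun_mult_right])
    then show "continuous (at (t, y) within I \<times> UNIV) (\<lambda>(s, z). blinfun_mult_right (D_x w s z))"
      using t by (simp add: continuous_on_eq_continuous_within case_prod_unfold)
  qed auto
  moreover have "at (t, y) within I \<times> UNIV = at (t, y)"
    using t I by (intro at_within_open) (auto intro: open_Times)
  ultimately have F: "((\<lambda>(s, z). w s z) has_derivative (\<lambda>(ts, tz). D_t w t y * ts + D_x w t y * tz)) (at (t, x + d * t))"
    by (simp add: y_def)
  have pair: "((\<lambda>s. (s, x + d * s)) has_derivative (\<lambda>h. (h, d * h))) (at t)"
    by (auto intro!: derivative_eq_intros)
  have wt: "((\<lambda>s. w s (x + d * s)) has_real_derivative (D_t w t y + d * D_x w t y)) (at t)"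
  proof -
    have "(\<lambda>h. D_t w t y * h + D_x w t y * (d * h)) = (*) (D_t w t y + d * D_x w t y)"
      by (auto simp: algebra_simps)
    then show ?thesis using has_derivative_compose[OF pair F] by (simp add: has_field_derivative_def)
  qed
  show ?thesis
  proof (rule residualI[where wx = "\<lambda>x. D_x w t (x + d * t)"], rule wt)
    show "((\<lambda>x. w t (x + d * t)) has_real_derivative D_x w t (z + d * t)) (at z)" for z
      using C12_on_derivatives(2)[OF w t] by (simp add: DERIV_shift[symmetric])
    show "((\<lambda>x. D_x w t (x + d * t)) has_real_derivative D_xx w t y) (at x)"
      using C12_on_derivatives(3)[OF w t] by (simp add: DERIV_shift[symmetric] y_def)
  qed (simp add: y_def algebra_simps)
qed

lemma cauchy_solution_sol:
  assumes u: "cauchy_solution f h u"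
  shows "sol f c 0 (\<lambda>t x. u t (x + c * t))"
proof -
  have "continuous_on ({0..} \<times> UNIV) ((\<lambda>(t, x). u t x) \<circ> (\<lambda>(t, x). (t, x + c * t)))"
    using u unfolding cauchy_solution_def
    by (intro continuous_on_compose) (auto simp: case_prod_beta intro!: continuous_intros elim!: continuous_on_subset)
  then have "continuous_on ({0..} \<times> UNIV) (\<lambda>(t, x). u t (x + c * t))"
    by (simp add: o_def case_prod_beta)
  moreover have "residual c (\<lambda>t x. u t (x + c * t)) t x (f t (u t (x + c * t)))" if "0 < t" for t x
    using C12_on_residual_moving[of "{0<..}" u t 0 c x] u that by (simp add: cauchy_solution_def)
  ultimately show ?thesis using u by (auto simp: sol_def cauchy_solution_def)
qed

lemma pulsating_front_front:
  assumes T: "0 < T" and r: "reaction f K g \<mu> B a0 a1 P0 P1" and U: "pulsating_front T f c U"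
  shows "front f K g \<mu> B a0 a1 P0 P1 T c U"
proof -
  interpret reaction f K g \<mu> B a0 a1 P0 P1 by fact
  have C: "C12_on UNIV U" using U by (simp add: pulsating_front_def)
  have "sol f c 0 U" unfolding sol_def
  proof (intro conjI allI impI)
    show "continuous_on ({0..} \<times> UNIV) (\<lambda>(t, x). U t x)"
      using C unfolding C12_on_def by (auto elim!: continuous_on_subset)
    fix t x :: real
    have "D_t U t x - c * D_x U t x - D_xx U t x = f t (U t x)"
      using U by (simp add: pulsating_front_def)
    then show "residual c U t x (f t (U t x))"
      using C12_on_residual_moving[OF C open_UNIV UNIV_I, of c 0 t x] by simp
  qed (use U in \<open>auto simp: pulsating_front_def\<close>)
  moreover have "\<exists>R. \<forall>t. \<forall>x\<ge>R. U t x \<le> e" if "0 < e" for e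
  proof -
    have "uniform_limit UNIV (\<lambda>\<xi> t. U t \<xi>) (\<lambda>t. 0) at_top" using U by (simp add: pulsating_front_def)
    from uniform_limitD[OF this that] obtain R where "\<And>t x. R \<le> x \<Longrightarrow> \<bar>U t x\<bar> < e"
      by (auto simp: eventually_at_top_linorder)
    then show ?thesis by (metis abs_le_D1 less_imp_le)
  qed
  moreover have "\<exists>R. \<forall>t. \<forall>x\<le>R. 1 - e \<le> U t x" if "0 < e" for e
  proof -
    have "uniform_limit UNIV (\<lambda>\<xi> t. U t \<xi>) (\<lambda>t. 1) at_bot" using U by (simp add: pulsating_front_def)
    from uniform_limitD[OF this that] obtain R where R: "\<And>t x. x \<le> R \<Longrightarrow> \<bar>U t x - 1\<bar> < e"
      by (auto simp: eventually_at_bot_linorder dist_real_def)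
    have "1 - e \<le> U t x" if "x \<le> R" for t x using R[OF that, of t] by linarith
    then show ?thesis by blast
  qed
  ultimately show ?thesis using T U by unfold_locales (auto simp: pulsating_front_def)
qed

theorem theorem1p2:
  fixes T :: real and f :: "real \<Rightarrow> real \<Rightarrow> real"
  assumes "T > 0" and "bistable_on_average T f"
  shows "\<exists>\<gamma>\<in>{0<..<1}. \<forall>c U. pulsating_front T f c U \<longrightarrow>
    (\<forall>h u. range h \<subseteq> {0..1} \<longrightarrow> uniformly_continuous_on UNIV h \<longrightarrow> cauchy_solution f h u \<longrightarrow>
       Liminf at_bot (\<lambda>\<xi>. ereal (h \<xi>)) > ereal (1 - \<gamma>) \<longrightarrow>
       Limsup at_top (\<lambda>\<xi>. ereal (h \<xi>)) < ereal \<gamma> \<longrightarrow>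
       (let v = (\<lambda>t \<xi>. u t (\<xi> + c * t)) in
        \<exists>\<xi>\<^sub>0. uniform_limit UNIV (\<lambda>t \<xi>. v t \<xi> - U t (\<xi> + \<xi>\<^sub>0)) (\<lambda>\<xi>. 0) at_top))"
proof -
  obtain K g \<mu> B a0 a1 P0 P1 where r: "reaction f K g \<mu> B a0 a1 P0 P1"
    using bistable_reaction[OF assms] by metis
  then interpret reaction f K g \<mu> B a0 a1 P0 P1 .
  \<comment> \<open>Fixed before \<open>c\<close> and \<open>U\<close> are introduced, so it depends
    on the nonlinearity only; the divisor offsets the largest possible growth of the periodic
    weight.\<close>
  define \<gamma> where "\<gamma> = g / exp (2 * B)"
  have \<gamma>: "0 < \<gamma>" "\<gamma> * exp (2 * B) = g" using g by (auto simp: \<gamma>_def)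
  have "\<gamma> * 1 \<le> \<gamma> * exp (2 * B)" using \<gamma>(1) B by (intro mult_left_mono) auto
  then have \<gamma>1: "\<gamma> < 1" using \<gamma>(2) g(2) by simp
  show ?thesis
  proof (rule bexI[of _ \<gamma>], intro allI impI, unfold Let_def)
    fix c U h u
    assume U: "pulsating_front T f c U" and u: "cauchy_solution f h u"
      and lo: "ereal (1 - \<gamma>) < Liminf at_bot (\<lambda>\<xi>. ereal (h \<xi>))"
      and up: "Limsup at_top (\<lambda>\<xi>. ereal (h \<xi>)) < ereal \<gamma>"
    interpret front f K g \<mu> B a0 a1 P0 P1 T c U
      by (rule pulsating_front_front[OF assms(1) r U])
    have h: "u 0 x = h x" for x using u by (simp add: cauchy_solution_def)
    obtain X where X: "\<And>x. X \<le> x \<Longrightarrow> h x < \<gamma>"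
      using Limsup_lessD[OF up] by (auto simp: eventually_at_top_linorder)
    obtain Y where Y: "\<And>x. x \<le> Y \<Longrightarrow> 1 - \<gamma> < h x"
      using less_LiminfD[OF lo] by (auto simp: eventually_at_bot_linorder)
    have "\<exists>\<sigma>. \<forall>\<epsilon>>0. \<exists>\<tau>. \<forall>t\<ge>\<tau>. \<forall>x. \<bar>u t (x + c * t) - U t (x - \<sigma>)\<bar> \<le> \<epsilon>"
    proof (rule front_attracts[OF cauchy_solution_sol[OF u], of \<gamma> X Y])
      show "u 0 (x + c * 0) \<le> \<gamma>" if "X \<le> x" for x using X[OF that] h by simp
      show "1 - \<gamma> \<le> u 0 (x + c * 0)" if "x \<le> Y" for x using Y[OF that] h by simp
    qed (use \<gamma> in auto)
    then obtain \<sigma> where \<sigma>: "\<And>\<epsilon>. 0 < \<epsilon> \<Longrightarrow> \<exists>\<tau>. \<forall>t\<ge>\<tau>. \<forall>x. \<bar>u t (x + c * t) - U t (x - \<sigma>)\<bar> \<le> \<epsilon>"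
      by blast
    show "\<exists>\<xi>\<^sub>0. uniform_limit UNIV (\<lambda>t \<xi>. u t (\<xi> + c * t) - U t (\<xi> + \<xi>\<^sub>0)) (\<lambda>\<xi>. 0) at_top"
    proof (rule exI[of _ "- \<sigma>"], rule uniform_limitI)
      fix e :: real assume e: "0 < e"
      then obtain \<tau> where \<tau>: "\<And>t x. \<tau> \<le> t \<Longrightarrow> \<bar>u t (x + c * t) - U t (x - \<sigma>)\<bar> \<le> e / 2"
        using \<sigma>[of "e / 2"] by auto
      have "\<bar>u t (x + c * t) - U t (x - \<sigma>)\<bar> < e" if "\<tau> \<le> t" for t x
        using \<tau>[OF that, of x] e by linarith
      then show "\<forall>\<^sub>F t in at_top. \<forall>x\<in>UNIV. dist (u t (x + c * t) - U t (x + - \<sigma>)) 0 < e"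
        by (auto simp: eventually_at_top_linorder intro!: exI[of _ \<tau>])
    qed
  qed (use \<gamma>(1) \<gamma>1 in simp)
qed

end
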